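(* Let $f$ be a nonconstant meromorphic function of zero order on $\mathbb{C}^m$, let $q=(\tilde q,\ldots,\tilde q)\in\mathbb{C}^m$ with $\tilde q\in\mathbb{C}\setminus\{0,1\}$, and let $c=(c_1,\ldots,c_m)\in\mathbb{C}^m$. Then $$m\left(r,\frac{f(q\cdot z+c)}{f(z)}\right)=\int_{S_m(r)}\log^+\left|\frac{f(\tilde q z_1+c_1,\ldots,\tilde q z_m+c_m)}{f(z_1,\ldots,z_m)}\right|\eta_m(z)=o(T_f(r))$$ for all $r=\|z\|$ on a set of logarithmic density one (that is, there is a set $E\subset[1,\infty)$ of logarithmic density one such that the estimate holds as $r\to\infty$ with $r\in E$).
   Context: For $z\in\mathbb{C}^m$, $\|z\|=(|z_1|^2+\cdots+|z_m|^2)^{1/2}$ and $S_m(r)=\{z\in\mathbb{C}^m:\|z\|=r\}$. With $d=\partial+\overline\partial$ and $d^c=(4\pi\sqrt{-1})^{-1}(\partial-\overline\partial)$, put $\sigma_m(z)=(dd^c\log\|z\|^2)^{m-1}$ and $\eta_m(z)=d^c\log\|z\|^2\wedge\sigma_m(z)$ on $\mathbb{C}^m\setminus\{0\}$. For $x>0$, $\log^+x=\max\{\log x,0\}$. The proximity function of a meromorphic function $h$ is $m(r,h)=\int_{S_m(r)}\log^+|h(z)|\eta_m(z)$. Here $q\cdot z=(q_1z_1,\ldots,q_mz_m)$. A meromorphic function $f$ on $\mathbb{C}^m$ is regarded as a meromorphic mapping into $\mathbb{P}^1(\mathbb{C})$ with a reduced representation $[f_0,f_1]$ ($f_0,f_1$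 entire with no common factors other than units). The characteristic function is $T_f(r)=\int_{S_m(r)}\log\|f\|\eta_m-\int_{S_m(1)}\log\|f\|\eta_m$ with $\|f\|=(|f_0|^2+|f_1|^2)^{1/2}$. The order of $f$ is $\zeta(f)=\limsup_{r\to\infty}\frac{\log^+T_f(r)}{\log r}$; "zero order" means $\zeta(f)=0$. A set $E\subset[1,\infty)$ has logarithmic density one if $\lim_{r\to\infty}\frac1{\log r}\int_{E\cap[1,r]}\frac{dt}{t}=1$. *)

theory Defs
  imports "HOL-Analysis.Analysis" "HOL-Library.Landau_Symbols"
begin

section \<open>Differential forms on complex coordinate space\<close>

text \<open>A form of degree k at a point is an alternating multilinear function of
  k tangent vectors, represented as a function that only looks at the entries
  0, ..., k-1 of a sequence of vectors.\<close>

type_synonym 'm form = "(nat \<Rightarrow> complex ^ 'm) \<Rightarrow> complex"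

definition wedge :: "nat \<Rightarrow> nat \<Rightarrow> 'm form \<Rightarrow> 'm form \<Rightarrow> 'm form" where
  "wedge k l a b = (\<lambda>v. (\<Sum>p | p permutes {..<k + l}.
      of_int (sign p) * a (\<lambda>i. v (p i)) * b (\<lambda>i. v (p (k + i)))) / (fact k * fact l))"

fun wedge_power2 :: "'m form \<Rightarrow> nat \<Rightarrow> 'm form" where
  "wedge_power2 w 0 = (\<lambda>v. 1)"
| "wedge_power2 w (Suc n) = wedge 2 (2 * n) w (wedge_power2 w n)"

definition ext_deriv ::
    "nat \<Rightarrow> (complex ^ 'm::finite \<Rightarrow> 'm form) \<Rightarrow> complex ^ 'm \<Rightarrow> 'm form" where
  "ext_deriv k w z = (\<lambda>v. \<Sum>i\<le>k. (- 1) ^ i *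
      frechet_derivative (\<lambda>y. w y (\<lambda>j. if j < i then v j else v (Suc j))) (at z) (v i))"

text \<open>The (1,0)-part and the (0,1)-part of the differential of a function;
  \<open>\<i> *s v\<close> is the complex structure applied to the tangent vector v.\<close>

definition del :: "(complex ^ 'm::finite \<Rightarrow> complex) \<Rightarrow> complex ^ 'm \<Rightarrow> 'm form" where
  "del u z = (\<lambda>v. (frechet_derivative u (at z) (v 0)
      - \<i> * frechet_derivative u (at z) (\<i> *s v 0)) / 2)"

definition delbar :: "(complex ^ 'm::finite \<Rightarrow> complex) \<Rightarrow> complex ^ 'm \<Rightarrow> 'm form" where
  "delbar u z = (\<lambda>v. (frechet_derivative u (at z) (v 0)
      + \<i> * frechet_derivative u (at z) (\<i> *s v 0)) / 2)"

definition dc :: "(complex ^ 'm::finite \<Rightarrow> complex) \<Rightarrow> complex ^ 'm \<Rightarrow> 'm form" where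
  "dc u z = (\<lambda>v. (del u z v - delbar u z v) / (4 * of_real pi * \<i>))"

definition log_norm_sq :: "complex ^ 'm::finite \<Rightarrow> complex" where
  "log_norm_sq z = of_real (ln ((norm z)\<^sup>2))"

definition sigma_form :: "complex ^ 'm::finite \<Rightarrow> 'm form" where
  "sigma_form z = wedge_power2 (ext_deriv 1 (dc log_norm_sq) z) (CARD('m) - 1)"

definition eta_form :: "complex ^ 'm::finite \<Rightarrow> 'm form" where
  "eta_form z = wedge 1 (2 * (CARD('m) - 1)) (dc log_norm_sq z) (sigma_form z)"


section \<open>Integration over spheres centred at the origin\<close>

text \<open>Euclidean surface measure on the sphere of radius r > 0, as a measure on the ambient
  space: the area of a part A of the sphere is dim / r times the volume of the cone
  \<open>{t x | 0 < t \<le> 1, x \<in> A}\<close>.\<close>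

definition sphere_measure :: "real \<Rightarrow> 'a::euclidean_space measure" where
  "sphere_measure r = scale_measure (ennreal (real DIM('a) / r))
     (distr (restrict_space lborel (cball 0 r)) borel (\<lambda>x. (r / norm x) *\<^sub>R x))"

text \<open>The frame e1, i e1, e2, i e2, ...  It is positively oriented, and its orientation does
  not depend on the enumeration of the coordinates.\<close>

definition std_frame :: "nat \<Rightarrow> complex ^ 'm::finite" where
  "std_frame k = axis (from_nat_into (UNIV :: 'm set) (k div 2)) (if even k then 1 else \<i>)"

text \<open>The sphere is oriented as the boundary of the ball (outward normal first). If w has degree
  2m-1, its value on a positively oriented orthonormal basis of the tangent space of the sphere
  through z is the value of \<open>dr \<and> w\<close>, with r the distance to the origin, on a positively
  oriented orthonormal basis of the whole space. All forms integrated below are real, so that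
  taking the real part only changes the type. The measure is completed because
  meromorphic functions are only determined outside a set of measure zero.\<close>

definition conormal :: "complex ^ 'm::finite \<Rightarrow> 'm form" where
  "conormal z = (\<lambda>v. of_real ((z /\<^sub>R norm z) \<bullet> v 0))"

definition sphere_density :: "(complex ^ 'm::finite \<Rightarrow> 'm form) \<Rightarrow> complex ^ 'm \<Rightarrow> real" where
  "sphere_density w z = Re (wedge 1 (2 * CARD('m) - 1) (conormal z) (w z) std_frame)"

definition sphere_integral ::
    "real \<Rightarrow> (complex ^ 'm::finite \<Rightarrow> real) \<Rightarrow> (complex ^ 'm \<Rightarrow> 'm form) \<Rightarrow> real" where
  "sphere_integral r g w =
     (LINT z | completion (sphere_measure r). g z * sphere_density w z)"


section \<open>Meromorphic functions of several variables\<close>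

definition holomorphic_Cm :: "(complex ^ 'm::finite \<Rightarrow> complex) \<Rightarrow> (complex ^ 'm) set \<Rightarrow> bool" where
  "holomorphic_Cm f U \<longleftrightarrow> (\<forall>z\<in>U. \<exists>D. (f has_derivative D) (at z) \<and>
      (\<forall>a v. D (a *s v) = a * D v))"

abbreviation entire_Cm :: "(complex ^ 'm::finite \<Rightarrow> complex) \<Rightarrow> bool" where
  "entire_Cm f \<equiv> holomorphic_Cm f UNIV"

text \<open>Locally a quotient of holomorphic functions with denominator not identically zero; the
  values at zeros of the denominators carry no information.\<close>

definition meromorphic_Cm :: "(complex ^ 'm::finite \<Rightarrow> complex) \<Rightarrow> bool" where
  "meromorphic_Cm f \<longleftrightarrow> (\<forall>p. \<exists>e>0. \<exists>g h.
      holomorphic_Cm g (ball p e) \<and> holomorphic_Cm h (ball p e) \<and>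
      (\<exists>z\<in>ball p e. h z \<noteq> 0) \<and> (\<forall>z\<in>ball p e. h z \<noteq> 0 \<longrightarrow> f z = g z / h z))"

definition unit_entire :: "(complex ^ 'm::finite \<Rightarrow> complex) \<Rightarrow> bool" where
  "unit_entire g \<longleftrightarrow> entire_Cm g \<and> (\<exists>k. entire_Cm k \<and> (\<forall>z. g z * k z = 1))"

definition dvd_entire ::
    "(complex ^ 'm::finite \<Rightarrow> complex) \<Rightarrow> (complex ^ 'm \<Rightarrow> complex) \<Rightarrow> bool" where
  "dvd_entire g f \<longleftrightarrow> entire_Cm g \<and> (\<exists>h. entire_Cm h \<and> (\<forall>z. f z = g z * h z))"

text \<open>The homogeneous coordinates are such that \<open>f = [f0, f1]\<close> corresponds to the
  quotient \<open>f1 / f0\<close>.\<close>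

definition reduced_representation ::
    "(complex ^ 'm::finite \<Rightarrow> complex) \<Rightarrow> (complex ^ 'm \<Rightarrow> complex) \<Rightarrow> (complex ^ 'm \<Rightarrow> complex) \<Rightarrow> bool"
  where
  "reduced_representation f f0 f1 \<longleftrightarrow> entire_Cm f0 \<and> entire_Cm f1 \<and> (\<exists>z. f0 z \<noteq> 0) \<and>
     (\<forall>g. dvd_entire g f0 \<and> dvd_entire g f1 \<longrightarrow> unit_entire g) \<and>
     (\<forall>z. f0 z \<noteq> 0 \<longrightarrow> f z = f1 z / f0 z)"


section \<open>Nevanlinna functions\<close>

text \<open>Note \<open>ln 0 = 0\<close>, so that \<open>log_plus 0 = 0\<close>.\<close>

definition log_plus :: "real \<Rightarrow> real" where
  "log_plus x = max (ln x) 0"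

definition proximity :: "real \<Rightarrow> (complex ^ 'm::finite \<Rightarrow> complex) \<Rightarrow> real" where
  "proximity r h = sphere_integral r (\<lambda>z. log_plus (cmod (h z))) eta_form"

text \<open>The characteristic function of the map with reduced representation \<open>[f0, f1]\<close>; it does not
  depend on the choice of the representation.\<close>

definition characteristic ::
    "(complex ^ 'm::finite \<Rightarrow> complex) \<Rightarrow> (complex ^ 'm \<Rightarrow> complex) \<Rightarrow> real \<Rightarrow> real" where
  "characteristic f0 f1 r =
     sphere_integral r (\<lambda>z. ln (sqrt ((cmod (f0 z))\<^sup>2 + (cmod (f1 z))\<^sup>2))) eta_form
   - sphere_integral 1 (\<lambda>z. ln (sqrt ((cmod (f0 z))\<^sup>2 + (cmod (f1 z))\<^sup>2))) eta_form"

definition growth_order :: "(real \<Rightarrow> real) \<Rightarrow> ereal" where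
  "growth_order T = Limsup at_top (\<lambda>r. ereal (log_plus (T r) / ln r))"

definition log_density_one :: "real set \<Rightarrow> bool" where
  "log_density_one E \<longleftrightarrow> E \<subseteq> {1..} \<and> E \<in> sets lebesgue \<and>
     ((\<lambda>r. 1 / ln r * (LINT t:E \<inter> {1..r}|lebesgue. 1 / t)) \<longlongrightarrow> 1) at_top"

end

theory Submission
  imports Defs "HOL-Complex_Analysis.Cauchy_Integral_Formula"
begin

text \<open>The form \<open>\<eta>\<close> is invariant under unitary maps and homogeneous, so its density
  on a sphere is a constant multiple of the area density; up to a constant factor, all integrals are
  spherical means. The value and the sign of the factor are irrelevant to the statement.

  In place of the Poisson-Jensen formula, \<open>log |F|\<close> for entire F is compared with its average
  over the ball of radius R around the point. The difference is nonnegative by subharmonicity, and its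
  integral over a shell is bounded by an increment of the spherical mean of \<open>log |F|\<close>.
  Applied to \<open>f0\<close> and \<open>f1\<close> at z and at \<open>q z + c\<close>, this reduces the proximity
  function to the difference of two ball averages of \<open>log |f|\<close>. Their centres have norm
  \<open>O(r)\<close>, so for R a large multiple of r the balls differ inside a thin shell, whose contribution
  is \<open>\<epsilon>\<close> times the growth at the scale R. Hence, integrated over \<open>r \<le> |z| \<le> 2 r\<close>,
  the proximity function is bounded by \<open>\<epsilon>\<close> times the characteristic function plus its
  increments between radii comparable to r. For zero order these increments are small relative to
  the function on most dyadic blocks, and Chebyshev's inequality yields the exceptional set.\<close>

section \<open>The density of the form on spheres\<close>

text \<open>Two obstacles shape the argument. The logarithms are singular on zero sets, which
  \<open>ln 0 = 0\<close> hides: hence the continuous regularisation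
  \<open>ln (nsq z + \<epsilon>) / 2\<close>, and the extended nonnegative \<open>gap B z\<close>,
  an upper bound B minus the logarithm, infinite at zeros. For it Tonelli and monotone convergence
  hold without integrability, and its finite integrals show that zero sets are null. Second, no
  estimate is attempted at a single radius: over a dyadic shell, monotone spherical means and a
  change of variables suffice, at the price of an exceptional set of radii. Monotonicity and growth
  of the means have one source, convexity in \<open>ln r\<close>, which is the maximum principle on
  complex lines through 0. Nonconstancy makes the characteristic unbounded, so that it absorbs
  additive constants. Zero order enters only as \<open>ln (Psi r) = o(ln r)\<close>: the sum of
  block increments telescopes to boundedly many values of \<open>ln Psi\<close>. The increments that
  occur are those of log |f0| and log |f1|, the main term is the characteristic; \<open>Psi\<close>
  adds all three.\<close>

text \<open>Real linearity, because \<open>dc_log\<close> and \<open>ddc_log\<close> are forms on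
  the underlying real space. The second condition is the convention that a form of degree k reads
  only the entries below k. Alternation is supplied by \<open>wedge\<close> itself.\<close>

definition multilinear_form :: "nat \<Rightarrow> 'm::finite form \<Rightarrow> bool" where
  "multilinear_form k a \<longleftrightarrow>
     (\<forall>i<k. \<forall>v x y s t. a (v(i := s *\<^sub>R x + t *\<^sub>R y)) = s *\<^sub>R a (v(i := x)) + t *\<^sub>R a (v(i := y))) \<and>
     (\<forall>v w. (\<forall>i<k. v i = w i) \<longrightarrow> a v = a w)"

lemma multilinear_formD:
  assumes "multilinear_form k a" "i < k"
  shows "a (v(i := s *\<^sub>R x + t *\<^sub>R y)) = s *\<^sub>R a (v(i := x)) + t *\<^sub>R a (v(i := y))"
  using assms unfolding multilinear_form_def by blast

lemma multilinear_form_cong: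
  assumes "multilinear_form k a" "\<And>i. i < k \<Longrightarrow> v i = w i"
  shows "a v = a w"
  using assms unfolding multilinear_form_def by blast

text \<open>Each permutation sends exactly one position to the entry j, and this position belongs
  either to a or to b. So in each summand one factor depends on entry j, and it is linear in
  it.\<close>

lemma multilinear_form_wedge:
  fixes a b :: "'m::finite form"
  assumes a: "multilinear_form k a" and b: "multilinear_form l b"
  shows "multilinear_form (k + l) (wedge k l a b)"
  unfolding multilinear_form_def
proof (intro conjI allI impI)
  fix j v and x y :: "complex ^ 'm" and s t :: real
  assume j: "j < k + l"
  let ?T = "\<lambda>w p. of_int (sign p) * a (\<lambda>i. w (p i)) * b (\<lambda>i. w (p (k + i))) :: complex"
  have *: "?T (v(j := s *\<^sub>R x + t *\<^sub>R y)) p = s *\<^sub>R ?T (v(j := x)) p + t *\<^sub>R ?T (v(j := y)) p"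
    if p: "p permutes {..<k + l}" for p
  proof -
    have inj: "inj p" using p permutes_inj by blast
    obtain i where i: "p i = j" using p by (metis permutes_surj surjD)
    then have il: "i < k + l" using j p by (metis lessThan_iff permutes_in_image)
    have upd: "(\<lambda>i. (v(j := z)) (p i)) = (\<lambda>i. v (p i))(i := z)" for z
      using i inj by (auto simp: fun_eq_iff inj_eq)
    show ?thesis
    proof (cases "i < k")
      case True
      have "(\<lambda>i. (v(j := z)) (p (k + i))) = (\<lambda>i. v (p (k + i)))" for z
        using i inj True by (force simp: fun_eq_iff dest: injD)
      then show ?thesis unfolding upd
        by (simp add: multilinear_formD[OF a True] algebra_simps)
    next
      case False
      define i' where "i' = i - k"
      have i': "i = k + i'" "i' < l" using False il by (auto simp: i'_def)
      have 1: "(\<lambda>i. (v(j := z)) (p (k + i))) = (\<lambda>i. v (p (k + i)))(i' := z)" for z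
        using i i' inj by (auto simp: fun_eq_iff inj_eq)
      have 2: "a (\<lambda>i. (v(j := z)) (p i)) = a (\<lambda>i. v (p i))" for z
        using i i' inj by (intro multilinear_form_cong[OF a]) (auto dest: injD)
      show ?thesis unfolding 1 2
        by (simp add: multilinear_formD[OF b i'(2)] algebra_simps)
    qed
  qed
  have "(\<Sum>p | p permutes {..<k + l}. ?T (v(j := s *\<^sub>R x + t *\<^sub>R y)) p) =
    s *\<^sub>R (\<Sum>p | p permutes {..<k + l}. ?T (v(j := x)) p) +
    t *\<^sub>R (\<Sum>p | p permutes {..<k + l}. ?T (v(j := y)) p)"
    unfolding scaleR_right.sum sum.distrib[symmetric] by (intro sum.cong refl *) auto
  then show "wedge k l a b (v(j := s *\<^sub>R x + t *\<^sub>R y)) =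
    s *\<^sub>R wedge k l a b (v(j := x)) + t *\<^sub>R wedge k l a b (v(j := y))"
    unfolding wedge_def by (simp only: add_divide_distrib scaleR_conv_of_real times_divide_eq_right)
next
  fix v w :: "nat \<Rightarrow> complex ^ 'm"
  assume eq: "\<forall>i<k + l. v i = w i"
  have "a (\<lambda>i. v (p i)) = a (\<lambda>i. w (p i)) \<and> b (\<lambda>i. v (p (k + i))) = b (\<lambda>i. w (p (k + i)))"
    if p: "p permutes {..<k + l}" for p
  proof -
    have "p i < k + l" if "i < k + l" for i
      using p that by (metis lessThan_iff permutes_in_image)
    then show ?thesis using eq
      by (intro conjI multilinear_form_cong[OF a] multilinear_form_cong[OF b]) auto
  qed
  then show "wedge k l a b v = wedge k l a b w"
    unfolding wedge_def by (intro arg_cong2[where f="(/)"] sum.cong refl) auto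
qed

lemma multilinear_form_wedge_power2:
  assumes "multilinear_form 2 a"
  shows "multilinear_form (2 * n) (wedge_power2 a n)"
proof (induction n)
  case 0
  then show ?case by (simp add: multilinear_form_def)
next
  case (Suc n)
  then show ?case using multilinear_form_wedge[OF assms] by simp
qed

text \<open>Substitution of \<open>q \<circ> p\<close> for p in the sum over permutations, and
  multiplicativity of the sign.\<close>

lemma wedge_permute:
  assumes q: "q permutes {..<k + l}"
  shows "wedge k l a b (\<lambda>i. v (q i)) = of_int (sign q) * wedge k l a b v"
proof -
  let ?F = "\<lambda>v p. of_int (sign p) * a (\<lambda>i. v (p i)) * b (\<lambda>i. v (p (k + i))) :: complex"
  have "(\<Sum>p | p permutes {..<k + l}. ?F v p) = (\<Sum>p | p permutes {..<k + l}. ?F v (q \<circ> p))"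
    by (rule setum_permutations_compose_left[OF q])
  also have "\<dots> = (\<Sum>p | p permutes {..<k + l}. of_int (sign q) * ?F (\<lambda>i. v (q i)) p)"
  proof (intro sum.cong refl)
    fix p assume "p \<in> {p. p permutes {..<k + l}}"
    then have "permutation p" "permutation q"
      using q by (auto simp: permutation_permutes)
    then show "?F v (q \<circ> p) = of_int (sign q) * ?F (\<lambda>i. v (q i)) p"
      by (simp add: sign_compose mult_ac)
  qed
  finally have "wedge k l a b v = of_int (sign q) * wedge k l a b (\<lambda>i. v (q i))"
    unfolding wedge_def by (simp add: sum_distrib_left[symmetric])
  moreover have "of_int (sign q) * of_int (sign q) = (1::complex)"
    by (simp flip: of_int_mult add: sign_idempotent)
  ultimately show ?thesis by (metis mult.assoc mult_1)
qed

lemma wedge_equal_entries: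
  assumes ij: "i < k + l" "j < k + l" "i \<noteq> j" and "v i = v j"
  shows "wedge k l a b v = 0"
proof -
  have "(\<lambda>x. v (Transposition.transpose i j x)) = v"
    using assms by (auto simp: fun_eq_iff Transposition.transpose_def)
  moreover have "Transposition.transpose i j permutes {..<k + l}"
    using ij by (intro permutes_swap_id) auto
  ultimately have "wedge k l a b v = - wedge k l a b v"
    using wedge_permute[of "Transposition.transpose i j" k l a b v] ij by (simp add: sign_swap_id)
  then show ?thesis by simp
qed

text \<open>Bilinear expansion: repeated entries kill two of the four terms, and a swap costs a
  sign. This case of the determinant rule suffices because the rotations below mix the frame vectors
  in pairs.\<close>

lemma wedge_2x2:
  fixes a b :: "'m::finite form"
  assumes a: "multilinear_form k a" and b: "multilinear_form l b"
    and ij: "i < k + l" "j < k + l" "i \<noteq> j"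
  shows "wedge k l a b (v(i := p *\<^sub>R v i + q *\<^sub>R v j, j := r *\<^sub>R v i + s *\<^sub>R v j)) =
    (p * s - q * r) *\<^sub>R wedge k l a b v"
proof -
  let ?W = "wedge k l a b"
  note m = multilinear_form_wedge[OF a b]
  have tw: "v(i := x, j := y) = v(j := y, i := x)" for x y
    using ij by (simp add: fun_upd_twist)
  have z: "?W (v(j := x, i := x)) = 0" for x
    using ij by (intro wedge_equal_entries[of i k l j]) auto
  have sw: "?W (v(j := v i, i := v j)) = - ?W v"
  proof -
    have "(\<lambda>x. v (Transposition.transpose i j x)) = v(j := v i, i := v j)"
      by (auto simp: fun_eq_iff Transposition.transpose_def)
    moreover have "Transposition.transpose i j permutes {..<k + l}"
      using ij by (intro permutes_swap_id) auto
    ultimately show ?thesis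
      using wedge_permute[of "Transposition.transpose i j" k l a b v] ij by (simp add: sign_swap_id)
  qed
  have 1: "?W (v(i := p *\<^sub>R v i + q *\<^sub>R v j, j := y)) =
      p *\<^sub>R ?W (v(j := y, i := v i)) + q *\<^sub>R ?W (v(j := y, i := v j))" for y
    unfolding tw by (rule multilinear_formD[OF m ij(1)])
  have 2: "?W (v(j := r *\<^sub>R v i + s *\<^sub>R v j, i := x)) =
      r *\<^sub>R ?W (v(j := v i, i := x)) + s *\<^sub>R ?W (v(j := v j, i := x))" for x
    unfolding tw[symmetric] by (rule multilinear_formD[OF m ij(2)])
  show ?thesis unfolding 1 2 z sw by (simp add: algebra_simps)
qed

lemma wedge_mult:
  "wedge k l (\<lambda>v. c * a v) (\<lambda>v. d * b v) v = c * d * wedge k l a b v"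
  unfolding wedge_def by (simp add: sum_distrib_left mult_ac)

lemma wedge_pullback:
  assumes "\<And>v. a' (\<lambda>i. U (v i)) = a v" "\<And>v. b' (\<lambda>i. U (v i)) = b v"
  shows "wedge k l a' b' (\<lambda>i. U (v i)) = wedge k l a b v"
  unfolding wedge_def assms ..

lemma wedge_power2_mult:
  "wedge_power2 (\<lambda>v. c * a v) n v = c ^ n * wedge_power2 a n v"
proof (induction n arbitrary: v)
  case 0
  then show ?case by simp
next
  case (Suc n)
  have eq: "wedge_power2 (\<lambda>v. c * a v) n = (\<lambda>v. c ^ n * wedge_power2 a n v)"
    using Suc by blast
  show ?case by (simp add: eq wedge_mult)
qed

lemma wedge_power2_pullback:
  assumes "\<And>v. a' (\<lambda>i. U (v i)) = a v"
  shows "wedge_power2 a' n (\<lambda>i. U (v i)) = wedge_power2 a n v"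
proof (induction n arbitrary: v)
  case (Suc n)
  then show ?case using wedge_pullback[of a' U a "wedge_power2 a' n" "wedge_power2 a n"] assms by simp
qed simp

section \<open>Explicit forms of d^c and dd^c of log |z|^2\<close>

lemma inner_vec_complex: "x \<bullet> y = (\<Sum>j\<in>UNIV. Re (x $ j * cnj (y $ j)))" for x y :: "complex ^ 'm::finite"
  unfolding inner_vec_def by (simp add: inner_complex_def)

lemma inner_ii_skew: "(\<i> *s x) \<bullet> y = - (x \<bullet> (\<i> *s y))" for x y :: "complex ^ 'm::finite"
  unfolding inner_vec_complex sum_negf[symmetric] by (intro sum.cong refl) (simp add: vector_scalar_mult_def)

lemma bounded_linear_ii: "bounded_linear (\<lambda>x::complex ^ 'm::finite. \<i> *s x)"
  unfolding linear_conv_bounded_linear[symmetric]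
  by (rule linearI) (auto simp: vec_eq_iff vector_scalar_mult_def algebra_simps scaleR_conv_of_real[where 'a=complex])

text \<open>This is d^c log |z|^2: d^c u (v) is - du(i v) / (4 pi), and i is skew for the real inner
  product. \<open>ddc_log\<close> is its exterior derivative by the quotient rule. With explicit
  formulas the invariance proofs become algebra with the inner product and i.\<close>

definition dc_log :: "complex ^ 'm::finite \<Rightarrow> 'm form" where
  "dc_log z = (\<lambda>v. of_real (((\<i> *s z) \<bullet> v 0) / (2 * pi * (z \<bullet> z))))"

definition ddc_log :: "complex ^ 'm::finite \<Rightarrow> 'm form" where
  "ddc_log z = (\<lambda>v. of_real (((\<i> *s v 0) \<bullet> v 1 - (\<i> *s v 1) \<bullet> v 0) / (2 * pi * (z \<bullet> z))
     - (((\<i> *s z) \<bullet> v 1) * (z \<bullet> v 0) - ((\<i> *s z) \<bullet> v 0) * (z \<bullet> v 1)) / (pi * (z \<bullet> z)\<^sup>2)))"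

lemma dc_log_norm_sq:
  assumes "z \<noteq> 0"
  shows "dc log_norm_sq z = dc_log z"
proof -
  have z: "z \<bullet> z > 0" using assms by simp
  have "(log_norm_sq has_derivative (\<lambda>v. of_real (2 * (z \<bullet> v) / (z \<bullet> z)))) (at z)"
    unfolding log_norm_sq_def[abs_def] power2_norm_eq_inner
    by (rule derivative_eq_intros refl z | simp add: z inner_commute field_simps)+
  then have D: "frechet_derivative log_norm_sq (at z) = (\<lambda>v. of_real (2 * (z \<bullet> v) / (z \<bullet> z)))"
    by (rule frechet_derivative_at[symmetric])
  show ?thesis
    unfolding dc_def del_def delbar_def D dc_log_def inner_ii_skew
    by (rule ext) (simp add: field_simps)
qed

lemma ext_deriv_dc_log_norm_sq:
  fixes z :: "complex ^ 'm::finite"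
  assumes "z \<noteq> 0"
  shows "ext_deriv 1 (dc log_norm_sq) z = ddc_log z"
proof -
  have z: "z \<bullet> z > 0" using assms by simp
  note bl = bounded_linear.has_derivative[OF bounded_linear_ii]
  have D: "frechet_derivative (\<lambda>y. dc log_norm_sq y u) (at z) =
      (\<lambda>h. of_real ((((\<i> *s h) \<bullet> u 0) / (2 * pi * (z \<bullet> z))
        - ((\<i> *s z) \<bullet> u 0) * (z \<bullet> h) / (pi * (z \<bullet> z)\<^sup>2))))" for u :: "nat \<Rightarrow> complex ^ 'm"
  proof -
    have quot: "(A * (2 * pi * N) - B * (2 * pi * (2 * C))) / ((2 * pi * N) * (2 * pi * N)) =
        A / (2 * pi * N) - B * C / (pi * N\<^sup>2)" if "N > 0" for A B C N :: real
      using that by (simp add: diff_divide_distrib power2_eq_square mult_ac)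
    have 1: "((\<lambda>y. (\<i> *s y) \<bullet> u 0) has_derivative (\<lambda>h. (\<i> *s h) \<bullet> u 0)) (at z)"
      by (intro has_derivative_inner_left bl has_derivative_ident)
    have 2: "((\<lambda>y. 2 * pi * (y \<bullet> y)) has_derivative (\<lambda>h. 2 * pi * (2 * (z \<bullet> h)))) (at z)"
      by (rule derivative_eq_intros refl | simp add: inner_commute)+
    have 3: "((\<lambda>y. ((\<i> *s y) \<bullet> u 0) / (2 * pi * (y \<bullet> y))) has_derivative
        (\<lambda>h. ((\<i> *s h) \<bullet> u 0) / (2 * pi * (z \<bullet> z)) - ((\<i> *s z) \<bullet> u 0) * (z \<bullet> h) / (pi * (z \<bullet> z)\<^sup>2))) (at z)"
      by (rule has_derivative_eq_rhs[OF has_derivative_divide'[OF 1 2]])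
        (use z in \<open>simp_all only: quot, auto\<close>)
    have "((\<lambda>y. dc_log y u) has_derivative (\<lambda>h. of_real ((((\<i> *s h) \<bullet> u 0) / (2 * pi * (z \<bullet> z))
        - ((\<i> *s z) \<bullet> u 0) * (z \<bullet> h) / (pi * (z \<bullet> z)\<^sup>2))))) (at z)"
      unfolding dc_log_def by (rule has_derivative_of_real[OF 3])
    then have "((\<lambda>y. dc log_norm_sq y u) has_derivative (\<lambda>h. of_real ((((\<i> *s h) \<bullet> u 0) / (2 * pi * (z \<bullet> z))
        - ((\<i> *s z) \<bullet> u 0) * (z \<bullet> h) / (pi * (z \<bullet> z)\<^sup>2))))) (at z)"
      by (rule has_derivative_transform_within_open[where s="- {0}"])
        (use assms in \<open>auto simp: dc_log_norm_sq\<close>)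
    then show ?thesis by (rule frechet_derivative_at[symmetric])
  qed
  have sum2: "(\<Sum>i\<le>1::nat. g i) = g 0 + g 1" for g :: "nat \<Rightarrow> complex" by simp
  have "ext_deriv 1 (dc log_norm_sq) z v = ddc_log z v" for v
  proof -
    have "ext_deriv 1 (dc log_norm_sq) z v =
        of_real (((\<i> *s v 0) \<bullet> v 1) / (2 * pi * (z \<bullet> z)) - ((\<i> *s z) \<bullet> v 1) * (z \<bullet> v 0) / (pi * (z \<bullet> z)\<^sup>2))
      - of_real (((\<i> *s v 1) \<bullet> v 0) / (2 * pi * (z \<bullet> z)) - ((\<i> *s z) \<bullet> v 0) * (z \<bullet> v 1) / (pi * (z \<bullet> z)\<^sup>2))"
      unfolding ext_deriv_def D sum2 by (simp del: of_real_diff of_real_divide of_real_mult)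
    also have "\<dots> = ddc_log z v"
      unfolding ddc_log_def of_real_diff[symmetric] of_real_eq_iff diff_divide_distrib by linarith
    finally show ?thesis .
  qed
  then show ?thesis by blast
qed

text \<open>This is dr \<and> d^c log |z|^2 \<and> (dd^c log |z|^2)^(m-1); on the standard frame it
  gives the surface density of \<eta>.\<close>

definition top_form :: "complex ^ 'm::finite \<Rightarrow> 'm form" where
  "top_form z = wedge 1 (2 * CARD('m) - 1) (conormal z)
     (wedge 1 (2 * (CARD('m) - 1)) (dc_log z) (wedge_power2 (ddc_log z) (CARD('m) - 1)))"

lemma sphere_density_eta_form:
  assumes "z \<noteq> 0"
  shows "sphere_density eta_form z = Re (top_form z std_frame)"
  unfolding sphere_density_def top_form_def eta_form_def sigma_form_def
  by (simp only: dc_log_norm_sq[OF assms] ext_deriv_dc_log_norm_sq[OF assms])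

text \<open>The degrees of homogeneity in z are 0 for \<open>conormal\<close>, -1 for
  \<open>dc_log\<close> and -2 for each of the m - 1 factors \<open>ddc_log\<close>.\<close>

lemma top_form_scaleR:
  fixes z :: "complex ^ 'm::finite"
  assumes s: "s > 0"
  shows "top_form (s *\<^sub>R z) v = of_real (1 / s ^ (2 * CARD('m) - 1)) * top_form z v"
proof -
  have ii: "\<i> *s (s *\<^sub>R z) = s *\<^sub>R (\<i> *s z)"
    by (auto simp: vec_eq_iff vector_scalar_mult_def)
  have 1: "conormal (s *\<^sub>R z) = (\<lambda>v. 1 * conormal z v)"
    using s by (auto simp: conormal_def fun_eq_iff)
  have 2: "dc_log (s *\<^sub>R z) = (\<lambda>v. of_real (1 / s) * dc_log z v)"
    using s by (auto simp: dc_log_def fun_eq_iff ii)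
  have 3: "ddc_log (s *\<^sub>R z) = (\<lambda>v. of_real (1 / s ^ 2) * ddc_log z v)"
  proof
    fix v :: "nat \<Rightarrow> complex ^ 'm"
    have "X / (2 * pi * (s * (s * N))) - (s * p * (s * q) - s * p' * (s * q')) / (pi * (s * (s * N))\<^sup>2) =
        1 / s\<^sup>2 * (X / (2 * pi * N) - (p * q - p' * q') / (pi * N\<^sup>2))" for X N p q p' q' :: real
    proof -
      have "s * p * (s * q) - s * p' * (s * q') = s\<^sup>2 * (p * q - p' * q')"
        by (simp add: power2_eq_square algebra_simps)
      moreover have "s\<^sup>2 * Y / (pi * (s * (s * N))\<^sup>2) = 1 / s\<^sup>2 * (Y / (pi * N\<^sup>2))" for Y
        using s by (simp add: power2_eq_square)
      moreover have "X / (2 * pi * (s * (s * N))) = 1 / s\<^sup>2 * (X / (2 * pi * N))"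
        by (simp add: power2_eq_square)
      ultimately show ?thesis by (simp only: right_diff_distrib[of "1 / s\<^sup>2"])
    qed
    then show "ddc_log (s *\<^sub>R z) v = of_real (1 / s\<^sup>2) * ddc_log z v"
      unfolding ddc_log_def ii of_real_mult[symmetric] of_real_eq_iff inner_scaleR_left inner_scaleR_right .
  qed
  have 4: "wedge_power2 (ddc_log (s *\<^sub>R z)) n = (\<lambda>v. of_real (1 / s ^ (2 * n)) * wedge_power2 (ddc_log z) n v)" for n
    unfolding 3 wedge_power2_mult by (simp add: power_divide power_mult)
  have "of_real (1 / s) * of_real (1 / s ^ (2 * (CARD('m) - 1))) = (of_real (1 / s ^ Suc (2 * (CARD('m) - 1))) :: complex)"
    using s by (simp add: field_simps)
  moreover have "Suc (2 * (CARD('m) - 1)) = 2 * CARD('m) - 1"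
    by (cases "CARD('m)") auto
  ultimately show ?thesis
    unfolding top_form_def 1 2 4 wedge_mult by (simp only: mult_1)
qed

text \<open>The three forms are built from the real inner product and multiplication by i alone, and
  a unitary map preserves both.\<close>

lemma top_form_pullback:
  fixes z :: "complex ^ 'm::finite" and U :: "complex ^ 'm \<Rightarrow> complex ^ 'm"
  assumes U: "orthogonal_transformation U" and ii: "\<And>x. U (\<i> *s x) = \<i> *s U x"
  shows "top_form (U z) (\<lambda>i. U (v i)) = top_form z v"
proof -
  have inn: "U x \<bullet> U y = x \<bullet> y" for x y
    using U by (simp add: orthogonal_transformation_def)
  have 1: "conormal (U z) (\<lambda>i. U (v i)) = conormal z v" for v
    unfolding conormal_def using U inn by (simp add: orthogonal_transformation_norm)
  have 2: "dc_log (U z) (\<lambda>i. U (v i)) = dc_log z v" for v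
    unfolding dc_log_def ii[symmetric] inn ..
  have 3: "ddc_log (U z) (\<lambda>i. U (v i)) = ddc_log z v" for v
    unfolding ddc_log_def ii[symmetric] inn ..
  show ?thesis
    unfolding top_form_def by (intro wedge_pullback wedge_power2_pullback 1 2 3)
qed

lemma multilinear_form_1: "linear g \<Longrightarrow> multilinear_form 1 (\<lambda>v. of_real (g (v 0)))"
  unfolding multilinear_form_def by (auto simp: linear_add linear_scale[of g] scaleR_conv_of_real[where 'a=complex])

lemma multilinear_form_2:
  assumes "\<And>y. linear (\<lambda>x. g x y)" "\<And>x. linear (g x)"
  shows "multilinear_form 2 (\<lambda>v. of_real (g (v 0) (v 1)))"
proof -
  have 1: "i = 0 \<or> i = 1" if "i < 2" for i :: nat using that by auto
  have 2: "g (s *\<^sub>R x + t *\<^sub>R x') y = s * g x y + t * g x' y" for s t x x' y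
    using linear_add[OF assms(1)[of y]] linear_scale[OF assms(1)[of y]] by simp
  have 3: "g y (s *\<^sub>R x + t *\<^sub>R x') = s * g y x + t * g y x'" for s t x x' y
    using linear_add[OF assms(2)[of y]] linear_scale[OF assms(2)[of y]] by simp
  show ?thesis
    unfolding multilinear_form_def
    by (auto dest!: 1 simp: 2 3 scaleR_conv_of_real[where 'a=complex])
qed

lemma multilinear_conormal: "multilinear_form 1 (conormal z)"
  unfolding conormal_def
  by (rule multilinear_form_1) (auto intro!: linearI simp: inner_right_distrib distrib_left)

lemma multilinear_dc_log: "multilinear_form 1 (dc_log z)"
  unfolding dc_log_def
  by (rule multilinear_form_1) (auto intro!: linearI simp: inner_right_distrib add_divide_distrib)

lemma multilinear_ddc_log:
  fixes z :: "complex ^ 'm::finite"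
  shows "multilinear_form 2 (ddc_log z)"
proof -
  have ii: "\<i> *s (x + y) = \<i> *s x + \<i> *s y" "\<i> *s (t *\<^sub>R y) = t *\<^sub>R (\<i> *s y)" for t and x y :: "complex ^ 'm"
    by (auto simp: vec_eq_iff vector_scalar_mult_def algebra_simps scaleR_conv_of_real[where 'a=complex])
  have r: "(a + b - (c + d)) / p - (e - f) / q = (a - c) / p - e' / q + ((b - d) / p - f' / q)"
    if "e - f = e' + f'" for a b c d e f e' f' p q :: real
    unfolding that by (simp add: add_divide_distrib diff_divide_distrib)
  have r': "(t * a - t * b) / p - (t * c - t * d) / q = t * ((a - b) / p - (c - d) / q)"
    for a b c d p q t :: real
    by (simp add: diff_divide_distrib right_diff_distrib)
  show ?thesis
    unfolding ddc_log_def
  proof (rule multilinear_form_2)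
    fix u :: "complex ^ 'm"
    show "linear (\<lambda>x. ((\<i> *s x) \<bullet> u - (\<i> *s u) \<bullet> x) / (2 * pi * (z \<bullet> z)) -
        ((\<i> *s z) \<bullet> u * (z \<bullet> x) - (\<i> *s z) \<bullet> x * (z \<bullet> u)) / (pi * (z \<bullet> z)\<^sup>2))"
    proof (rule linearI, goal_cases)
      case 1 show ?case unfolding ii inner_left_distrib inner_right_distrib
        by (rule r) (simp add: algebra_simps)
    next
      case (2 t) show ?case unfolding ii inner_scaleR_left inner_scaleR_right real_scaleR_def
        by (subst r'[symmetric]) (simp add: mult_ac)
    qed
    show "linear (\<lambda>x. ((\<i> *s u) \<bullet> x - (\<i> *s x) \<bullet> u) / (2 * pi * (z \<bullet> z)) -
        ((\<i> *s z) \<bullet> x * (z \<bullet> u) - (\<i> *s z) \<bullet> u * (z \<bullet> x)) / (pi * (z \<bullet> z)\<^sup>2))"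
    proof (rule linearI, goal_cases)
      case 1 show ?case unfolding ii inner_left_distrib inner_right_distrib
        by (rule r) (simp add: algebra_simps)
    next
      case (2 t) show ?case unfolding ii inner_scaleR_left inner_scaleR_right real_scaleR_def
        by (subst r'[symmetric]) (simp add: mult_ac)
    qed
  qed
qed

lemma multilinear_top_factor:
  fixes z :: "complex ^ 'm::finite"
  shows "multilinear_form (2 * CARD('m) - 1)
     (wedge 1 (2 * (CARD('m) - 1)) (dc_log z) (wedge_power2 (ddc_log z) (CARD('m) - 1)))"
proof -
  have "2 * CARD('m) - 1 = 1 + 2 * (CARD('m) - 1)" by (cases "CARD('m)") auto
  then show ?thesis
    using multilinear_form_wedge[OF multilinear_dc_log multilinear_form_wedge_power2[OF multilinear_ddc_log]]
    by metis
qed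

lemma card_shift: "1 + (2 * CARD('m::finite) - 1) = 2 * CARD('m)"
  by (cases "CARD('m)") auto

lemma top_form_cong:
  fixes z :: "complex ^ 'm::finite"
  assumes "\<And>i. i < 2 * CARD('m) \<Longrightarrow> v i = w i"
  shows "top_form z v = top_form z w"
  using multilinear_form_cong[OF multilinear_form_wedge[OF multilinear_conormal multilinear_top_factor]] assms
  unfolding top_form_def card_shift by blast

lemma top_form_2x2:
  fixes z :: "complex ^ 'm::finite"
  assumes ij: "i < 2 * CARD('m)" "j < 2 * CARD('m)" "i \<noteq> j"
  shows "top_form z (v(i := p *\<^sub>R v i + q *\<^sub>R v j, j := r *\<^sub>R v i + s *\<^sub>R v j)) =
    (p * s - q * r) *\<^sub>R top_form z v"
  unfolding top_form_def using wedge_2x2[OF multilinear_conormal multilinear_top_factor] ij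
  unfolding card_shift by blast

section \<open>Unitary invariance of the density\<close>

abbreviation coord_index :: "'m::finite \<Rightarrow> nat" where
  "coord_index \<equiv> to_nat_on UNIV"

lemma coord_index_less: "coord_index (j::'m::finite) < CARD('m)"
  using bij_betw_apply[OF to_nat_on_finite[of "UNIV::'m set"]] by auto

lemma coord_index_inj: "coord_index j = coord_index k \<longleftrightarrow> j = (k::'m::finite)"
  by (simp add: countable_finite)

lemma std_frame_coord_index:
  "std_frame (2 * coord_index j) = axis (j::'m::finite) 1"
  "std_frame (Suc (2 * coord_index j)) = axis j \<i>"
  by (simp_all add: std_frame_def countable_finite)

lemma frame_index_cases:
  assumes "i < 2 * CARD('m::finite)"
  obtains j :: "'m::finite" where "i = 2 * coord_index j \<or> i = Suc (2 * coord_index j)"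
proof -
  have "i div 2 \<in> {..<CARD('m)}" using assms by auto
  then obtain j :: 'm where "coord_index j = i div 2"
    using bij_betw_imp_surj_on[OF to_nat_on_finite[of "UNIV::'m set"]] by (metis finite imageE)
  moreover have "i = 2 * (i div 2) \<or> i = Suc (2 * (i div 2))" by presburger
  ultimately show thesis using that[of j] by simp
qed

text \<open>Phase rotations of one coordinate and real rotations in a coordinate plane suffice to
  carry any vector to a multiple of one axis, and each acts on \<open>std_frame\<close> in 2 by 2
  blocks.\<close>

definition phase_rot :: "'m::finite \<Rightarrow> complex \<Rightarrow> complex ^ 'm \<Rightarrow> complex ^ 'm" where
  "phase_rot j w z = (\<chi> i. if i = j then w * z $ i else z $ i)"

definition plane_rot :: "'m::finite \<Rightarrow> 'm \<Rightarrow> real \<Rightarrow> real \<Rightarrow> complex ^ 'm \<Rightarrow> complex ^ 'm" where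
  "plane_rot j k c s z = (\<chi> i. if i = j then of_real c * z $ j - of_real s * z $ k
     else if i = k then of_real s * z $ j + of_real c * z $ k else z $ i)"

lemma phase_rot_orthogonal:
  assumes "cmod w = 1"
  shows "orthogonal_transformation (phase_rot j w)"
  unfolding orthogonal_transformation
proof
  show "linear (phase_rot j w)"
    by (rule linearI) (auto simp: phase_rot_def vec_eq_iff algebra_simps)
  have "norm (phase_rot j w z $ i) = norm (z $ i)" for z i
    using assms by (simp add: phase_rot_def norm_mult)
  then show "\<forall>z. norm (phase_rot j w z) = norm z" by (simp add: norm_vec_def)
qed

lemma plane_rot_orthogonal:
  fixes j k :: "'m::finite"
  assumes "j \<noteq> k" and cs: "c\<^sup>2 + s\<^sup>2 = 1"
  shows "orthogonal_transformation (plane_rot j k c s)"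
  unfolding orthogonal_transformation
proof
  show "linear (plane_rot j k c s)"
    by (rule linearI) (auto simp: plane_rot_def vec_eq_iff algebra_simps scaleR_conv_of_real[where 'a=complex])
  have "norm (plane_rot j k c s z) = norm z" for z
  proof -
    have sq: "(norm y)\<^sup>2 = (cmod (y $ j))\<^sup>2 + (cmod (y $ k))\<^sup>2 + (\<Sum>i\<in>UNIV - {j, k}. (cmod (y $ i))\<^sup>2)"
      for y :: "complex ^ 'm"
    proof -
      have "(norm y)\<^sup>2 = (\<Sum>i\<in>UNIV. (cmod (y $ i))\<^sup>2)"
        by (simp add: norm_vec_def L2_set_def sum_nonneg)
      also have "\<dots> = (\<Sum>i\<in>{j, k}. (cmod (y $ i))\<^sup>2) + (\<Sum>i\<in>UNIV - {j, k}. (cmod (y $ i))\<^sup>2)"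
        by (subst sum.subset_diff[of "{j, k}"]) (auto simp: add_ac)
      finally show ?thesis using assms by simp
    qed
    have "(cmod (of_real c * a - of_real s * b))\<^sup>2 + (cmod (of_real s * a + of_real c * b))\<^sup>2 =
        (c\<^sup>2 + s\<^sup>2) * ((cmod a)\<^sup>2 + (cmod b)\<^sup>2)" for a b
      unfolding cmod_power2 by (simp add: power2_eq_square algebra_simps)
    then have "(norm (plane_rot j k c s z))\<^sup>2 = (norm z)\<^sup>2"
      unfolding sq using assms by (simp add: plane_rot_def)
    then show ?thesis by simp
  qed
  then show "\<forall>z. norm (plane_rot j k c s z) = norm z" by blast
qed

lemma phase_rot_axis:
  "phase_rot j w (axis j 1) = Re w *\<^sub>R axis j 1 + Im w *\<^sub>R axis j \<i>"
  "phase_rot j w (axis j \<i>) = (- Im w) *\<^sub>R axis j 1 + Re w *\<^sub>R axis j \<i>"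
  "k \<noteq> j \<Longrightarrow> phase_rot j w (axis k x) = axis k x"
  by (simp_all add: vec_eq_iff phase_rot_def axis_def complex_eq_iff)

lemma plane_rot_axis:
  "j \<noteq> k \<Longrightarrow> plane_rot j k c s (axis j x) = c *\<^sub>R axis j x + s *\<^sub>R axis k x"
  "j \<noteq> k \<Longrightarrow> plane_rot j k c s (axis k x) = (- s) *\<^sub>R axis j x + c *\<^sub>R axis k x"
  "i \<noteq> j \<Longrightarrow> i \<noteq> k \<Longrightarrow> plane_rot j k c s (axis i x) = axis i x"
  by (simp_all add: vec_eq_iff plane_rot_def axis_def complex_eq_iff)

text \<open>U changes the frame only in the pair e_j, i e_j, with determinant |w|^2 = 1, so the
  frame and its image give the same value at U z; the pullback rule leads from the image back to
  z.\<close>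

lemma top_form_phase_rot:
  fixes z :: "complex ^ 'm::finite"
  assumes w: "cmod w = 1"
  shows "top_form (phase_rot j w z) std_frame = top_form z std_frame"
proof -
  let ?U = "phase_rot j w" and ?i = "2 * coord_index j" and ?v = "std_frame :: nat \<Rightarrow> complex ^ 'm"
  have lt: "?i < 2 * CARD('m)" "Suc ?i < 2 * CARD('m)" using coord_index_less[of j] by auto
  have "top_form (?U z) (\<lambda>i. ?U (?v i)) =
    top_form (?U z) (?v(?i := Re w *\<^sub>R ?v ?i + Im w *\<^sub>R ?v (Suc ?i), Suc ?i := (- Im w) *\<^sub>R ?v ?i + Re w *\<^sub>R ?v (Suc ?i)))"
  proof (rule top_form_cong)
    fix i assume "i < 2 * CARD('m)"
    then obtain k :: 'm where k: "i = 2 * coord_index k \<or> i = Suc (2 * coord_index k)"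
      by (rule frame_index_cases)
    have 1: "Suc (2 * a) \<noteq> 2 * b" "2 * b \<noteq> Suc (2 * a)" for a b :: nat by presburger+
    show "?U (?v i) = (?v(?i := Re w *\<^sub>R ?v ?i + Im w *\<^sub>R ?v (Suc ?i), Suc ?i := (- Im w) *\<^sub>R ?v ?i + Re w *\<^sub>R ?v (Suc ?i))) i"
      using k by (cases "k = j"; elim disjE) (simp_all add: std_frame_coord_index coord_index_inj 1 phase_rot_axis)
  qed
  also have "\<dots> = (Re w * Re w - Im w * (- Im w)) *\<^sub>R top_form (?U z) ?v"
    using lt by (intro top_form_2x2) auto
  also have "Re w * Re w - Im w * (- Im w) = 1"
    using w by (metis cmod_power2 diff_minus_eq_add mult_minus_right one_power2 power2_eq_square)
  finally show ?thesis
    using top_form_pullback[of ?U z ?v, OF phase_rot_orthogonal[OF w]]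
    by (simp add: phase_rot_def vec_eq_iff mult_ac)
qed

lemma top_form_plane_rot:
  fixes z :: "complex ^ 'm::finite"
  assumes jk: "j \<noteq> k" and cs: "c\<^sup>2 + s\<^sup>2 = 1"
  shows "top_form (plane_rot j k c s z) std_frame = top_form z std_frame"
proof -
  let ?U = "plane_rot j k c s" and ?v = "std_frame :: nat \<Rightarrow> complex ^ 'm"
  let ?i = "2 * coord_index j" and ?l = "2 * coord_index k"
  have lt: "?i < 2 * CARD('m)" "Suc ?i < 2 * CARD('m)" "?l < 2 * CARD('m)" "Suc ?l < 2 * CARD('m)"
    using coord_index_less[of j] coord_index_less[of k] by auto
  have 1: "Suc (2 * a) \<noteq> 2 * b" "2 * b \<noteq> Suc (2 * a)" for a b :: nat by presburger+
  have ne: "coord_index j \<noteq> coord_index k" using jk coord_index_inj by blast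
  \<comment> \<open>The rotation acts on the pair e_j, e_k and in the same way on i e_j, i e_k; the
    two 2 by 2 steps are taken one after the other.\<close>
  define v1 where "v1 = ?v(?i := c *\<^sub>R ?v ?i + s *\<^sub>R ?v ?l, ?l := (- s) *\<^sub>R ?v ?i + c *\<^sub>R ?v ?l)"
  define v2 where "v2 = v1(Suc ?i := c *\<^sub>R v1 (Suc ?i) + s *\<^sub>R v1 (Suc ?l), Suc ?l := (- s) *\<^sub>R v1 (Suc ?i) + c *\<^sub>R v1 (Suc ?l))"
  have "top_form (?U z) (\<lambda>i. ?U (?v i)) = top_form (?U z) v2"
  proof (rule top_form_cong)
    fix i assume "i < 2 * CARD('m)"
    then obtain k' :: 'm where k: "i = 2 * coord_index k' \<or> i = Suc (2 * coord_index k')"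
      by (rule frame_index_cases)
    show "?U (?v i) = v2 i"
      unfolding v1_def v2_def using k jk
      by (cases "k' = j"; cases "k' = k"; elim disjE)
        (simp_all add: std_frame_coord_index coord_index_inj 1 plane_rot_axis)
  qed
  also have "\<dots> = (c * c - s * (- s)) *\<^sub>R top_form (?U z) v1"
    unfolding v2_def using lt ne by (intro top_form_2x2) auto
  also have "top_form (?U z) v1 = (c * c - s * (- s)) *\<^sub>R top_form (?U z) ?v"
    unfolding v1_def using lt ne by (intro top_form_2x2) auto
  also have "c * c - s * (- s) = 1" using cs by (simp add: power2_eq_square)
  finally show ?thesis
    using top_form_pullback[of ?U z ?v, OF plane_rot_orthogonal[OF jk cs]]
    by (simp add: plane_rot_def vec_eq_iff algebra_simps)
qed

lemma phase_rot_to_real: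
  obtains w where "cmod w = 1" "phase_rot j w z $ j = of_real (cmod (z $ j))" "norm (phase_rot j w z) = norm z"
    "\<And>i. i \<noteq> j \<Longrightarrow> phase_rot j w z $ i = z $ i"
proof -
  define w where "w = (if z $ j = 0 then 1 else cnj (sgn (z $ j)))"
  have w: "cmod w = 1" by (auto simp: w_def norm_sgn)
  show thesis
  proof (rule that[OF w])
    show "phase_rot j w z $ j = of_real (cmod (z $ j))"
      by (auto simp: w_def phase_rot_def sgn_eq complex_norm_square power2_eq_square field_simps)
        (metis complex_norm_square mult.commute power2_eq_square of_real_mult)
    show "norm (phase_rot j w z) = norm z"
      using phase_rot_orthogonal[OF w] orthogonal_transformation_norm by blast
  qed (auto simp: phase_rot_def)
qed

text \<open>Givens elimination: phases make the coordinates at j0 and k real, then a plane rotation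
  moves the k part into j0. The number of nonzero coordinates off j0 drops; when none is left, one
  more phase finishes.\<close>

lemma top_form_normalize:
  fixes z :: "complex ^ 'm::finite" and j0 :: 'm
  shows "top_form z std_frame = top_form (axis j0 (of_real (norm z))) std_frame"
proof (induction "card {j. j \<noteq> j0 \<and> z $ j \<noteq> 0}" arbitrary: z rule: less_induct)
  case less
  show ?case
  proof (cases "{j. j \<noteq> j0 \<and> z $ j \<noteq> 0} = {}")
    case True
    obtain w where w: "cmod w = 1" "phase_rot j0 w z $ j0 = of_real (cmod (z $ j0))"
      "norm (phase_rot j0 w z) = norm z" "\<And>i. i \<noteq> j0 \<Longrightarrow> phase_rot j0 w z $ i = z $ i"
      using phase_rot_to_real by blast
    have "z = axis j0 (z $ j0)" using True by (auto simp: vec_eq_iff axis_def)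
    then have "norm z = cmod (z $ j0)"
      by (metis inner_axis_axis norm_eq_sqrt_inner)
    then have "phase_rot j0 w z = axis j0 (of_real (norm z))"
      using w True by (auto simp: vec_eq_iff axis_def)
    then show ?thesis using top_form_phase_rot[OF w(1), of j0 z] by simp
  next
    case False
    then obtain k where k: "k \<noteq> j0" "z $ k \<noteq> 0" by auto
    obtain w where w: "cmod w = 1" "phase_rot j0 w z $ j0 = of_real (cmod (z $ j0))"
      "norm (phase_rot j0 w z) = norm z" "\<And>i. i \<noteq> j0 \<Longrightarrow> phase_rot j0 w z $ i = z $ i"
      using phase_rot_to_real by blast
    define z1 where "z1 = phase_rot j0 w z"
    obtain w' where w': "cmod w' = 1" "phase_rot k w' z1 $ k = of_real (cmod (z1 $ k))"
      "norm (phase_rot k w' z1) = norm z1" "\<And>i. i \<noteq> k \<Longrightarrow> phase_rot k w' z1 $ i = z1 $ i"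
      using phase_rot_to_real by blast
    define z2 where "z2 = phase_rot k w' z1"
    define a b \<rho> where "a = cmod (z $ j0)" and "b = cmod (z $ k)" and "\<rho> = sqrt (a\<^sup>2 + b\<^sup>2)"
    have b: "b > 0" using k by (simp add: b_def)
    have "a\<^sup>2 + b\<^sup>2 > 0" using b by (simp add: add_nonneg_pos)
    then have \<rho>: "\<rho> > 0" "\<rho>\<^sup>2 = a\<^sup>2 + b\<^sup>2" by (auto simp: \<rho>_def)
    have z2: "z2 $ j0 = of_real a" "z2 $ k = of_real b" "norm z2 = norm z"
      "\<And>i. i \<noteq> k \<Longrightarrow> i \<noteq> j0 \<Longrightarrow> z2 $ i = z $ i"
      using w w' k by (auto simp: z1_def z2_def a_def b_def)
    have cs: "(a / \<rho>)\<^sup>2 + (- (b / \<rho>))\<^sup>2 = 1"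
    proof -
      have "(a / \<rho>)\<^sup>2 + (- (b / \<rho>))\<^sup>2 = (a\<^sup>2 + b\<^sup>2) / \<rho>\<^sup>2"
        by (simp add: power_divide add_divide_distrib)
      also have "\<dots> = 1" unfolding \<rho>(2)[symmetric] using \<rho>(1) by simp
      finally show ?thesis .
    qed
    define z3 where "z3 = plane_rot j0 k (a / \<rho>) (- (b / \<rho>)) z2"
    have z3: "z3 $ k = 0" "\<And>i. i \<noteq> k \<Longrightarrow> i \<noteq> j0 \<Longrightarrow> z3 $ i = z $ i" "norm z3 = norm z"
      using z2 k orthogonal_transformation_norm[OF plane_rot_orthogonal[OF k(1)[symmetric] cs]]
      by (auto simp: z3_def plane_rot_def)
    have "{j. j \<noteq> j0 \<and> z3 $ j \<noteq> 0} \<subset> {j. j \<noteq> j0 \<and> z $ j \<noteq> 0}"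
      using z3 k by (auto simp: psubset_eq) metis+
    then have "card {j. j \<noteq> j0 \<and> z3 $ j \<noteq> 0} < card {j. j \<noteq> j0 \<and> z $ j \<noteq> 0}"
      by (intro psubset_card_mono) auto
    from less[OF this] have "top_form z3 std_frame = top_form (axis j0 (of_real (norm z))) std_frame"
      using z3(3) by simp
    moreover have "top_form z3 std_frame = top_form z std_frame"
      unfolding z3_def z2_def z1_def
      by (simp add: top_form_plane_rot[OF k(1)[symmetric] cs] top_form_phase_rot w w')
    ultimately show ?thesis by simp
  qed
qed

text \<open>Unitary invariance and homogeneity leave a single number, the value at a unit axis
  vector, which is never evaluated.\<close>

lemma sphere_density_eta_form_const:
  obtains \<kappa> where "\<And>z :: complex ^ 'm::finite. z \<noteq> 0 \<Longrightarrow>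
    sphere_density eta_form z = \<kappa> / norm z ^ (2 * CARD('m) - 1)"
proof -
  fix j0 :: 'm
  define \<kappa> where "\<kappa> = Re (top_form (axis j0 1) std_frame)"
  have "sphere_density eta_form z = \<kappa> / norm z ^ (2 * CARD('m) - 1)" if z: "z \<noteq> 0" for z :: "complex ^ 'm"
  proof -
    have "axis j0 (of_real (norm z)) = norm z *\<^sub>R axis j0 (1::complex)"
      by (auto simp: vec_eq_iff axis_def scaleR_conv_of_real[where 'a=complex])
    then have "top_form z std_frame = of_real (1 / norm z ^ (2 * CARD('m) - 1)) * top_form (axis j0 1) std_frame"
      using top_form_normalize[of z j0] top_form_scaleR[of "norm z"] z by simp
    then show ?thesis unfolding sphere_density_eta_form[OF z] \<kappa>_def by simp
  qed
  then show thesis by (rule that)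
qed

section \<open>Lebesgue measure in polar coordinates\<close>

lemma nn_integral_lborel_affine:
  fixes g :: "'a::euclidean_space \<Rightarrow> ennreal"
  assumes [measurable]: "g \<in> borel_measurable borel" and c: "c \<noteq> 0"
  shows "(\<integral>\<^sup>+ x. g x \<partial>lborel) = ennreal (\<bar>c\<bar> ^ DIM('a)) * (\<integral>\<^sup>+ x. g (t + c *\<^sub>R x) \<partial>lborel)"
proof -
  have "(\<integral>\<^sup>+ x. g x \<partial>lborel) = (\<integral>\<^sup>+ x. g x \<partial>density (distr lborel borel (\<lambda>x. t + c *\<^sub>R x)) (\<lambda>_. ennreal (\<bar>c\<bar> ^ DIM('a))))"
    by (rule arg_cong[where f = "\<lambda>M. nn_integral M g", OF lborel_affine[OF c, of t]])
  also have "\<dots> = (\<integral>\<^sup>+ x. ennreal (\<bar>c\<bar> ^ DIM('a)) * g x \<partial>distr lborel borel (\<lambda>x. t + c *\<^sub>R x))"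
    by (intro nn_integral_density) auto
  also have "\<dots> = (\<integral>\<^sup>+ x. ennreal (\<bar>c\<bar> ^ DIM('a)) * g (t + c *\<^sub>R x) \<partial>lborel)"
    by (intro nn_integral_distr) auto
  also have "\<dots> = ennreal (\<bar>c\<bar> ^ DIM('a)) * (\<integral>\<^sup>+ x. g (t + c *\<^sub>R x) \<partial>lborel)"
    by (intro nn_integral_cmult) auto
  finally show ?thesis .
qed

lemma nn_integral_lborel_translate:
  fixes g :: "'a::euclidean_space \<Rightarrow> ennreal"
  assumes [measurable]: "g \<in> borel_measurable borel"
  shows "(\<integral>\<^sup>+ x. g (t + x) \<partial>lborel) = (\<integral>\<^sup>+ x. g x \<partial>lborel)"
  using nn_integral_lborel_affine[OF assms, of 1 t] by simp

lemma orthogonal_transformation_measurable: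
  fixes U :: "'a::euclidean_space \<Rightarrow> 'a"
  assumes "orthogonal_transformation U"
  shows "U \<in> borel_measurable borel"
  using assms by (intro borel_measurable_continuous_onI linear_continuous_on)
    (simp add: orthogonal_transformation_linear flip: linear_conv_bounded_linear)

text \<open>Uniqueness of Haar measure: Lebesgue measure and its image under U are both translation
  invariant, and they agree on the unit ball.\<close>

lemma nn_integral_lborel_orthogonal:
  fixes U :: "'a::euclidean_space \<Rightarrow> 'a"
  assumes U: "orthogonal_transformation U" and b [measurable]: "b \<in> borel_measurable borel"
  shows "(\<integral>\<^sup>+ x. b (U x) \<partial>lborel) = (\<integral>\<^sup>+ x. b x \<partial>lborel)"
proof -
  note [measurable] = orthogonal_transformation_measurable[OF U]
  have lin: "linear U" using U by (simp add: orthogonal_transformation_linear)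
  have surj: "surj U" using U by (simp add: orthogonal_transformation_surj)
  define a :: "'a \<Rightarrow> ennreal" where "a = indicator (cball 0 1)"
  have [measurable]: "cball (0::'a) 1 \<in> sets borel" by simp
  have [measurable]: "a \<in> borel_measurable borel" unfolding a_def by measurable
  define V where "V = (\<integral>\<^sup>+ x. a x \<partial>lborel)"
  have V: "V \<noteq> 0" "V \<noteq> top"
    using emeasure_eq_ennreal_measure[of lborel "cball (0::'a) 1"] content_cball_pos[of 1 "0::'a"]
    by (simp_all add: V_def a_def emeasure_lborel_cball_finite[unfolded infinity_ennreal_def, THEN less_imp_neq])
  have a_norm: "a x = a y" if "norm x = norm y" for x y
    by (simp add: a_def indicator_def mem_cball_0 that)
  have sh: "(\<integral>\<^sup>+ y. b (U y) \<partial>lborel) = (\<integral>\<^sup>+ y. b (x + U y) \<partial>lborel)" for x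
  proof -
    obtain x' where x': "x = U x'" using surj by blast
    have "(\<integral>\<^sup>+ y. b (x + U y) \<partial>lborel) = (\<integral>\<^sup>+ y. b (U (x' + y)) \<partial>lborel)"
      by (simp add: x' linear_add[OF lin])
    also have "\<dots> = (\<integral>\<^sup>+ y. b (U y) \<partial>lborel)"
      by (rule nn_integral_lborel_translate) simp
    finally show ?thesis ..
  qed
  have aV: "(\<integral>\<^sup>+ y. a (x - U y) \<partial>lborel) = V" for x
  proof -
    obtain x' where x': "x = U x'" using surj by blast
    have "(\<integral>\<^sup>+ y. a (x - U y) \<partial>lborel) = (\<integral>\<^sup>+ y. a (- x' + y) \<partial>lborel)"
    proof (intro nn_integral_cong a_norm)
      fix y
      have "x - U y = U (x' - y)" by (simp add: x' linear_diff[OF lin])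
      then show "norm (x - U y) = norm (- x' + y)"
        using U by (simp add: orthogonal_transformation_norm norm_minus_commute)
    qed
    also have "\<dots> = V" unfolding V_def by (rule nn_integral_lborel_translate) simp
    finally show ?thesis .
  qed
  \<comment> \<open>Convolution trick: translation invariance inserts x into the argument of b.
    After the exchange of integrals, the shift by - U y moves y into the indicator of the ball,
    whose integral over y is again V.\<close>
  have "V * (\<integral>\<^sup>+ x. b (U x) \<partial>lborel) = (\<integral>\<^sup>+ x. a x * (\<integral>\<^sup>+ y. b (U y) \<partial>lborel) \<partial>lborel)"
    unfolding V_def by (simp add: nn_integral_multc)
  also have "\<dots> = (\<integral>\<^sup>+ x. \<integral>\<^sup>+ y. a x * b (x + U y) \<partial>lborel \<partial>lborel)"
  proof (rule nn_integral_cong)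
    fix x
    show "a x * (\<integral>\<^sup>+ y. b (U y) \<partial>lborel) = (\<integral>\<^sup>+ y. a x * b (x + U y) \<partial>lborel)"
      by (subst sh[of x]) (simp add: nn_integral_cmult)
  qed
  also have "\<dots> = (\<integral>\<^sup>+ y. \<integral>\<^sup>+ x. a x * b (x + U y) \<partial>lborel \<partial>lborel)"
    by (rule lborel_pair.Fubini') measurable
  also have "\<dots> = (\<integral>\<^sup>+ y. \<integral>\<^sup>+ x. a (x - U y) * b x \<partial>lborel \<partial>lborel)"
  proof (rule nn_integral_cong)
    fix y
    show "(\<integral>\<^sup>+ x. a x * b (x + U y) \<partial>lborel) = (\<integral>\<^sup>+ x. a (x - U y) * b x \<partial>lborel)"
      using nn_integral_lborel_translate[of "\<lambda>x. a (x - U y) * b x" "U y"] by (simp add: add.commute)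
  qed
  also have "\<dots> = (\<integral>\<^sup>+ x. \<integral>\<^sup>+ y. a (x - U y) * b x \<partial>lborel \<partial>lborel)"
    by (rule lborel_pair.Fubini'[symmetric]) measurable
  also have "\<dots> = (\<integral>\<^sup>+ x. V * b x \<partial>lborel)"
    by (simp add: nn_integral_multc aV)
  also have "\<dots> = V * (\<integral>\<^sup>+ x. b x \<partial>lborel)" by (simp add: nn_integral_cmult)
  finally show ?thesis using V by (simp add: ennreal_mult_cancel_left)
qed

text \<open>The reflection in the hyperplane orthogonal to y - y' exchanges two vectors of equal
  norm.\<close>

lemma orthogonal_transformation_between:
  fixes y y' :: "'a::euclidean_space"
  assumes "norm y = norm y'"
  obtains U where "orthogonal_transformation U" "U y = y'"
proof (cases "y = y'")
  case True
  then show thesis using that[of id] by (simp add: orthogonal_transformation_def linear_id)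
next
  case False
  define d where "d = y - y'"
  define U where "U x = x - (2 * (x \<bullet> d) / (d \<bullet> d)) *\<^sub>R d" for x
  have d: "d \<bullet> d \<noteq> 0" using False by (simp add: d_def)
  have eq: "y \<bullet> y = y' \<bullet> y'" using assms by (simp flip: power2_norm_eq_inner)
  have "2 * (y \<bullet> d) = d \<bullet> d"
    using eq by (simp add: d_def inner_diff_left inner_diff_right inner_commute)
  then have "U y = y'" using d by (simp add: U_def) (simp add: d_def)
  moreover have "linear U"
    by (rule linearI) (auto simp: U_def inner_add_left add_divide_distrib scaleR_add_left scaleR_diff_right distrib_left)
  moreover have "U x \<bullet> U w = x \<bullet> w" for x w
  proof -
    have "U x \<bullet> U w = x \<bullet> w - (2 * (w \<bullet> d) / (d \<bullet> d)) * (x \<bullet> d) - (2 * (x \<bullet> d) / (d \<bullet> d)) * (w \<bullet> d)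
        + (2 * (x \<bullet> d) / (d \<bullet> d)) * (2 * (w \<bullet> d) / (d \<bullet> d) * (d \<bullet> d))"
      unfolding U_def inner_diff_left inner_diff_right inner_scaleR_left inner_scaleR_right inner_commute[of d w]
      by simp
    then show ?thesis using d by simp
  qed
  ultimately have "orthogonal_transformation U" "U y = y'"
    unfolding orthogonal_transformation_def by blast+
  then show thesis by (rule that)
qed

text \<open>The radial projection of the unit ball to the sphere of radius r. Its mass is the volume
  of the unit ball for every r, so integrals against it are spherical means up to a factor
  independent of r.\<close>

definition cone_measure :: "real \<Rightarrow> 'a::euclidean_space measure" where
  "cone_measure r = distr (restrict_space lborel (cball 0 1)) borel (\<lambda>x. (r / norm x) *\<^sub>R x)"

lemma sets_cone_measure [simp, measurable_cong]: "sets (cone_measure r) = sets borel"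
  by (simp add: cone_measure_def)

lemma space_cone_measure [simp]: "space (cone_measure r) = UNIV"
  by (simp add: cone_measure_def)

lemma nn_integral_cone_measure:
  fixes g :: "'a::euclidean_space \<Rightarrow> ennreal"
  assumes [measurable]: "g \<in> borel_measurable borel"
  shows "(\<integral>\<^sup>+ z. g z \<partial>cone_measure r) =
    (\<integral>\<^sup>+ x. g ((r / norm x) *\<^sub>R x) * indicator (cball 0 1) x \<partial>lborel)"
  unfolding cone_measure_def
  by (subst nn_integral_distr) (auto simp: nn_integral_restrict_space intro!: measurable_restrict_space1)

lemma emeasure_cone_measure_UNIV: "emeasure (cone_measure r :: 'a::euclidean_space measure) UNIV = emeasure lborel (cball (0::'a) 1)"
  using nn_integral_cone_measure[of "\<lambda>_. 1" r] by simp

lemma finite_measure_cone_measure: "finite_measure (cone_measure r)"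
  by (rule finite_measureI) (simp add: emeasure_cone_measure_UNIV emeasure_lborel_cball_finite[unfolded infinity_ennreal_def, THEN less_imp_neq])

text \<open>Division by zero leaves the origin at 0. It is the only point of the ball that misses
  the sphere, and it is null.\<close>

lemma AE_cone_measure:
  fixes r :: real and P :: "'a::euclidean_space \<Rightarrow> bool"
  assumes "r > 0" "\<And>z. norm z = r \<Longrightarrow> P z"
  shows "AE z in cone_measure r. P z"
proof -
  have "AE z in cone_measure r. norm (z::'a) = r"
  proof -
    have "AE x in lborel. x \<noteq> (0::'a)" by (rule AE_lborel_singleton)
    then have "AE x in lborel. (x::'a) \<in> cball 0 1 \<longrightarrow> norm ((r / norm x) *\<^sub>R x) = r" 
      by eventually_elim (use assms in auto)
    then show ?thesis unfolding cone_measure_def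
      by (subst AE_distr_iff) (auto simp: AE_restrict_space_iff intro!: measurable_restrict_space1)
  qed
  then show ?thesis by eventually_elim (use assms in auto)
qed

lemma sphere_measure_eq_cone_measure:
  fixes r :: real
  assumes r: "r > 0"
  shows "(sphere_measure r :: 'a::euclidean_space measure) =
    scale_measure (ennreal (DIM('a) * r ^ (DIM('a) - 1))) (cone_measure r)"
proof (rule measure_eqI)
  fix A assume "A \<in> sets (sphere_measure r :: 'a measure)"
  then have A [measurable]: "A \<in> sets borel" by (simp add: sphere_measure_def)
  have [measurable]: "cball (0::'a) r \<in> sets borel" by simp
  have "emeasure (distr (restrict_space lborel (cball 0 r)) borel (\<lambda>x. (r / norm x) *\<^sub>R x)) A =
      (\<integral>\<^sup>+ z. indicator A z \<partial>distr (restrict_space lborel (cball 0 r)) borel (\<lambda>x. (r / norm x) *\<^sub>R x))"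
    by simp
  also have "\<dots> = (\<integral>\<^sup>+ x. indicator A ((r / norm x) *\<^sub>R x) * indicator (cball 0 r) x \<partial>lborel)"
    by (subst nn_integral_distr) (auto simp: nn_integral_restrict_space intro!: measurable_restrict_space1)
  also have "\<dots> = ennreal (\<bar>r\<bar> ^ DIM('a)) *
      (\<integral>\<^sup>+ x. indicator A ((r / norm (0 + r *\<^sub>R x)) *\<^sub>R (0 + r *\<^sub>R x)) * indicator (cball 0 r) (0 + r *\<^sub>R x) \<partial>lborel)"
    using r by (intro nn_integral_lborel_affine) auto
  also have "(\<lambda>x::'a. indicator A ((r / norm (0 + r *\<^sub>R x)) *\<^sub>R (0 + r *\<^sub>R x)) * indicator (cball 0 r) (0 + r *\<^sub>R x) :: ennreal) =
      (\<lambda>x. indicator A ((r / norm x) *\<^sub>R x) * indicator (cball 0 1) x)"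
    using r by (auto simp: fun_eq_iff indicator_def)
  also have "(\<integral>\<^sup>+ x. indicator A ((r / norm x) *\<^sub>R x) * indicator (cball 0 1) x \<partial>lborel) = emeasure (cone_measure r) A"
    using nn_integral_cone_measure[of "indicator A" r] by simp
  finally have "emeasure (sphere_measure r) A = ennreal (real DIM('a) / r) * (ennreal (r ^ DIM('a)) * emeasure (cone_measure r) A)"
    using r by (simp add: sphere_measure_def)
  also have "\<dots> = ennreal (real DIM('a) / r * r ^ DIM('a)) * emeasure (cone_measure r) A"
    unfolding mult.assoc[symmetric] using r by (subst ennreal_mult[symmetric]) auto
  also have "real DIM('a) / r * r ^ DIM('a) = DIM('a) * r ^ (DIM('a) - 1)"
    using r by (cases "DIM('a)") auto
  finally show "emeasure (sphere_measure r) A =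
      emeasure (scale_measure (ennreal (DIM('a) * r ^ (DIM('a) - 1))) (cone_measure r)) A" by simp
qed (simp add: sphere_measure_def)

lemma integral_scale_measure:
  fixes g :: "'a \<Rightarrow> real"
  assumes "c \<ge> 0" "g \<in> borel_measurable M"
  shows "integral\<^sup>L (scale_measure (ennreal c) M) g = c * integral\<^sup>L M g"
proof -
  have "scale_measure (ennreal c) M = density M (\<lambda>_. ennreal c)"
    by (rule measure_eqI) (auto simp: emeasure_density_const)
  then show ?thesis using assms by (simp add: integral_density)
qed

lemma measurable_completion_AE:
  assumes g': "g' \<in> measurable M N" and ae: "AE x in M. g x = g' x" and g: "g \<in> space M \<rightarrow> space N"
  shows "g \<in> measurable (completion M) N"
proof (rule measurableI)
  fix A assume A: "A \<in> sets N"
  show "g -` A \<inter> space (completion M) \<in> sets (completion M)"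
  proof (rule completion.in_sets_AE)
    show "AE x in completion M. (x \<in> g' -` A \<inter> space M) = (x \<in> g -` A \<inter> space (completion M))"
      using AE_completion[OF ae] by eventually_elim auto
    show "g' -` A \<inter> space M \<in> sets (completion M)"
      using measurable_sets[OF g' A] by simp
  qed auto
qed (use g in auto)

text \<open>Serves integrands that involve f, which is prescribed only where f0 is nonzero: they
  agree almost everywhere with a Borel function but may fail to be Borel themselves.\<close>

lemma integral_completion_AE:
  fixes g g' :: "'a \<Rightarrow> real"
  assumes g': "g' \<in> borel_measurable M" and ae: "AE x in M. g x = g' x"
  shows "integral\<^sup>L (completion M) g = integral\<^sup>L M g'"
proof -
  have "integral\<^sup>L (completion M) g = integral\<^sup>L (completion M) g'"
    by (intro integral_cong_AE measurable_completion_AE[OF g' ae] measurable_completion[OF g'] AE_completion ae) auto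
  then show ?thesis using integral_completion[OF g'] by simp
qed

lemma nn_integral_inverse_power_tail:
  assumes n: "n \<ge> 1" and a: "a > 0"
  shows "(\<integral>\<^sup>+ t. ennreal (n / t ^ Suc n) * indicator {a..} t \<partial>lborel) = ennreal (1 / a ^ n)"
proof -
  have "(\<integral>\<^sup>+ t. ennreal (n / t ^ Suc n) * indicator {a..} t \<partial>lborel) = ennreal (0 - (- (1 / a ^ n)))"
  proof (rule nn_integral_FTC_atLeast)
    fix x assume "a \<le> x"
    then have x: "x > 0" using a by simp
    obtain k where k: "n = Suc k" using n by (cases n) auto
    have "((\<lambda>t. - (1 / t ^ n)) has_real_derivative - ((0 * x ^ n - 1 * (real n * (1 * x ^ (n - Suc 0)))) / (x ^ n * x ^ n))) (at x)"
      using x by (intro DERIV_minus DERIV_divide DERIV_const DERIV_power DERIV_ident) auto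
    moreover have "- ((0 * x ^ n - 1 * (real n * (1 * x ^ (n - Suc 0)))) / (x ^ n * x ^ n)) = n / x ^ Suc n"
      using x by (simp add: k field_simps)
    ultimately show "((\<lambda>t. - (1 / t ^ n)) has_real_derivative n / x ^ Suc n) (at x)" by metis
    show "0 \<le> n / x ^ Suc n" using x by simp
  next
    have "((\<lambda>t::real. - (inverse t ^ n)) \<longlongrightarrow> - (0 ^ n)) at_top"
      by (intro tendsto_intros tendsto_inverse_0_at_top filterlim_ident)
    then show "((\<lambda>t::real. - (1 / t ^ n)) \<longlongrightarrow> 0) at_top"
      using n by (cases n) (auto simp: power_inverse inverse_eq_divide power_one_over)
  qed measurable
  then show ?thesis by simp
qed

text \<open>By definition of \<open>cone_measure\<close> the right side is a double integral over s
  and the unit ball. Substituting s = |x| t and then y = t x turns it into the integral of g y |y|^n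
  times the integral of n / t^(n+1) over t \<ge> |y|, which is 1 / |y|^n.\<close>

lemma nn_integral_polar:
  fixes g :: "'a::euclidean_space \<Rightarrow> ennreal"
  assumes [measurable]: "g \<in> borel_measurable borel"
  shows "(\<integral>\<^sup>+ z. g z \<partial>lborel) =
    (\<integral>\<^sup>+ s. ennreal (DIM('a) * s ^ (DIM('a) - 1)) * indicator {0<..} s * (\<integral>\<^sup>+ z. g z \<partial>cone_measure s) \<partial>lborel)"
proof -
  let ?n = "DIM('a)"
  define N where "N s = ennreal (?n * s ^ (?n - 1)) * indicator {0<..} s" for s :: real
  define B where "B = (indicator (cball 0 1) :: 'a \<Rightarrow> ennreal)"
  have [measurable]: "cball (0::'a) 1 \<in> sets borel" by simp
  have [measurable]: "N \<in> borel_measurable borel" "B \<in> borel_measurable borel"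
    unfolding N_def[abs_def] B_def by measurable
  have n: "?n \<ge> 1" by (simp add: Suc_leI)
  have nz: "AE x in lborel. x \<noteq> (0::'a)" by (rule AE_lborel_singleton)
  have N_scale: "ennreal \<bar>a\<bar> * N (a * t) = ennreal (a ^ ?n) * N t" if "a > 0" for a t
  proof (cases "t > 0")
    case True
    have "a * (?n * (a * t) ^ (?n - 1)) = a ^ ?n * (?n * t ^ (?n - 1))"
      using n by (cases ?n) (auto simp: power_mult_distrib)
    then show ?thesis using True that
      by (simp add: N_def ennreal_mult[symmetric])
  next
    case False
    then have "\<not> 0 < a * t" using that by (simp add: zero_less_mult_iff)
    then show ?thesis using False by (simp add: N_def)
  qed
  have "(\<integral>\<^sup>+ s. N s * (\<integral>\<^sup>+ z. g z \<partial>cone_measure s) \<partial>lborel) =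
      (\<integral>\<^sup>+ s. \<integral>\<^sup>+ x. N s * (g ((s / norm x) *\<^sub>R x) * B x) \<partial>lborel \<partial>lborel)"
    by (simp add: nn_integral_cone_measure B_def nn_integral_cmult)
  also have "\<dots> = (\<integral>\<^sup>+ x. \<integral>\<^sup>+ s. N s * (g ((s / norm x) *\<^sub>R x) * B x) \<partial>lborel \<partial>lborel)"
    by (rule lborel_pair.Fubini') measurable
  also have "\<dots> = (\<integral>\<^sup>+ x. \<integral>\<^sup>+ t. ennreal (norm x ^ ?n) * N t * (g (t *\<^sub>R x) * B x) \<partial>lborel \<partial>lborel)"
  proof (rule nn_integral_cong_AE, use nz in eventually_elim)
    fix x :: 'a assume x: "x \<noteq> 0"
    have "(\<integral>\<^sup>+ s. N s * (g ((s / norm x) *\<^sub>R x) * B x) \<partial>lborel) =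
        ennreal \<bar>norm x\<bar> * (\<integral>\<^sup>+ t. N (0 + norm x * t) * (g (((0 + norm x * t) / norm x) *\<^sub>R x) * B x) \<partial>lborel)"
      using x by (intro nn_integral_real_affine) auto
    also have "\<dots> = (\<integral>\<^sup>+ t. ennreal \<bar>norm x\<bar> * (N (norm x * t) * (g (t *\<^sub>R x) * B x)) \<partial>lborel)"
      using x by (simp add: nn_integral_cmult)
    also have "\<dots> = (\<integral>\<^sup>+ t. ennreal (norm x ^ ?n) * N t * (g (t *\<^sub>R x) * B x) \<partial>lborel)"
      using N_scale[of "norm x"] x by (simp add: mult.assoc[symmetric])
    finally show "(\<integral>\<^sup>+ s. N s * (g ((s / norm x) *\<^sub>R x) * B x) \<partial>lborel) =
      (\<integral>\<^sup>+ t. ennreal (norm x ^ ?n) * N t * (g (t *\<^sub>R x) * B x) \<partial>lborel)" .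
  qed
  also have "\<dots> = (\<integral>\<^sup>+ t. \<integral>\<^sup>+ x. ennreal (norm x ^ ?n) * N t * (g (t *\<^sub>R x) * B x) \<partial>lborel \<partial>lborel)"
    by (rule lborel_pair.Fubini') measurable
  also have "\<dots> = (\<integral>\<^sup>+ t. \<integral>\<^sup>+ y. ennreal (norm y ^ ?n) * g y * (ennreal (?n / t ^ Suc ?n) * indicator {0..} (t - norm y) * indicator {0<..} t) \<partial>lborel \<partial>lborel)"
  proof (rule nn_integral_cong)
    fix t :: real
    show "(\<integral>\<^sup>+ x. ennreal (norm x ^ ?n) * N t * (g (t *\<^sub>R x) * B x) \<partial>lborel) =
      (\<integral>\<^sup>+ y. ennreal (norm y ^ ?n) * g y * (ennreal (?n / t ^ Suc ?n) * indicator {0..} (t - norm y) * indicator {0<..} t) \<partial>lborel)"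
    proof (cases "t > 0")
      case True
      have *: "t ^ ?n * ((t * a) ^ ?n * (?n / t ^ Suc ?n)) = a ^ ?n * (?n * t ^ (?n - 1))" for a
        using True n by (cases ?n) (auto simp: power_mult_distrib)
      have "(\<integral>\<^sup>+ y. ennreal (norm y ^ ?n) * g y * (ennreal (?n / t ^ Suc ?n) * indicator {0..} (t - norm y) * indicator {0<..} t) \<partial>lborel) =
        ennreal (\<bar>t\<bar> ^ ?n) * (\<integral>\<^sup>+ x. ennreal (norm (0 + t *\<^sub>R x) ^ ?n) * g (0 + t *\<^sub>R x) * (ennreal (?n / t ^ Suc ?n) * indicator {0..} (t - norm (0 + t *\<^sub>R x)) * indicator {0<..} t) \<partial>lborel)"
        using True by (intro nn_integral_lborel_affine) auto
      also have "\<dots> = (\<integral>\<^sup>+ x. ennreal (t ^ ?n) * (ennreal ((t * norm x) ^ ?n) * ennreal (?n / t ^ Suc ?n)) * (g (t *\<^sub>R x) * B x) \<partial>lborel)"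
        using True by (subst nn_integral_cmult[symmetric])
          (auto simp: B_def indicator_def mult_ac intro!: nn_integral_cong)
      also have "\<dots> = (\<integral>\<^sup>+ x. ennreal (norm x ^ ?n) * N t * (g (t *\<^sub>R x) * B x) \<partial>lborel)"
        using True * by (simp add: N_def ennreal_mult[symmetric])
      finally show ?thesis ..
    qed (simp add: N_def)
  qed
  also have "\<dots> = (\<integral>\<^sup>+ y. \<integral>\<^sup>+ t. ennreal (norm y ^ ?n) * g y * (ennreal (?n / t ^ Suc ?n) * indicator {0..} (t - norm y) * indicator {0<..} t) \<partial>lborel \<partial>lborel)"
    by (rule lborel_pair.Fubini') measurable
  also have "\<dots> = (\<integral>\<^sup>+ y. g y \<partial>lborel)"
  proof (rule nn_integral_cong_AE, use nz in eventually_elim)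
    fix y :: 'a assume y: "y \<noteq> 0"
    have "(\<integral>\<^sup>+ t. ennreal (norm y ^ ?n) * g y * (ennreal (?n / t ^ Suc ?n) * indicator {0..} (t - norm y) * indicator {0<..} t) \<partial>lborel) =
       ennreal (norm y ^ ?n) * g y * (\<integral>\<^sup>+ t. ennreal (?n / t ^ Suc ?n) * indicator {norm y..} t \<partial>lborel)"
    proof (subst nn_integral_cmult[symmetric])
      have "\<not> norm y \<le> t" if "t \<le> 0" for t using that y by (smt (verit) zero_less_norm_iff)
      then show "(\<integral>\<^sup>+ t. ennreal (norm y ^ ?n) * g y * (ennreal (?n / t ^ Suc ?n) * indicator {0..} (t - norm y) * indicator {0<..} t) \<partial>lborel) =
        (\<integral>\<^sup>+ t. ennreal (norm y ^ ?n) * g y * (ennreal (?n / t ^ Suc ?n) * indicator {norm y..} t) \<partial>lborel)"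
        by (intro nn_integral_cong) (auto simp: indicator_def not_less)
    qed measurable
    also have "\<dots> = ennreal (norm y ^ ?n) * g y * ennreal (1 / norm y ^ ?n)"
      using y n by (subst nn_integral_inverse_power_tail) auto
    also have "\<dots> = (ennreal (norm y ^ ?n) * ennreal (1 / norm y ^ ?n)) * g y"
      by (simp only: mult_ac)
    also have "ennreal (norm y ^ ?n) * ennreal (1 / norm y ^ ?n) = 1"
      using y by (subst ennreal_mult[symmetric]) auto
    also have "1 * g y = g y" by simp
    finally show "(\<integral>\<^sup>+ t. ennreal (norm y ^ ?n) * g y * (ennreal (?n / t ^ Suc ?n) * indicator {0..} (t - norm y) * indicator {0<..} t) \<partial>lborel) = g y" .
  qed
  finally show ?thesis unfolding N_def ..
qed

section \<open>Subharmonicity on complex lines\<close>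

definition circ :: "real \<Rightarrow> complex" where
  "circ t = exp (2 * of_real pi * \<i> * of_real t)"

lemma norm_circ [simp]: "cmod (circ t) = 1"
  by (simp add: circ_def norm_exp_eq_Re)

lemma circ_0 [simp]: "circ 0 = 1"
  by (simp add: circ_def)

lemma continuous_on_circ [continuous_intros]:
  "continuous_on A f \<Longrightarrow> continuous_on A (\<lambda>x. circ (f x))"
  unfolding circ_def by (intro continuous_intros)

text \<open>Cauchy's formula on the unit circle for the function u \<mapsto> k (a + d u).\<close>

lemma holomorphic_mean_value:
  assumes k: "k holomorphic_on ball a \<rho>" and d: "cmod d < \<rho>"
  shows "((\<lambda>t. k (a + d * circ t)) has_integral k a) {0..1}"
proof -
  define f where "f = (\<lambda>u. k (a + d * u))"
  define C where "C = 2 * of_real pi * \<i>"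
  have C: "C \<noteq> 0" by (simp add: C_def)
  have "f holomorphic_on cball 0 1"
    unfolding f_def
  proof (rule holomorphic_on_compose_gen[OF _ k, unfolded o_def])
    show "(\<lambda>u. a + d * u) ` cball 0 1 \<subseteq> ball a \<rho>"
    proof clarify
      fix u :: complex assume "u \<in> cball 0 1"
      then have "cmod d * cmod u \<le> cmod d" by (simp add: mult_left_le)
      then show "a + d * u \<in> ball a \<rho>" using d by (simp add: dist_norm norm_mult)
    qed
  qed (intro holomorphic_intros)
  then have "((\<lambda>u. f u / (u - 0)) has_contour_integral (2 * of_real pi * \<i> * f 0)) (circlepath 0 1)"
    by (rule Cauchy_integral_circlepath_simple) simp
  then have "((\<lambda>t. f (circlepath 0 1 t) / (circlepath 0 1 t - 0) * vector_derivative (circlepath 0 1) (at t within {0..1}))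
      has_integral (2 * of_real pi * \<i> * f 0)) {0..1}"
    by (simp add: has_contour_integral_def)
  moreover have "f (circlepath 0 1 t) / (circlepath 0 1 t - 0) * vector_derivative (circlepath 0 1) (at t within {0..1}) =
      (2 * of_real pi * \<i>) * f (circ t)" if "t \<in> {0..1}" for t
  proof -
    have vd: "vector_derivative (circlepath 0 1) (at t within {0..1}) = 2 * of_real pi * \<i> * circ t"
      using vector_derivative_circlepath01[of t 0 1] that by (simp add: circ_def)
    have cp: "circlepath 0 1 t = circ t" by (simp add: circlepath circ_def)
    have "circ t \<noteq> 0" by (simp add: circ_def)
    then show ?thesis unfolding vd cp by simp
  qed
  ultimately have "((\<lambda>t. (2 * of_real pi * \<i>) * f (circ t)) has_integral (2 * of_real pi * \<i>) * f 0) {0..1}"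
    by (rule has_integral_eq[rotated])
  then have "((\<lambda>t. C * f (circ t)) has_integral C * f 0) {0..1}"
    unfolding C_def .
  from has_integral_mult_right[OF this, of "inverse C"]
  have "((\<lambda>t. f (circ t)) has_integral f 0) {0..1}"
    using C by (simp flip: mult.assoc)
  then show ?thesis by (simp add: f_def)
qed

text \<open>A positive real part makes the principal logarithm of g holomorphic, and log |g| is its
  real part.\<close>

lemma log_norm_mean_value:
  assumes g: "g holomorphic_on ball a \<rho>" and re: "\<And>\<zeta>. \<zeta> \<in> ball a \<rho> \<Longrightarrow> 0 < Re (g \<zeta>)"
    and d: "cmod d < \<rho>"
  shows "((\<lambda>t. ln (cmod (g (a + d * circ t)))) has_integral ln (cmod (g a))) {0..1}"
proof -
  have nz: "g \<zeta> \<notin> \<real>\<^sub>\<le>\<^sub>0" "g \<zeta> \<noteq> 0" if "\<zeta> \<in> ball a \<rho>" for \<zeta>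
    using re[OF that] by (auto simp: complex_nonpos_Reals_iff)
  have "(\<lambda>\<zeta>. Ln (g \<zeta>)) holomorphic_on ball a \<rho>"
    using g nz by (intro holomorphic_on_Ln') auto
  then have "((\<lambda>t. Re (Ln (g (a + d * circ t)))) has_integral Re (Ln (g a))) {0..1}"
    by (intro has_integral_Re holomorphic_mean_value[OF _ d])
  moreover have "a + d * circ t \<in> ball a \<rho>" for t using d by (simp add: dist_norm norm_mult)
  moreover have "a \<in> ball a \<rho>" using d by (auto simp: le_less_trans[OF norm_ge_zero])
  ultimately show ?thesis using nz by simp
qed

text \<open>Cauchy-Schwarz in dimension 3 for the moduli, with sqrt \<epsilon> as third component of
  both vectors, by Lagrange's identity.\<close>

lemma norm_inner_eps_le:
  fixes x y a b :: complex
  assumes "\<epsilon> > 0"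
  shows "(cmod (x * cnj a + y * cnj b + of_real \<epsilon>))\<^sup>2 \<le>
    ((cmod x)\<^sup>2 + (cmod y)\<^sup>2 + \<epsilon>) * ((cmod a)\<^sup>2 + (cmod b)\<^sup>2 + \<epsilon>)"
proof -
  have "cmod (x * cnj a + y * cnj b + of_real \<epsilon>) \<le> cmod (x * cnj a) + cmod (y * cnj b) + cmod (of_real \<epsilon>)"
    by (intro order_trans[OF norm_triangle_ineq] add_right_mono norm_triangle_ineq)
  also have "\<dots> = cmod x * cmod a + cmod y * cmod b + \<epsilon>"
    using assms by (simp add: norm_mult)
  finally have "(cmod (x * cnj a + y * cnj b + of_real \<epsilon>))\<^sup>2 \<le> (cmod x * cmod a + cmod y * cmod b + \<epsilon>)\<^sup>2"
    by (intro power_mono) auto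
  also have "\<dots> \<le> ((cmod x)\<^sup>2 + (cmod y)\<^sup>2 + \<epsilon>) * ((cmod a)\<^sup>2 + (cmod b)\<^sup>2 + \<epsilon>)"
  proof -
    have "(p\<^sup>2 + q\<^sup>2 + \<epsilon>) * (r\<^sup>2 + s\<^sup>2 + \<epsilon>) - (p * r + q * s + \<epsilon>)\<^sup>2 =
        (p * s - q * r)\<^sup>2 + \<epsilon> * (p - r)\<^sup>2 + \<epsilon> * (q - s)\<^sup>2" for p q r s :: real
      by (simp add: power2_eq_square algebra_simps)
    moreover have "(p * s - q * r)\<^sup>2 + \<epsilon> * (p - r)\<^sup>2 + \<epsilon> * (q - s)\<^sup>2 \<ge> 0" for p q r s :: real
      using assms by simp
    ultimately show ?thesis by (metis diff_ge_0_iff_ge)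
  qed
  finally show ?thesis .
qed

text \<open>The regularised logarithm of the norm of \<open>h = (h0, h1, sqrt \<epsilon>)\<close> dominates
  the logarithm of the modulus of the holomorphic function \<open>\<langle>h, h a\<rangle> / \<parallel>h a\<parallel>\<close>, with
  equality at a.\<close>

lemma log_sum_squares_submean:
  assumes h0: "h0 holomorphic_on ball a \<rho>" and h1: "h1 holomorphic_on ball a \<rho>" and \<epsilon>: "\<epsilon> > 0"
    and near: "\<And>\<zeta>. \<zeta> \<in> ball a \<rho> \<Longrightarrow> (cmod (h0 \<zeta> - h0 a))\<^sup>2 + (cmod (h1 \<zeta> - h1 a))\<^sup>2 < 2 * \<epsilon>"
    and d: "cmod d < \<rho>"
  shows "ln ((cmod (h0 a))\<^sup>2 + (cmod (h1 a))\<^sup>2 + \<epsilon>) / 2 \<le>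
    integral {0..1} (\<lambda>t. ln ((cmod (h0 (a + d * circ t)))\<^sup>2 + (cmod (h1 (a + d * circ t)))\<^sup>2 + \<epsilon>) / 2)"
proof -
  define S where "S \<zeta> = (cmod (h0 \<zeta>))\<^sup>2 + (cmod (h1 \<zeta>))\<^sup>2 + \<epsilon>" for \<zeta>
  have S: "S \<zeta> > 0" for \<zeta> using \<epsilon> by (simp add: S_def add_nonneg_pos)
  define g where "g \<zeta> = h0 \<zeta> * cnj (h0 a) + h1 \<zeta> * cnj (h1 a) + of_real \<epsilon>" for \<zeta>
  have inb: "a + d * circ t \<in> ball a \<rho>" for t using d by (simp add: dist_norm norm_mult)
  have ga: "g a = of_real (S a)"
    unfolding g_def S_def by (simp only: of_real_add complex_norm_square)
  have re: "0 < Re (g \<zeta>)" if "\<zeta> \<in> ball a \<rho>" for \<zeta>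
  proof -
    \<comment> \<open>Polarisation: twice the real part of the inner product is a sum of squared
      norms minus the squared distance, which is below 2 \<epsilon>; the third component contributes
      the compensating \<epsilon>.\<close>
    have pol: "2 * Re (x * cnj y) = (cmod x)\<^sup>2 + (cmod y)\<^sup>2 - (cmod (x - y))\<^sup>2" for x y
      unfolding cmod_power2 by (simp add: power2_eq_square algebra_simps)
    have "Re (g \<zeta>) = Re (h0 \<zeta> * cnj (h0 a)) + Re (h1 \<zeta> * cnj (h1 a)) + \<epsilon>"
      by (simp only: g_def plus_complex.simps Re_complex_of_real)
    then show ?thesis
      using near[OF that] pol[of "h0 \<zeta>" "h0 a"] pol[of "h1 \<zeta>" "h1 a"]
        zero_le_power2[of "cmod (h0 \<zeta>)"] zero_le_power2[of "cmod (h0 a)"]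
        zero_le_power2[of "cmod (h1 \<zeta>)"] zero_le_power2[of "cmod (h1 a)"] by linarith
  qed
  have le: "ln (cmod (g \<zeta>)) \<le> ln (S \<zeta>) / 2 + ln (S a) / 2" if "\<zeta> \<in> ball a \<rho>" for \<zeta>
  proof -
    have pos: "cmod (g \<zeta>) > 0" using re[OF that] by auto
    have "2 * ln (cmod (g \<zeta>)) = ln ((cmod (g \<zeta>))\<^sup>2)" using pos by (simp add: ln_realpow)
    also have "\<dots> \<le> ln (S \<zeta> * S a)"
    proof (rule ln_mono)
      show "(cmod (g \<zeta>))\<^sup>2 \<le> S \<zeta> * S a"
        unfolding g_def S_def by (rule norm_inner_eps_le[OF \<epsilon>])
      show "0 < (cmod (g \<zeta>))\<^sup>2" using pos by simp
    qed
    also have "\<dots> = ln (S \<zeta>) + ln (S a)" using S by (intro ln_mult_pos)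
    finally show ?thesis by simp
  qed
  have gh: "g holomorphic_on ball a \<rho>"
    unfolding g_def by (intro holomorphic_intros h0 h1)
  note I = log_norm_mean_value[OF gh re d]
  have cont: "continuous_on {0..1} (\<lambda>t. ln (S (a + d * circ t)) / 2)"
  proof -
    have "continuous_on {0..1} (\<lambda>t. h (a + d * circ t))" if "h holomorphic_on ball a \<rho>" for h
      using inb by (intro continuous_on_compose2[OF holomorphic_on_imp_continuous_on[OF that]] continuous_intros) auto
    then show ?thesis
      unfolding S_def using h0 h1 S[unfolded S_def] by (intro continuous_intros) (auto simp: less_imp_neq[symmetric])
  qed
  then have int: "(\<lambda>t. ln (S (a + d * circ t)) / 2) integrable_on {0..1}"
    by (rule integrable_continuous_interval)
  then have "((\<lambda>t. ln (S (a + d * circ t)) / 2 + ln (S a) / 2) has_integral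
      integral {0..1} (\<lambda>t. ln (S (a + d * circ t)) / 2) + ln (S a) / 2) {0..1}"
    using has_integral_const_real[of "ln (S a) / 2" 0 1] by (intro has_integral_add integrable_integral) auto
  with I have "ln (cmod (g a)) \<le> integral {0..1} (\<lambda>t. ln (S (a + d * circ t)) / 2) + ln (S a) / 2"
    by (rule has_integral_le) (use le inb in auto)
  moreover have "cmod (g a) = S a" using S[of a] by (simp add: ga)
  ultimately have "ln (S a) / 2 \<le> integral {0..1} (\<lambda>t. ln (S (a + d * circ t)) / 2)" by simp
  then show ?thesis unfolding S_def .
qed

lemma bounded_linear_vector_scalar: "bounded_linear (\<lambda>\<zeta>::complex. \<zeta> *s (y :: complex ^ 'm::finite))"
  unfolding linear_conv_bounded_linear[symmetric]
  by (rule linearI) (auto simp: vec_eq_iff vector_scalar_mult_def algebra_simps)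

lemma bounded_linear_scalar_vector: "bounded_linear (\<lambda>y. \<zeta> *s (y :: complex ^ 'm::finite))"
  unfolding linear_conv_bounded_linear[symmetric]
  by (rule linearI) (auto simp: vec_eq_iff vector_scalar_mult_def algebra_simps)

lemma norm_vector_scalar: "norm (\<zeta> *s (y :: complex ^ 'm::finite)) = cmod \<zeta> * norm y"
  by (simp add: norm_vec_def vector_scalar_mult_def norm_mult L2_set_right_distrib)

lemma of_real_vector_scalar: "of_real s *s (y :: complex ^ 'm::finite) = s *\<^sub>R y"
  by (simp add: vec_eq_iff scaleR_conv_of_real[where 'a=complex])

lemma continuous_on_vector_scalar [continuous_intros]:
  fixes f :: "'a::topological_space \<Rightarrow> complex" and g :: "'a \<Rightarrow> complex ^ 'm::finite"
  assumes "continuous_on A f" "continuous_on A g"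
  shows "continuous_on A (\<lambda>x. f x *s g x)"
  unfolding vector_scalar_mult_def by (intro continuous_intros assms)

lemma entire_Cm_continuous_on: "entire_Cm F \<Longrightarrow> continuous_on A F"
  unfolding holomorphic_Cm_def continuous_on_eq_continuous_within
  by (meson UNIV_I continuous_at_imp_continuous_at_within has_derivative_continuous)

lemma entire_Cm_slice:
  fixes F :: "complex ^ 'm::finite \<Rightarrow> complex"
  assumes F: "entire_Cm F"
  shows "(\<lambda>\<zeta>. F (\<zeta> *s y)) holomorphic_on A"
proof -
  have "\<exists>D. ((\<lambda>\<zeta>. F (\<zeta> *s y)) has_field_derivative D) (at \<zeta>)" for \<zeta>
  proof -
    obtain D where D: "(F has_derivative D) (at (\<zeta> *s y))" "\<And>a v. D (a *s v) = a * D v"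
      using F unfolding holomorphic_Cm_def by blast
    have "((\<lambda>\<zeta>. F (\<zeta> *s y)) has_derivative (\<lambda>h. D (h *s y))) (at \<zeta>)"
      by (rule has_derivative_compose[OF bounded_linear.has_derivative[OF bounded_linear_vector_scalar has_derivative_ident] D(1)])
    moreover have "(\<lambda>h. D (h *s y)) = (*) (D y)" by (simp add: D(2) fun_eq_iff)
    ultimately show ?thesis
      unfolding has_field_derivative_def by auto
  qed
  then show ?thesis
    unfolding holomorphic_on_def field_differentiable_def
    by (meson has_field_derivative_at_within)
qed

lemma entire_Cm_affine:
  fixes F :: "complex ^ 'm::finite \<Rightarrow> complex"
  assumes F: "entire_Cm F"
  shows "entire_Cm (\<lambda>z. F (b + a *s z))"
  unfolding holomorphic_Cm_def
proof
  fix z :: "complex ^ 'm"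
  obtain D where D: "(F has_derivative D) (at (b + a *s z))" "\<And>a v. D (a *s v) = a * D v"
    using F unfolding holomorphic_Cm_def by blast
  have "((\<lambda>z. b + a *s z) has_derivative (\<lambda>v. a *s v)) (at z)"
    using has_derivative_add[OF has_derivative_const bounded_linear.has_derivative[OF bounded_linear_scalar_vector has_derivative_ident]]
    by simp
  from has_derivative_compose[OF this D(1)]
  have "((\<lambda>z. F (b + a *s z)) has_derivative (\<lambda>v. a * D v)) (at z)" by (simp add: D(2))
  moreover have "a * D (a' *s v) = a' * (a * D v)" for a' v by (simp add: D(2))
  ultimately show "\<exists>D. ((\<lambda>z. F (b + a *s z)) has_derivative D) (at z) \<and> (\<forall>a v. D (a *s v) = a * D v)"
    by blast
qed

section \<open>Regularised logarithms and their means on complex lines\<close>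

lemma integral_lborel_orthogonal:
  fixes U :: "'a::euclidean_space \<Rightarrow> 'a" and g :: "'a \<Rightarrow> real"
  assumes U: "orthogonal_transformation U" and g [measurable]: "g \<in> borel_measurable borel"
  shows "(LINT x|lborel. g (U x)) = (LINT x|lborel. g x)"
proof -
  note [measurable] = orthogonal_transformation_measurable[OF U]
  have "distr lborel borel U = lborel"
  proof (rule measure_eqI)
    fix A assume "A \<in> sets (distr lborel borel U)"
    then have [measurable]: "A \<in> sets borel" by simp
    have "emeasure (distr lborel borel U) A = (\<integral>\<^sup>+ x. indicator A x \<partial>distr lborel borel U)" by simp
    also have "\<dots> = (\<integral>\<^sup>+ x. indicator A (U x) \<partial>lborel)" by (rule nn_integral_distr) auto
    also have "\<dots> = emeasure lborel A" by (subst nn_integral_lborel_orthogonal[OF U]) auto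
    finally show "emeasure (distr lborel borel U) A = emeasure lborel A" .
  qed simp
  then have "(LINT x|lborel. g x) = (LINT x|distr lborel borel U. g x)" by simp
  also have "\<dots> = (LINT x|lborel. g (U x))" by (rule integral_distr) auto
  finally show ?thesis ..
qed

lemma finite_measure_unit_ball: "finite_measure (restrict_space lborel (cball (0::'a::euclidean_space) 1))"
  by (rule finite_measureI)
    (simp add: emeasure_restrict_space space_restrict_space emeasure_lborel_cball_finite[unfolded infinity_ennreal_def, THEN less_imp_neq])

lemma integral_cone_measure:
  fixes g :: "'a::euclidean_space \<Rightarrow> real"
  assumes [measurable]: "g \<in> borel_measurable borel"
  shows "(LINT z|cone_measure s. g z) = (LINT x|restrict_space lborel (cball 0 1). g (s *\<^sub>R sgn x))"
  unfolding cone_measure_def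
  by (subst integral_distr) (auto simp: sgn_div_norm divide_inverse intro!: measurable_restrict_space1)

text \<open>One development serves three cases: (f0, 0) for log |f0|, (f1, 0) for log |f1|, and (f0,
  f1) for the logarithm of the norm.\<close>

locale entire_pair =
  fixes F0 F1 :: "complex ^ 'm::finite \<Rightarrow> complex"
  assumes entire_F0: "entire_Cm F0" and entire_F1: "entire_Cm F1"
begin

definition nsq :: "complex ^ 'm \<Rightarrow> real" where
  "nsq z = (cmod (F0 z))\<^sup>2 + (cmod (F1 z))\<^sup>2"

definition ueps :: "real \<Rightarrow> complex ^ 'm \<Rightarrow> real" where
  "ueps \<epsilon> z = ln (nsq z + \<epsilon>) / 2"

text \<open>The radius is made complex: \<open>Phi \<epsilon>\<close> is a radial subharmonic
  function of one variable, whose value at a positive real s is the integral of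
  \<open>ueps \<epsilon>\<close> against \<open>cone_measure s\<close>. One-variable arguments then
  settle spherical means in every dimension.\<close>

definition Phi :: "real \<Rightarrow> complex \<Rightarrow> real" where
  "Phi \<epsilon> \<zeta> = (LINT x|restrict_space lborel (cball 0 1). ueps \<epsilon> (\<zeta> *s sgn x))"

lemma nsq_nonneg: "nsq z \<ge> 0"
  by (simp add: nsq_def)

lemma continuous_on_nsq: "continuous_on A nsq"
  unfolding nsq_def by (intro continuous_intros entire_Cm_continuous_on entire_F0 entire_F1)

lemma nsq_measurable [measurable]: "nsq \<in> borel_measurable borel"
  by (intro borel_measurable_continuous_onI continuous_on_nsq)

lemma nsq_eps_pos: "\<epsilon> > 0 \<Longrightarrow> nsq z + \<epsilon> > 0"
  using nsq_nonneg[of z] by simp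

lemma continuous_on_ueps: "\<epsilon> > 0 \<Longrightarrow> continuous_on A (ueps \<epsilon>)"
  unfolding ueps_def using nsq_eps_pos[of \<epsilon>]
  by (intro continuous_intros continuous_on_nsq) (auto simp: less_imp_neq[symmetric])

lemma ueps_measurable [measurable]: "ueps \<epsilon> \<in> borel_measurable borel"
  unfolding ueps_def by measurable

lemma ueps_bounded:
  assumes "\<epsilon> > 0"
  shows "\<exists>B. \<forall>z. norm z \<le> T \<longrightarrow> \<bar>ueps \<epsilon> z\<bar> \<le> B"
proof -
  have "bounded (ueps \<epsilon> ` cball 0 T)"
    by (intro compact_imp_bounded compact_continuous_image continuous_on_ueps assms compact_cball)
  then obtain B where "\<forall>x\<in>ueps \<epsilon> ` cball 0 T. norm x \<le> B" unfolding bounded_iff by blast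
  then show ?thesis by (intro exI[of _ B]) auto
qed

text \<open>Uniform continuity on a compact ball yields one \<delta> for all x, so that the
  inequality can be integrated over x.\<close>

lemma local_submean:
  assumes \<epsilon>: "\<epsilon> > 0"
  shows "\<exists>\<delta>>0. \<forall>x d. norm x \<le> 1 \<longrightarrow> cmod d < \<delta> \<longrightarrow>
    ueps \<epsilon> (\<zeta> *s x) \<le> integral {0..1} (\<lambda>t. ueps \<epsilon> ((\<zeta> + d * circ t) *s x))"
proof -
  let ?K = "cball (0 :: complex ^ 'm) (cmod \<zeta> + 1)"
  have uc: "uniformly_continuous_on ?K F" if "entire_Cm F" for F
    by (intro compact_uniformly_continuous entire_Cm_continuous_on that compact_cball)
  obtain \<delta>0 where \<delta>0: "\<delta>0 > 0" "\<And>z z'. z \<in> ?K \<Longrightarrow> z' \<in> ?K \<Longrightarrow> dist z' z < \<delta>0 \<Longrightarrow> dist (F0 z') (F0 z) < sqrt \<epsilon>"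
    using uc[OF entire_F0] \<epsilon> unfolding uniformly_continuous_on_def by (meson real_sqrt_gt_zero)
  obtain \<delta>1 where \<delta>1: "\<delta>1 > 0" "\<And>z z'. z \<in> ?K \<Longrightarrow> z' \<in> ?K \<Longrightarrow> dist z' z < \<delta>1 \<Longrightarrow> dist (F1 z') (F1 z) < sqrt \<epsilon>"
    using uc[OF entire_F1] \<epsilon> unfolding uniformly_continuous_on_def by (meson real_sqrt_gt_zero)
  \<comment> \<open>The bound 1 keeps \<open>\<xi> *s x\<close> inside the compact ball
    \<open>?K\<close>.\<close>
  define \<delta> where "\<delta> = min 1 (min \<delta>0 \<delta>1)"
  show ?thesis
  proof (intro exI[of _ \<delta>] conjI allI impI)
    show "\<delta> > 0" using \<delta>0 \<delta>1 by (simp add: \<delta>_def)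
    fix x :: "complex ^ 'm" and d :: complex assume x: "norm x \<le> 1" and d: "cmod d < \<delta>"
    have zK: "\<zeta> *s x \<in> ?K"
      using mult_left_le[OF x, of "cmod \<zeta>"] by (simp add: norm_vector_scalar)
    have sq: "a\<^sup>2 < \<epsilon>" if "cmod b < sqrt \<epsilon>" "a = cmod b" for a b
      using power_strict_mono[OF that(1), of 2] \<epsilon> that(2) by simp
    have near: "(cmod (F0 (\<xi> *s x) - F0 (\<zeta> *s x)))\<^sup>2 + (cmod (F1 (\<xi> *s x) - F1 (\<zeta> *s x)))\<^sup>2 < 2 * \<epsilon>"
      if "\<xi> \<in> ball \<zeta> \<delta>" for \<xi>
    proof -
      have lt: "cmod (\<xi> - \<zeta>) < \<delta>" using that by (simp add: dist_norm norm_minus_commute)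
      have "cmod \<xi> \<le> cmod \<zeta> + 1"
        using lt norm_triangle_sub[of \<xi> \<zeta>] by (simp add: \<delta>_def)
      then have K: "\<xi> *s x \<in> ?K"
        using mult_left_le[OF x, of "cmod \<xi>"] by (simp add: norm_vector_scalar)
      have "\<xi> *s x - \<zeta> *s x = (\<xi> - \<zeta>) *s x" by (simp add: vec_eq_iff algebra_simps)
      then have "dist (\<xi> *s x) (\<zeta> *s x) \<le> cmod (\<xi> - \<zeta>)"
        using mult_left_le[OF x, of "cmod (\<xi> - \<zeta>)"] by (simp only: dist_norm norm_vector_scalar norm_ge_zero)
      then have "dist (\<xi> *s x) (\<zeta> *s x) < \<delta>0" "dist (\<xi> *s x) (\<zeta> *s x) < \<delta>1"
        using lt by (auto simp: \<delta>_def)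
      then have "cmod (F0 (\<xi> *s x) - F0 (\<zeta> *s x)) < sqrt \<epsilon>" "cmod (F1 (\<xi> *s x) - F1 (\<zeta> *s x)) < sqrt \<epsilon>"
        using \<delta>0(2)[OF zK K] \<delta>1(2)[OF zK K] by (simp_all add: dist_norm)
      then have "(cmod (F0 (\<xi> *s x) - F0 (\<zeta> *s x)))\<^sup>2 < \<epsilon>" "(cmod (F1 (\<xi> *s x) - F1 (\<zeta> *s x)))\<^sup>2 < \<epsilon>"
        using sq by blast+
      then show ?thesis by simp
    qed
    show "ueps \<epsilon> (\<zeta> *s x) \<le> integral {0..1} (\<lambda>t. ueps \<epsilon> ((\<zeta> + d * circ t) *s x))"
      unfolding ueps_def nsq_def
      using log_sum_squares_submean[where ?h0.0 = "\<lambda>\<xi>. F0 (\<xi> *s x)" and ?h1.0 = "\<lambda>\<xi>. F1 (\<xi> *s x)",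
        OF entire_Cm_slice[OF entire_F0] entire_Cm_slice[OF entire_F1] \<epsilon> near d] .
  qed
qed

lemma sgn_slice_measurable [measurable]:
  "(\<lambda>x. ueps \<epsilon> (\<zeta> *s sgn x)) \<in> borel_measurable borel"
proof -
  have [measurable]: "(\<lambda>x :: complex ^ 'm. \<zeta> *s x) \<in> borel_measurable borel"
    by (intro borel_measurable_continuous_onI continuous_intros)
  show ?thesis by measurable
qed

lemma norm_scalar_sgn_le: "norm (\<zeta> *s sgn (x :: complex ^ 'm)) \<le> cmod \<zeta>"
  by (simp add: norm_vector_scalar norm_sgn)

lemma Phi_submean:
  assumes \<epsilon>: "\<epsilon> > 0" and contPhi: "continuous_on UNIV (Phi \<epsilon>)"
  shows "\<exists>\<delta>>0. \<forall>d. cmod d < \<delta> \<longrightarrow> Phi \<epsilon> \<zeta> \<le> integral {0..1} (\<lambda>t. Phi \<epsilon> (\<zeta> + d * circ t))"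
proof -
  obtain \<delta> where \<delta>: "\<delta> > 0" "\<And>x d. norm x \<le> 1 \<Longrightarrow> cmod d < \<delta> \<Longrightarrow>
    ueps \<epsilon> (\<zeta> *s x) \<le> integral {0..1} (\<lambda>t. ueps \<epsilon> ((\<zeta> + d * circ t) *s x))"
    using local_submean[OF \<epsilon>, where \<zeta> = \<zeta>] by blast
  show ?thesis
  proof (intro exI[of _ \<delta>] conjI allI impI \<delta>(1))
    fix d assume d: "cmod d < \<delta>"
    let ?M = "restrict_space lborel (cball (0::complex ^ 'm) 1)"
    let ?L = "restrict_space lborel {0..1::real}"
    let ?f = "\<lambda>t x. ueps \<epsilon> ((\<zeta> + d * circ t) *s sgn x)"
    interpret M: finite_measure ?M by (rule finite_measure_unit_ball)
    interpret L: finite_measure ?L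
      by (rule finite_measureI) (simp add: emeasure_restrict_space space_restrict_space)
    interpret LM: pair_sigma_finite ?L ?M by unfold_locales
    obtain B where B: "\<And>z. norm z \<le> cmod \<zeta> + cmod d \<Longrightarrow> \<bar>ueps \<epsilon> z\<bar> \<le> B"
      using ueps_bounded[OF \<epsilon>, where T = "cmod \<zeta> + cmod d"] by blast
    have bd: "\<bar>?f t x\<bar> \<le> B" for t x
      by (rule B[OF order_trans[OF norm_scalar_sgn_le]]) (metis norm_circ mult.right_neutral norm_mult norm_triangle_ineq)
    have [measurable]: "(\<lambda>p. (\<zeta> + d * circ (fst p)) *s (snd p :: complex ^ 'm)) \<in> borel_measurable borel"
      by (intro borel_measurable_continuous_onI continuous_intros)
    have meas: "case_prod ?f \<in> borel_measurable (borel \<Otimes>\<^sub>M borel)"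
    proof -
      have "(\<lambda>p. (fst p, sgn (snd p))) \<in> (borel :: real measure) \<Otimes>\<^sub>M (borel :: (complex ^ 'm) measure) \<rightarrow>\<^sub>M borel"
        by (subst borel_prod[symmetric]) measurable
      moreover have "(\<lambda>p. ueps \<epsilon> ((\<zeta> + d * circ (fst p)) *s (snd p :: complex ^ 'm))) \<in> borel_measurable borel"
        by (intro measurable_compose[OF _ ueps_measurable]) measurable
      ultimately have "(\<lambda>p. ueps \<epsilon> ((\<zeta> + d * circ (fst (fst p, sgn (snd p)))) *s snd (fst p, sgn (snd p :: complex ^ 'm))))
          \<in> borel_measurable ((borel :: real measure) \<Otimes>\<^sub>M borel)"
        by (rule measurable_compose)
      then show ?thesis by (simp only: case_prod_unfold fst_conv snd_conv)
    qed
    have meas': "case_prod ?f \<in> borel_measurable (?L \<Otimes>\<^sub>M ?M)"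
    proof -
      have "id \<in> ?L \<Otimes>\<^sub>M ?M \<rightarrow>\<^sub>M (borel :: real measure) \<Otimes>\<^sub>M (borel :: (complex ^ 'm) measure)"
        unfolding id_def by (rule measurable_Pair[of fst _ _ snd, simplified])
          (auto intro!: measurable_compose[OF measurable_fst] measurable_compose[OF measurable_snd] measurable_restrict_space1)
      from measurable_compose[OF this meas] show ?thesis by simp
    qed
    have int: "integrable (?L \<Otimes>\<^sub>M ?M) (case_prod ?f)"
    proof (rule finite_measure.integrable_const_bound[where B = B])
      show "finite_measure (?L \<Otimes>\<^sub>M ?M)"
        by (rule finite_measure_pair_measure) unfold_locales
    qed (use bd meas' in auto)
    have conv: "(LINT t|?L. g t) = integral {0..1} g" if "continuous_on {0..1} g" for g :: "real \<Rightarrow> real"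
      using set_borel_integral_eq_integral(2)[OF borel_integrable_atLeastAtMost'[OF that]]
      by (simp add: integral_restrict_space set_lebesgue_integral_def)
    have "Phi \<epsilon> \<zeta> \<le> (LINT x|?M. integral {0..1} (\<lambda>t. ?f t x))"
      unfolding Phi_def
    proof (rule integral_mono)
      show "integrable ?M (\<lambda>x. ueps \<epsilon> (\<zeta> *s sgn x))"
        by (rule M.integrable_const_bound[where B = B])
          (auto intro!: measurable_restrict_space1 B order_trans[OF norm_scalar_sgn_le])
      have "(\<lambda>x. integral {0..1} (\<lambda>t. ?f t x)) = (\<lambda>x. LINT t|?L. ?f t x)"
        by (intro ext conv[symmetric] continuous_on_compose2[OF continuous_on_ueps[OF \<epsilon>, of UNIV]] continuous_intros) auto
      then show "integrable ?M (\<lambda>x. integral {0..1} (\<lambda>t. ?f t x))"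
        using LM.integrable_snd[OF int] by simp
      show "ueps \<epsilon> (\<zeta> *s sgn x) \<le> integral {0..1} (\<lambda>t. ?f t x)" for x
        using d by (intro \<delta>(2)) (auto simp: norm_sgn)
    qed
    also have "\<dots> = (LINT x|?M. LINT t|?L. ?f t x)"
      by (intro Bochner_Integration.integral_cong refl conv[symmetric] continuous_on_compose2[OF continuous_on_ueps[OF \<epsilon>, of UNIV]] continuous_intros) auto
    also have "\<dots> = (LINT t|?L. LINT x|?M. ?f t x)"
      by (rule LM.Fubini_integral[OF int])
    also have "\<dots> = integral {0..1} (\<lambda>t. Phi \<epsilon> (\<zeta> + d * circ t))"
      unfolding Phi_def[symmetric]
      by (intro conv continuous_on_compose2[OF contPhi] continuous_intros) auto
    finally show "Phi \<epsilon> \<zeta> \<le> integral {0..1} (\<lambda>t. Phi \<epsilon> (\<zeta> + d * circ t))" .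
  qed
qed

lemma continuous_on_Phi:
  assumes \<epsilon>: "\<epsilon> > 0"
  shows "continuous_on A (Phi \<epsilon>)"
proof (rule continuous_on_subset[OF _ subset_UNIV])
  let ?M = "restrict_space lborel (cball (0::complex ^ 'm) 1)"
  interpret M: finite_measure ?M by (rule finite_measure_unit_ball)
  show "continuous_on UNIV (Phi \<epsilon>)"
    unfolding continuous_on_sequentially
  proof (intro ballI allI impI, elim conjE, unfold o_def)
    fix X :: "nat \<Rightarrow> complex" and \<zeta> assume X: "X \<longlonglongrightarrow> \<zeta>"
    obtain T where T: "\<And>n. cmod (X n) \<le> T"
      using convergent_imp_Bseq[OF convergentI[OF X]] by (auto simp: Bseq_def)
    obtain B where B: "\<And>z. norm z \<le> T \<Longrightarrow> \<bar>ueps \<epsilon> z\<bar> \<le> B"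
      using ueps_bounded[OF \<epsilon>, where T = T] by blast
    show "(\<lambda>n. Phi \<epsilon> (X n)) \<longlonglongrightarrow> Phi \<epsilon> \<zeta>"
      unfolding Phi_def
    proof (rule integral_dominated_convergence[where w = "\<lambda>_. B"])
      show "AE x in ?M. (\<lambda>n. ueps \<epsilon> (X n *s sgn x)) \<longlonglongrightarrow> ueps \<epsilon> (\<zeta> *s sgn x)"
      proof (rule AE_I2)
        fix x :: "complex ^ 'm"
        have cu: "continuous_on UNIV (\<lambda>\<xi>. ueps \<epsilon> (\<xi> *s sgn x))"
          by (intro continuous_on_compose2[OF continuous_on_ueps[OF \<epsilon>, of UNIV]] continuous_intros) auto
        show "(\<lambda>n. ueps \<epsilon> (X n *s sgn x)) \<longlonglongrightarrow> ueps \<epsilon> (\<zeta> *s sgn x)"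
          using continuous_on_tendsto_compose[OF cu X] by simp
      qed
      show "AE x in ?M. norm (ueps \<epsilon> (X n *s sgn x)) \<le> B" for n
        by (rule AE_I2) (auto intro!: B order_trans[OF norm_scalar_sgn_le T])
    qed (auto intro!: measurable_restrict_space1)
  qed
qed

text \<open>Multiplication by a unimodular scalar is orthogonal and commutes with
  \<open>sgn\<close>.\<close>

lemma Phi_radial: "Phi \<epsilon> \<zeta> = Phi \<epsilon> (of_real (cmod \<zeta>))"
proof -
  define w where "w = (if \<zeta> = 0 then 1 else sgn \<zeta>)"
  have w: "cmod w = 1" "\<zeta> = of_real (cmod \<zeta>) * w"
    by (simp_all add: w_def norm_sgn) (simp add: sgn_eq)
  have U: "orthogonal_transformation (\<lambda>x :: complex ^ 'm. w *s x)"
    unfolding orthogonal_transformation using w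
    by (auto simp: norm_vector_scalar intro: bounded_linear.linear bounded_linear_scalar_vector)
  have sg: "sgn (w *s x) = w *s sgn x" for x :: "complex ^ 'm"
    using w by (simp add: sgn_div_norm norm_vector_scalar vec_eq_iff)
  have [measurable]: "cball (0::complex ^ 'm) 1 \<in> sets borel" by simp
  have P: "Phi \<epsilon> \<xi> = (LINT x|lborel. indicator (cball 0 1) x * ueps \<epsilon> (\<xi> *s sgn x))" for \<xi>
    unfolding Phi_def by (subst integral_restrict_space) auto
  have "Phi \<epsilon> (of_real (cmod \<zeta>)) = (LINT x|lborel. indicator (cball 0 1) (w *s x) * ueps \<epsilon> (of_real (cmod \<zeta>) *s sgn (w *s x)))"
    unfolding P by (rule integral_lborel_orthogonal[OF U, symmetric]) measurable
  also have "\<dots> = Phi \<epsilon> \<zeta>"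
    unfolding P
  proof (intro Bochner_Integration.integral_cong refl)
    fix x :: "complex ^ 'm"
    have "indicator (cball 0 1) (w *s x) = (indicator (cball 0 1) x :: real)"
      using w by (simp add: indicator_def norm_vector_scalar)
    moreover have "of_real (cmod \<zeta>) *s sgn (w *s x) = \<zeta> *s sgn x"
      unfolding sg vector_smult_assoc w(2)[symmetric] ..
    ultimately show "indicator (cball 0 1) (w *s x) * ueps \<epsilon> (of_real (cmod \<zeta>) *s sgn (w *s x)) =
      indicator (cball 0 1) x * ueps \<epsilon> (\<zeta> *s sgn x)" by simp
  qed
  finally show ?thesis ..
qed

lemma Phi_0: "Phi \<epsilon> 0 = ueps \<epsilon> 0 * measure lborel (cball (0::complex ^ 'm) 1)"
  unfolding Phi_def by (simp add: measure_restrict_space space_restrict_space)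

lemma Phi_of_real: "Phi \<epsilon> (of_real s) = (LINT z|cone_measure s. ueps \<epsilon> z)"
  unfolding Phi_def by (subst integral_cone_measure) (auto simp: of_real_vector_scalar)

text \<open>Hadamard's three circles theorem. Off 0 the function ln |\<zeta>| is harmonic, so
  subtracting a multiple of it preserves subharmonicity and the maximum principle applies. The free
  slope l expresses convexity in \<open>ln s\<close>.\<close>

lemma Phi_three_circles:
  assumes \<epsilon>: "\<epsilon> > 0" and s: "0 < s1" "s1 \<le> s" "s \<le> s2"
  shows "Phi \<epsilon> (of_real s) - l * ln s \<le>
    max (Phi \<epsilon> (of_real s1) - l * ln s1) (Phi \<epsilon> (of_real s2) - l * ln s2)"
proof (rule ccontr)
  define f where "f s = Phi \<epsilon> (of_real s) - l * ln s" for s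
  assume "\<not> ?thesis"
  then have gt: "max (f s1) (f s2) < f s" by (simp add: f_def not_le)
  have cont: "continuous_on A f" if "A \<subseteq> {0<..}" for A
    unfolding f_def using that
    by (intro continuous_intros continuous_on_compose2[OF continuous_on_Phi[OF \<epsilon>, of UNIV]]) auto
  have c12: "continuous_on {s1..s2} f" using s by (intro cont) auto
  obtain x0 where x0: "x0 \<in> {s1..s2}" "\<And>x. x \<in> {s1..s2} \<Longrightarrow> f x \<le> f x0"
    using continuous_attains_sup[OF compact_Icc _ c12] s by fastforce
  \<comment> \<open>m will be the last point of the interval at which f is maximal. If m is
    interior, the mean value inequality on a small circle about m forces f to be maximal at every
    radius met by the circle, among them m + d.\<close>
  define S where "S = {s1..s2} \<inter> f -` {f x0}"
  have "closed S" unfolding S_def by (intro continuous_closed_preimage c12) auto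
  moreover have "bounded S" by (rule bounded_subset[of "{s1..s2}"]) (auto simp: S_def)
  ultimately have "compact S" by (simp add: compact_eq_bounded_closed)
  moreover have "S \<noteq> {}" using x0 by (auto simp: S_def)
  ultimately obtain m where m: "m \<in> S" "\<And>x. x \<in> S \<Longrightarrow> x \<le> m"
    by (metis compact_attains_sup)
  have fm: "f m = f x0" and m12: "m \<in> {s1..s2}" using m by (auto simp: S_def)
  have "f s \<le> f m" using x0(2)[of s] s fm by simp
  then have "m \<noteq> s1" "m \<noteq> s2" using gt by auto
  then have mm: "s1 < m" "m < s2" using m12 by auto
  obtain \<delta> where \<delta>: "\<delta> > 0" "\<And>d. cmod d < \<delta> \<Longrightarrow> Phi \<epsilon> (of_real m) \<le> integral {0..1} (\<lambda>t. Phi \<epsilon> (of_real m + d * circ t))"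
    using Phi_submean[OF \<epsilon> continuous_on_Phi[OF \<epsilon>], where \<zeta> = "of_real m"] by blast
  define d where "d = min (\<delta> / 2) (min ((m - s1) / 2) ((s2 - m) / 2))"
  have d: "0 < d" "d < \<delta>" "d < m - s1" "d < s2 - m" "d < m" using \<delta>(1) mm s by (auto simp: d_def min_def)
  define \<rho> where "\<rho> t = cmod (of_real m + of_real d * circ t)" for t
  have \<rho>_le: "\<rho> t \<le> m + d" for t
    unfolding \<rho>_def using norm_triangle_ineq[of "of_real m" "of_real d * circ t"] d mm s by (simp add: norm_mult)
  have \<rho>_ge: "m - d \<le> \<rho> t" for t
    unfolding \<rho>_def using norm_diff_ineq[of "of_real m" "of_real d * circ t"] d mm s by (simp add: norm_mult)
  have \<rho>: "\<rho> t \<in> {s1..s2}" "\<rho> t > 0" for t using \<rho>_le[of t] \<rho>_ge[of t] d mm s by auto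
  have c\<rho>: "continuous_on {0..1} \<rho>" unfolding \<rho>_def by (intro continuous_intros)
  have cf: "continuous_on {0..1} (\<lambda>t. f (\<rho> t))"
    using \<rho> by (intro continuous_on_compose2[OF c12 c\<rho>]) auto
  have "integral {0..1} (\<lambda>t. f (\<rho> t)) \<ge> f m"
  proof -
    have "((\<lambda>t. ln (cmod (of_real m + of_real d * circ t))) has_integral ln (cmod (of_real m))) {0..1}"
    proof (rule log_norm_mean_value[where \<rho> = m and g = "\<lambda>\<zeta>. \<zeta>"])
      fix \<zeta> assume "\<zeta> \<in> ball (complex_of_real m) m"
      then have "\<bar>Re (of_real m - \<zeta>)\<bar> < m" by (metis abs_Re_le_cmod dist_norm le_less_trans mem_ball)
      then show "0 < Re \<zeta>" by auto
    qed (use d in auto)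
    then have ln: "((\<lambda>t. ln (\<rho> t)) has_integral ln m) {0..1}"
      using mm s by (simp add: \<rho>_def)
    have P: "(\<lambda>t. Phi \<epsilon> (of_real (\<rho> t))) integrable_on {0..1}"
      by (intro integrable_continuous_interval continuous_on_compose2[OF continuous_on_Phi[OF \<epsilon>, of UNIV]] continuous_intros c\<rho>) auto
    have "((\<lambda>t. f (\<rho> t)) has_integral integral {0..1} (\<lambda>t. Phi \<epsilon> (of_real (\<rho> t))) - l * ln m) {0..1}"
      unfolding f_def by (intro has_integral_diff has_integral_mult_right integrable_integral P ln)
    then have "integral {0..1} (\<lambda>t. f (\<rho> t)) = integral {0..1} (\<lambda>t. Phi \<epsilon> (of_real (\<rho> t))) - l * ln m"
      by (rule integral_unique)
    moreover have "Phi \<epsilon> (of_real m) \<le> integral {0..1} (\<lambda>t. Phi \<epsilon> (of_real (\<rho> t)))"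
      using \<delta>(2)[of "of_real d"] d unfolding \<rho>_def Phi_radial[symmetric] by simp
    ultimately show ?thesis by (simp add: f_def)
  qed
  moreover have "integral {0..1} (\<lambda>t. f m - f (\<rho> t)) = f m - integral {0..1} (\<lambda>t. f (\<rho> t))"
    by (subst integral_diff) (auto intro!: integrable_continuous_interval cf)
  moreover have nonneg: "0 \<le> f m - f (\<rho> t)" for t
    using x0(2)[OF \<rho>(1)] fm by simp
  then have "0 \<le> integral {0..1} (\<lambda>t. f m - f (\<rho> t))"
    by (intro integral_nonneg integrable_continuous_interval continuous_intros cf) auto
  ultimately have "integral {0..1} (\<lambda>t. f m - f (\<rho> t)) = 0" by simp
  then have "\<forall>t\<in>{0..1}. f m - f (\<rho> t) = 0"
    using nonneg by (subst (asm) integral_eq_0_iff) (auto intro!: continuous_intros cf)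
  then have "f m - f (\<rho> 0) = 0" by (rule bspec) simp
  then have "f (\<rho> 0) = f x0" using fm by simp
  moreover have "\<rho> 0 = m + d" using d mm s by (simp add: \<rho>_def flip: of_real_add)
  ultimately have "m + d \<in> S" using \<rho>(1)[of 0] by (simp add: S_def)
  then show False using m(2) d by fastforce
qed

end

section \<open>Spherical means and ball averages\<close>

definition unit_vol :: "'m::finite itself \<Rightarrow> real" where
  "unit_vol _ = measure lborel (cball (0::complex ^ 'm) 1)"

lemma unit_vol_pos: "unit_vol TYPE('m::finite) > 0"
  unfolding unit_vol_def by (rule content_cball_pos) simp

lemma emeasure_unit_ball: "emeasure lborel (cball (0::complex ^ 'm) 1) = ennreal (unit_vol TYPE('m::finite))"
  unfolding unit_vol_def
  by (rule emeasure_eq_ennreal_measure) (use emeasure_lborel_cball_finite[of "0::complex ^ 'm" 1] in auto)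

lemma measure_cone_measure_UNIV: "measure (cone_measure s :: (complex ^ 'm) measure) UNIV = unit_vol TYPE('m::finite)"
  by (simp add: measure_def emeasure_cone_measure_UNIV unit_vol_def)

context entire_pair
begin

text \<open>Three circles with slope - \<eta>: near 0 \<open>Phi\<close> stays bounded while \<eta>
  ln s1 tends to minus infinity, so the inner circle cannot attain the maximum. Then \<eta> tends to
  0.\<close>

lemma Phi_mono:
  assumes \<epsilon>: "\<epsilon> > 0" and s: "0 < s" "s \<le> s'"
  shows "Phi \<epsilon> (of_real s) \<le> Phi \<epsilon> (of_real s')"
proof -
  have *: "Phi \<epsilon> (of_real s) + \<eta> * ln s \<le> Phi \<epsilon> (of_real s') + \<eta> * ln s'" if \<eta>: "\<eta> > 0" for \<eta>
  proof -
    have "continuous_on {0..s} (\<lambda>r. Phi \<epsilon> (of_real r))"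
      by (intro continuous_on_compose2[OF continuous_on_Phi[OF \<epsilon>, of UNIV]] continuous_intros) auto
    then have "bounded ((\<lambda>r. Phi \<epsilon> (of_real r)) ` {0..s})"
      by (intro compact_imp_bounded compact_continuous_image) auto
    then obtain K where K: "\<forall>y\<in>(\<lambda>r. Phi \<epsilon> (of_real r)) ` {0..s}. norm y \<le> K"
      unfolding bounded_iff by blast
    \<comment> \<open>Small enough that the inner term is at most the middle one minus 1.\<close>
    define s1 where "s1 = min s (exp ((Phi \<epsilon> (of_real s) + \<eta> * ln s - K - 1) / \<eta>))"
    have s1: "0 < s1" "s1 \<le> s" using s by (auto simp: s1_def)
    have "ln s1 \<le> (Phi \<epsilon> (of_real s) + \<eta> * ln s - K - 1) / \<eta>"
      using s1 by (subst ln_exp[symmetric], intro ln_mono) (auto simp: s1_def)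
    then have "\<eta> * ln s1 \<le> Phi \<epsilon> (of_real s) + \<eta> * ln s - K - 1"
      using \<eta> by (simp add: field_simps)
    moreover have "Phi \<epsilon> (of_real s1) \<le> K"
      using K s1 by (force dest: abs_le_D1)
    ultimately have "Phi \<epsilon> (of_real s1) - (- \<eta>) * ln s1 < Phi \<epsilon> (of_real s) - (- \<eta>) * ln s" by simp
    then show ?thesis
      using Phi_three_circles[OF \<epsilon> s1 s(2), of "- \<eta>"] by (simp add: max_def split: if_splits)
  qed
  show ?thesis
  proof (rule field_le_epsilon)
    fix e :: real assume e: "e > 0"
    define D where "D = ln s' - ln s"
    have D: "D \<ge> 0" using s by (simp add: D_def)
    have "Phi \<epsilon> (of_real s) \<le> Phi \<epsilon> (of_real s') + e / (D + 1) * D"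
      using *[of "e / (D + 1)"] e D by (simp add: D_def right_diff_distrib)
    also have "e / (D + 1) * D \<le> e" using e D by (simp add: field_simps)
    finally show "Phi \<epsilon> (of_real s) \<le> Phi \<epsilon> (of_real s') + e" by simp
  qed
qed

lemma Phi_0_le:
  assumes \<epsilon>: "\<epsilon> > 0" and s: "0 < s"
  shows "Phi \<epsilon> 0 \<le> Phi \<epsilon> (of_real s)"
proof (rule tendsto_upperbound)
  show "(\<lambda>n. Phi \<epsilon> (of_real (s / of_nat (Suc n)))) \<longlonglongrightarrow> Phi \<epsilon> 0"
  proof (rule continuous_on_tendsto_compose[OF continuous_on_Phi[OF \<epsilon>, of UNIV]])
    have "(\<lambda>n. s / of_nat (Suc n)) \<longlonglongrightarrow> 0"
      using LIMSEQ_Suc[OF lim_const_over_n[of s]] by simp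
    from tendsto_of_real[OF this, where 'a = complex]
    show "(\<lambda>n. complex_of_real (s / of_nat (Suc n))) \<longlonglongrightarrow> 0" by (simp only: of_real_0)
  qed auto
  show "\<forall>\<^sub>F n in sequentially. Phi \<epsilon> (of_real (s / of_nat (Suc n))) \<le> Phi \<epsilon> (of_real s)"
    using s by (intro always_eventually allI Phi_mono[OF \<epsilon>]) (auto simp: field_simps)
qed simp

section \<open>From the regularised logarithm to log |F|\<close>

definition ulog :: "complex ^ 'm \<Rightarrow> real" where
  "ulog z = ln (nsq z) / 2"

text \<open>The junk value \<open>ulog z = 0\<close> at zeros is replaced by infinity, so that
  \<open>gap\<close> is the increasing limit of \<open>gap_eps\<close>. B is meant as an upper bound
  of \<open>ueps 1\<close> on the set in question: it then bounds every
  \<open>ueps (1 / Suc k)\<close> as well, and \<open>ennreal\<close> cuts off nothing.\<close>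

definition gap :: "real \<Rightarrow> complex ^ 'm \<Rightarrow> ennreal" where
  "gap B z = (if nsq z = 0 then top else ennreal (B - ulog z))"

definition gap_eps :: "nat \<Rightarrow> real \<Rightarrow> complex ^ 'm \<Rightarrow> ennreal" where
  "gap_eps k B z = ennreal (B - ueps (1 / Suc k) z)"

lemma ulog_measurable [measurable]: "ulog \<in> borel_measurable borel"
  unfolding ulog_def by measurable

lemma gap_measurable [measurable]: "gap B \<in> borel_measurable borel"
  unfolding gap_def by measurable

lemma gap_eps_measurable [measurable]: "gap_eps k B \<in> borel_measurable borel"
  unfolding gap_eps_def by measurable

lemma ueps_mono: "0 < \<epsilon> \<Longrightarrow> \<epsilon> \<le> \<epsilon>' \<Longrightarrow> ueps \<epsilon> z \<le> ueps \<epsilon>' z"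
  unfolding ueps_def using nsq_eps_pos[of \<epsilon> z] by (intro divide_right_mono ln_mono) auto

lemma ulog_le_ueps: "nsq z \<noteq> 0 \<Longrightarrow> 0 < \<epsilon> \<Longrightarrow> ulog z \<le> ueps \<epsilon> z"
  unfolding ueps_def ulog_def using nsq_nonneg[of z] by (intro divide_right_mono ln_mono) auto

lemma tendsto_ueps: 
  assumes "nsq z \<noteq> 0"
  shows "(\<lambda>k. ueps (1 / Suc k) z) \<longlonglongrightarrow> ulog z"
proof -
  have "(\<lambda>k. nsq z + 1 / real (Suc k)) \<longlonglongrightarrow> nsq z + 0"
    by (intro tendsto_add tendsto_const LIMSEQ_Suc lim_1_over_n)
  then have "(\<lambda>k. ln (nsq z + 1 / real (Suc k)) / 2) \<longlonglongrightarrow> ln (nsq z) / 2"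
    using assms by (intro tendsto_divide tendsto_ln) auto
  then show ?thesis by (simp add: ueps_def ulog_def)
qed

lemma gap_eps_incseq: "incseq (\<lambda>k. gap_eps k B z)"
  unfolding gap_eps_def
  by (intro incseq_SucI ennreal_leI diff_left_mono ueps_mono) (auto simp: field_simps)

lemma gap_eps_le_gap: "gap_eps k B z \<le> gap B z"
  unfolding gap_eps_def gap_def by (auto intro!: ennreal_leI diff_left_mono ulog_le_ueps)

lemma gap_eq_SUP: "gap B z = (SUP k. gap_eps k B z)"
proof (rule antisym)
  show "gap B z \<le> (SUP k. gap_eps k B z)"
  proof (cases "nsq z = 0")
    case True
    have "(SUP k. gap_eps k B z) = top"
    proof (rule ennreal_SUP_eq_top)
      fix n :: nat
      obtain k :: nat where k: "exp (2 * (n - B)) \<le> k" using real_arch_simple by blast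
      have "2 * (n - B) \<le> ln (real (Suc k))"
        using k by (subst ln_exp[symmetric], intro ln_mono) auto
      then have "real n \<le> B - ueps (1 / Suc k) z"
        using True by (simp add: ueps_def ln_div)
      then have "of_nat n \<le> gap_eps k B z"
        unfolding gap_eps_def ennreal_of_nat_eq_real_of_nat by (rule ennreal_leI)
      then show "\<exists>i\<in>UNIV. of_nat n \<le> gap_eps i B z" by blast
    qed
    then show ?thesis by (simp only: top_greatest)
  next
    case False
    have "(\<lambda>k. gap_eps k B z) \<longlonglongrightarrow> ennreal (B - ulog z)"
      unfolding gap_eps_def by (intro tendsto_ennrealI tendsto_diff tendsto_const tendsto_ueps False)
    then have "ennreal (B - ulog z) = (SUP k. gap_eps k B z)"
      using LIMSEQ_unique LIMSEQ_SUP[OF gap_eps_incseq] by blast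
    then show ?thesis using False by (simp add: gap_def)
  qed
qed (auto intro: SUP_least gap_eps_le_gap)

definition mean_gap :: "real \<Rightarrow> real \<Rightarrow> ennreal" where
  "mean_gap B s = (\<integral>\<^sup>+ z. gap B z \<partial>cone_measure s)"

lemma integrable_ueps_cone_measure:
  assumes "s > 0" "\<epsilon> > 0"
  shows "integrable (cone_measure s) (ueps \<epsilon>)"
proof -
  interpret finite_measure "cone_measure s :: (complex ^ 'm) measure" by (rule finite_measure_cone_measure)
  obtain B where "\<And>z. norm z \<le> s \<Longrightarrow> \<bar>ueps \<epsilon> z\<bar> \<le> B" using ueps_bounded[OF assms(2), where T = s] by blast
  then have "AE z in cone_measure s. norm (ueps \<epsilon> z) \<le> B"
    by (intro AE_cone_measure[OF assms(1)]) auto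
  then show ?thesis by (rule integrable_const_bound) simp
qed

lemma nn_integral_gap_eps:
  assumes s: "s > 0" and B: "\<And>z. norm z = s \<Longrightarrow> ueps 1 z \<le> B"
  shows "(\<integral>\<^sup>+ z. gap_eps k B z \<partial>cone_measure s) = ennreal (B * unit_vol TYPE('m) - Phi (1 / Suc k) (of_real s))"
proof -
  interpret finite_measure "cone_measure s :: (complex ^ 'm) measure" by (rule finite_measure_cone_measure)
  have "AE z in cone_measure s. 0 \<le> B - ueps (1 / Suc k) z"
    using order_trans[OF ueps_mono[of "1 / Suc k" 1] B] by (intro AE_cone_measure[OF s]) auto
  then have "(\<integral>\<^sup>+ z. gap_eps k B z \<partial>cone_measure s) = ennreal (LINT z|cone_measure s. B - ueps (1 / Suc k) z)"
    unfolding gap_eps_def using integrable_ueps_cone_measure[OF s, of "1 / Suc k"]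
    by (intro nn_integral_eq_integral) auto
  also have "(LINT z|cone_measure s. B - ueps (1 / Suc k) z) = B * unit_vol TYPE('m) - Phi (1 / Suc k) (of_real s)"
    using integrable_ueps_cone_measure[OF s, of "1 / Suc k"]
    by (simp add: Phi_of_real measure_cone_measure_UNIV)
  finally show ?thesis .
qed

lemma mean_gap_eq_SUP:
  assumes s: "s > 0" and B: "\<And>z. norm z = s \<Longrightarrow> ueps 1 z \<le> B"
  shows "mean_gap B s = (SUP k. ennreal (B * unit_vol TYPE('m) - Phi (1 / Suc k) (of_real s)))"
proof -
  have "mean_gap B s = (SUP k. \<integral>\<^sup>+ z. gap_eps k B z \<partial>cone_measure s)"
    unfolding mean_gap_def gap_eq_SUP
    by (rule nn_integral_monotone_convergence_SUP)
      (use gap_eps_incseq in \<open>auto simp: incseq_def le_fun_def\<close>)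
  also have "\<dots> = (SUP k. ennreal (B * unit_vol TYPE('m) - Phi (1 / Suc k) (of_real s)))"
    by (intro SUP_cong refl nn_integral_gap_eps assms)
  finally show ?thesis .
qed

text \<open>Monotonicity of every \<open>Phi (1 / Suc k)\<close> passes to the supremum.\<close>

lemma mean_gap_antimono:
  assumes s: "0 < s" "s \<le> s'" and B: "\<And>z. norm z \<le> s' \<Longrightarrow> ueps 1 z \<le> B"
  shows "mean_gap B s' \<le> mean_gap B s"
proof -
  have "mean_gap B s' = (SUP k. ennreal (B * unit_vol TYPE('m) - Phi (1 / Suc k) (of_real s')))"
    using s B by (intro mean_gap_eq_SUP) auto
  also have "\<dots> \<le> (SUP k. ennreal (B * unit_vol TYPE('m) - Phi (1 / Suc k) (of_real s)))"
    using s by (intro SUP_mono' ennreal_leI diff_left_mono Phi_mono) auto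
  also have "\<dots> = mean_gap B s"
    using s B by (intro mean_gap_eq_SUP[symmetric]) auto
  finally show ?thesis .
qed

lemma mean_gap_le_center:
  assumes s: "0 < s" and B: "\<And>z. norm z \<le> s \<Longrightarrow> ueps 1 z \<le> B"
  shows "mean_gap B s \<le> ennreal (unit_vol TYPE('m)) * gap B 0"
proof -
  have "mean_gap B s = (SUP k. ennreal (B * unit_vol TYPE('m) - Phi (1 / Suc k) (of_real s)))"
    using s B by (intro mean_gap_eq_SUP) auto
  also have "\<dots> \<le> ennreal (unit_vol TYPE('m)) * gap B 0"
  proof (rule SUP_least)
    fix k
    have "ennreal (B * unit_vol TYPE('m) - Phi (1 / Suc k) (of_real s)) \<le> ennreal (B * unit_vol TYPE('m) - Phi (1 / Suc k) 0)"
      using s by (intro ennreal_leI diff_left_mono Phi_0_le) auto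
    also have "B * unit_vol TYPE('m) - Phi (1 / Suc k) 0 = unit_vol TYPE('m) * (B - ueps (1 / Suc k) 0)"
      by (simp add: Phi_0 unit_vol_def algebra_simps)
    also have "ennreal \<dots> = ennreal (unit_vol TYPE('m)) * gap_eps k B 0"
      unfolding gap_eps_def by (rule ennreal_mult') (use unit_vol_pos less_imp_le in blast)
    also have "\<dots> \<le> ennreal (unit_vol TYPE('m)) * gap B 0"
      by (intro mult_left_mono gap_eps_le_gap) auto
    finally show "ennreal (B * unit_vol TYPE('m) - Phi (1 / Suc k) (of_real s)) \<le> ennreal (unit_vol TYPE('m)) * gap B 0" .
  qed
  finally show ?thesis .
qed

end

section \<open>Radial weights, local integrability and null sets\<close>

lemma nn_integral_polar_radial:
  fixes g :: "'a::euclidean_space \<Rightarrow> ennreal" and \<kappa> :: "real \<Rightarrow> ennreal"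
  assumes [measurable]: "g \<in> borel_measurable borel" "\<kappa> \<in> borel_measurable borel"
  shows "(\<integral>\<^sup>+ z. g z * \<kappa> (norm z) \<partial>lborel) =
    (\<integral>\<^sup>+ s. ennreal (DIM('a) * s ^ (DIM('a) - 1)) * indicator {0<..} s * (\<kappa> s * (\<integral>\<^sup>+ z. g z \<partial>cone_measure s)) \<partial>lborel)"
proof -
  have eq: "(\<integral>\<^sup>+ z. g z * \<kappa> (norm z) \<partial>cone_measure s) = \<kappa> s * (\<integral>\<^sup>+ z. g z \<partial>cone_measure s)" if "s > 0" for s
  proof -
    have "(\<integral>\<^sup>+ z. g z * \<kappa> (norm z) \<partial>cone_measure s) = (\<integral>\<^sup>+ z. \<kappa> s * g z \<partial>cone_measure s)"
      by (intro nn_integral_cong_AE AE_cone_measure[OF that]) (auto simp: mult.commute)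
    then show ?thesis by (simp add: nn_integral_cmult)
  qed
  show ?thesis
    by (subst nn_integral_polar) (auto intro!: nn_integral_cong simp: eq indicator_def)
qed

lemma nn_integral_cone_measure_measurable [measurable]:
  fixes g :: "'a::euclidean_space \<Rightarrow> ennreal"
  assumes [measurable]: "g \<in> borel_measurable borel"
  shows "(\<lambda>s. \<integral>\<^sup>+ z. g z \<partial>cone_measure s) \<in> borel_measurable borel"
proof -
  have [measurable]: "cball (0::'a) 1 \<in> sets borel" by simp
  show ?thesis
    unfolding nn_integral_cone_measure[OF assms] by measurable
qed

context entire_pair
begin

text \<open>In polar coordinates the solid integral is an integral of \<open>mean_gap B s\<close>,
  which decreases in s and so is at least its value at the end \<rho> of the support. The factor
  \<open>unit_vol\<close> is the mass of \<open>cone_measure\<close>. The lemma that follows uses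
  the start of the support for the opposite bound.\<close>

lemma nn_integral_gap_radial_ge:
  assumes [measurable]: "\<kappa> \<in> borel_measurable borel" and \<rho>: "0 < \<rho>"
    and supp: "\<And>s. s > \<rho> \<Longrightarrow> \<kappa> s = 0" and B: "\<And>z. norm z \<le> \<rho> \<Longrightarrow> ueps 1 z \<le> B"
  shows "mean_gap B \<rho> * (\<integral>\<^sup>+ z. \<kappa> (norm (z :: complex ^ 'm)) \<partial>lborel) \<le>
    ennreal (unit_vol TYPE('m)) * (\<integral>\<^sup>+ z. gap B z * \<kappa> (norm z) \<partial>lborel)"
proof -
  let ?N = "\<lambda>s::real. ennreal (DIM(complex ^ 'm) * s ^ (DIM(complex ^ 'm) - 1)) * indicator {0<..} s :: ennreal"
  have "mean_gap B \<rho> * (\<integral>\<^sup>+ z. \<kappa> (norm (z :: complex ^ 'm)) \<partial>lborel) =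
      mean_gap B \<rho> * (\<integral>\<^sup>+ s. ?N s * (\<kappa> s * ennreal (unit_vol TYPE('m))) \<partial>lborel)"
    using nn_integral_polar_radial[of "\<lambda>_ :: complex ^ 'm. 1" \<kappa>] by (simp add: emeasure_cone_measure_UNIV emeasure_unit_ball)
  also have "\<dots> = (\<integral>\<^sup>+ s. mean_gap B \<rho> * (?N s * (\<kappa> s * ennreal (unit_vol TYPE('m)))) \<partial>lborel)"
    by (rule nn_integral_cmult[symmetric]) measurable
  also have "\<dots> \<le> (\<integral>\<^sup>+ s. ennreal (unit_vol TYPE('m)) * (?N s * (\<kappa> s * mean_gap B s)) \<partial>lborel)"
  proof (rule nn_integral_mono)
    fix s
    show "mean_gap B \<rho> * (?N s * (\<kappa> s * ennreal (unit_vol TYPE('m)))) \<le> ennreal (unit_vol TYPE('m)) * (?N s * (\<kappa> s * mean_gap B s))"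
    proof (cases "0 < s \<and> s \<le> \<rho>")
      case True
      then have "mean_gap B \<rho> \<le> mean_gap B s" using B by (intro mean_gap_antimono) auto
      then have "(ennreal (unit_vol TYPE('m)) * ?N s * \<kappa> s) * mean_gap B \<rho> \<le> (ennreal (unit_vol TYPE('m)) * ?N s * \<kappa> s) * mean_gap B s"
        by (rule mult_left_mono) simp
      then show ?thesis by (simp only: mult_ac)
    qed (use supp in \<open>auto simp: not_less not_le\<close>)
  qed
  also have "\<dots> = ennreal (unit_vol TYPE('m)) * (\<integral>\<^sup>+ s. ?N s * (\<kappa> s * mean_gap B s) \<partial>lborel)"
    unfolding mean_gap_def by (rule nn_integral_cmult) measurable
  also have "(\<integral>\<^sup>+ s. ?N s * (\<kappa> s * mean_gap B s) \<partial>lborel) = (\<integral>\<^sup>+ z. gap B z * \<kappa> (norm z) \<partial>lborel)"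
    unfolding mean_gap_def by (rule nn_integral_polar_radial[symmetric]) measurable
  finally show ?thesis .
qed

lemma nn_integral_gap_radial_le:
  assumes [measurable]: "\<kappa> \<in> borel_measurable borel" and \<rho>: "0 < \<rho>"
    and supp: "\<And>s. s < \<rho> \<Longrightarrow> \<kappa> s = 0" "\<And>s. T < s \<Longrightarrow> \<kappa> s = 0" and B: "\<And>z. norm z \<le> T \<Longrightarrow> ueps 1 z \<le> B"
  shows "ennreal (unit_vol TYPE('m)) * (\<integral>\<^sup>+ z. gap B z * \<kappa> (norm z) \<partial>lborel) \<le>
    mean_gap B \<rho> * (\<integral>\<^sup>+ z. \<kappa> (norm (z :: complex ^ 'm)) \<partial>lborel)"
proof -
  let ?N = "\<lambda>s::real. ennreal (DIM(complex ^ 'm) * s ^ (DIM(complex ^ 'm) - 1)) * indicator {0<..} s :: ennreal"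
  have "ennreal (unit_vol TYPE('m)) * (\<integral>\<^sup>+ z. gap B z * \<kappa> (norm z) \<partial>lborel) = ennreal (unit_vol TYPE('m)) * (\<integral>\<^sup>+ s. ?N s * (\<kappa> s * mean_gap B s) \<partial>lborel)"
    unfolding mean_gap_def by (subst nn_integral_polar_radial) auto
  also have "\<dots> = (\<integral>\<^sup>+ s. ennreal (unit_vol TYPE('m)) * (?N s * (\<kappa> s * mean_gap B s)) \<partial>lborel)"
    unfolding mean_gap_def by (rule nn_integral_cmult[symmetric]) measurable
  also have "\<dots> \<le> (\<integral>\<^sup>+ s. mean_gap B \<rho> * (?N s * (\<kappa> s * ennreal (unit_vol TYPE('m)))) \<partial>lborel)"
  proof (rule nn_integral_mono)
    fix s
    show "ennreal (unit_vol TYPE('m)) * (?N s * (\<kappa> s * mean_gap B s)) \<le> mean_gap B \<rho> * (?N s * (\<kappa> s * ennreal (unit_vol TYPE('m))))"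
    proof (cases "\<rho> \<le> s \<and> s \<le> T")
      case True
      then have "mean_gap B s \<le> mean_gap B \<rho>" using B \<rho> by (intro mean_gap_antimono) auto
      then have "(ennreal (unit_vol TYPE('m)) * ?N s * \<kappa> s) * mean_gap B s \<le> (ennreal (unit_vol TYPE('m)) * ?N s * \<kappa> s) * mean_gap B \<rho>"
        by (rule mult_left_mono) simp
      then show ?thesis by (simp only: mult_ac)
    qed (use supp in \<open>auto simp: not_less not_le\<close>)
  qed
  also have "\<dots> = mean_gap B \<rho> * (\<integral>\<^sup>+ s. ?N s * (\<kappa> s * ennreal (unit_vol TYPE('m))) \<partial>lborel)"
    by (rule nn_integral_cmult) measurable
  also have "(\<integral>\<^sup>+ s. ?N s * (\<kappa> s * ennreal (unit_vol TYPE('m))) \<partial>lborel) = (\<integral>\<^sup>+ z. \<kappa> (norm (z :: complex ^ 'm)) \<partial>lborel)"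
    using nn_integral_polar_radial[of "\<lambda>_ :: complex ^ 'm. 1" \<kappa>] by (simp add: emeasure_cone_measure_UNIV emeasure_unit_ball)
  finally show ?thesis .
qed

lemma nn_integral_gap_ball_center:
  assumes B: "\<And>z. norm z \<le> R \<Longrightarrow> ueps 1 z \<le> B"
  shows "(\<integral>\<^sup>+ z. gap B z * indicator (cball 0 R) z \<partial>lborel) \<le> emeasure lborel (cball (0::complex ^ 'm) R) * gap B 0"
proof -
  let ?N = "\<lambda>s::real. ennreal (DIM(complex ^ 'm) * s ^ (DIM(complex ^ 'm) - 1)) * indicator {0<..} s :: ennreal"
  have ind: "indicator (cball 0 R) z = (indicator {..R} (norm z) :: ennreal)" for z :: "complex ^ 'm"
    by (simp add: indicator_def)
  have "(\<integral>\<^sup>+ z. gap B z * indicator (cball 0 R) z \<partial>lborel) = (\<integral>\<^sup>+ s. ?N s * (indicator {..R} s * mean_gap B s) \<partial>lborel)"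
    unfolding ind mean_gap_def by (rule nn_integral_polar_radial) measurable
  also have "\<dots> \<le> (\<integral>\<^sup>+ s. (?N s * (indicator {..R} s * ennreal (unit_vol TYPE('m)))) * gap B 0 \<partial>lborel)"
  proof (rule nn_integral_mono)
    fix s
    show "?N s * (indicator {..R} s * mean_gap B s) \<le> (?N s * (indicator {..R} s * ennreal (unit_vol TYPE('m)))) * gap B 0"
      using mean_gap_le_center[of s B] B by (auto simp: indicator_def mult.assoc intro!: mult_left_mono)
  qed
  also have "\<dots> = (\<integral>\<^sup>+ s. ?N s * (indicator {..R} s * ennreal (unit_vol TYPE('m))) \<partial>lborel) * gap B 0"
    by (rule nn_integral_multc) measurable
  also have "(\<integral>\<^sup>+ s. ?N s * (indicator {..R} s * ennreal (unit_vol TYPE('m))) \<partial>lborel) = (\<integral>\<^sup>+ z. 1 * indicator {..R} (norm (z :: complex ^ 'm)) \<partial>lborel)"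
    by (subst nn_integral_polar_radial) (auto simp: emeasure_cone_measure_UNIV emeasure_unit_ball)
  also have "\<dots> = emeasure lborel (cball (0::complex ^ 'm) R)"
    unfolding ind[symmetric] by simp
  finally show ?thesis .
qed

lemma entire_pair_translate: "entire_pair (\<lambda>z. F0 (p + z)) (\<lambda>z. F1 (p + z))"
  using entire_Cm_affine[OF entire_F0, of p 1] entire_Cm_affine[OF entire_F1, of p 1]
  by unfold_locales simp_all

text \<open>The translated pair is again an \<open>entire_pair\<close>, which moves the centre to
  0.\<close>

lemma nn_integral_gap_ball:
  assumes B: "\<And>z. norm z \<le> R \<Longrightarrow> ueps 1 (p + z) \<le> B"
  shows "(\<integral>\<^sup>+ z. gap B z * indicator (cball p R) z \<partial>lborel) \<le> emeasure lborel (cball (0::complex ^ 'm) R) * gap B p"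
proof -
  interpret P: entire_pair "\<lambda>z. F0 (p + z)" "\<lambda>z. F1 (p + z)" by (rule entire_pair_translate)
  have 1: "P.nsq z = nsq (p + z)" for z by (simp add: P.nsq_def nsq_def)
  have 2: "P.gap B z = gap B (p + z)" for z by (simp add: P.gap_def gap_def P.ulog_def ulog_def 1)
  have 3: "P.ueps 1 z = ueps 1 (p + z)" for z by (simp add: P.ueps_def ueps_def 1)
  have [measurable]: "cball p R \<in> sets borel" by simp
  have "(\<integral>\<^sup>+ z. gap B z * indicator (cball p R) z \<partial>lborel) = (\<integral>\<^sup>+ z. gap B (p + z) * indicator (cball p R) (p + z) \<partial>lborel)"
    by (rule nn_integral_lborel_translate[symmetric]) measurable
  also have "\<dots> = (\<integral>\<^sup>+ z. P.gap B z * indicator (cball 0 R) z \<partial>lborel)"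
    by (intro nn_integral_cong) (auto simp: 2 indicator_def dist_norm)
  also have "\<dots> \<le> emeasure lborel (cball (0::complex ^ 'm) R) * P.gap B 0"
    using B by (intro P.nn_integral_gap_ball_center) (simp add: 3)
  finally show ?thesis by (simp add: 2)
qed

text \<open>The ball about 0 lies in the ball of radius R + |p| about a point p off the zero set,
  where the mean value inequality bounds the integral by the finite gap at p. That ball reaches out
  to |p| + (R + |p|).\<close>

lemma nn_integral_gap_finite:
  assumes p: "nsq p \<noteq> 0" and B: "\<And>z. norm z \<le> norm p + (R + norm p) \<Longrightarrow> ueps 1 z \<le> B"
  shows "(\<integral>\<^sup>+ z. gap B z * indicator (cball 0 R) z \<partial>lborel) < top"
proof -
  have "(\<integral>\<^sup>+ z. gap B z * indicator (cball 0 R) z \<partial>lborel) \<le> (\<integral>\<^sup>+ z. gap B z * indicator (cball p (R + norm p)) z \<partial>lborel)"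
  proof (intro nn_integral_mono mult_left_mono)
    fix z
    have "dist p z \<le> R + norm p" if "norm z \<le> R" using that norm_triangle_ineq4[of p z] by (simp add: dist_norm)
    then show "indicator (cball 0 R) z \<le> (indicator (cball p (R + norm p)) z :: ennreal)"
      by (auto simp: indicator_def)
  qed simp
  also have "\<dots> \<le> emeasure lborel (cball (0::complex ^ 'm) (R + norm p)) * gap B p"
    using B norm_triangle_ineq[of p] by (intro nn_integral_gap_ball) (meson add_left_mono order_trans)
  also have "\<dots> < top"
    using p emeasure_lborel_cball_finite[of "0::complex ^ 'm" "R + norm p"] by (simp add: gap_def ennreal_mult_less_top)
  finally show ?thesis .
qed

lemma ueps_bounded_above:
  "\<exists>B. \<forall>z. norm z \<le> T \<longrightarrow> ueps 1 z \<le> B"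
  using ueps_bounded[of 1 T] by (auto dest: abs_le_D1)

end

locale nonzero_entire_pair = entire_pair F0 F1
  for F0 F1 :: "complex ^ 'm::finite \<Rightarrow> complex" +
  assumes nonzero: "\<exists>p. nsq p \<noteq> 0"
begin

text \<open>The gap is infinite on the zero set and has a finite integral over every ball.\<close>

lemma AE_nsq_nonzero: "AE z in lborel. nsq z \<noteq> 0"
proof -
  obtain p where p: "nsq p \<noteq> 0" using nonzero by blast
  have "AE z in lborel. z \<in> cball 0 (real n) \<longrightarrow> nsq z \<noteq> 0" for n :: nat
  proof -
    obtain B where B: "\<And>z. norm z \<le> norm p + (real n + norm p) \<Longrightarrow> ueps 1 z \<le> B"
      using ueps_bounded_above[where T = "norm p + (real n + norm p)"] by blast
    have [measurable]: "cball (0::complex ^ 'm) (real n) \<in> sets borel" by simp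
    have "(\<integral>\<^sup>+ z. gap B z * indicator (cball 0 (real n)) z \<partial>lborel) < top"
      by (rule nn_integral_gap_finite[OF p]) (rule B)
    then have "(\<integral>\<^sup>+ z. gap B z * indicator (cball 0 (real n)) z \<partial>lborel) \<noteq> \<infinity>" by simp
    then have "AE z in lborel. gap B z * indicator (cball 0 (real n)) z \<noteq> \<infinity>"
      by (intro nn_integral_PInf_AE) measurable
    then show ?thesis by eventually_elim (auto simp: gap_def)
  qed
  then have "AE z in lborel. \<forall>n::nat. z \<in> cball 0 (real n) \<longrightarrow> nsq z \<noteq> 0"
    by (simp only: AE_all_countable) blast
  then show ?thesis
  proof eventually_elim
    case (elim z)
    obtain n :: nat where "norm z \<le> n" using real_arch_simple by blast
    then show ?case using elim by auto
  qed
qed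

lemma AE_gap: "AE z in lborel. gap B z = ennreal (B - ulog z)"
  using AE_nsq_nonzero by eventually_elim (simp add: gap_def)

lemma ulog_le: 
  assumes "nsq z \<noteq> 0" "ueps 1 z \<le> B"
  shows "ulog z \<le> B"
  using ulog_le_ueps[of z 1] assms by simp

lemma ulog_set_integrable: "set_integrable lborel (cball 0 R) ulog"
proof -
  obtain p where p: "nsq p \<noteq> 0" using nonzero by blast
  define T where "T = norm p + (R + norm p)"
  obtain B where B: "\<And>z. norm z \<le> T \<Longrightarrow> ueps 1 z \<le> B" using ueps_bounded_above[where T = T] by blast
  have [measurable]: "cball (0::complex ^ 'm) R \<in> sets borel" by simp
  have "integrable lborel (\<lambda>z. indicator (cball 0 R) z * (B - ulog z))"
  proof (rule integrableI_nonneg)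
    show "AE z in lborel. 0 \<le> indicator (cball 0 R) z * (B - ulog z)"
      using AE_nsq_nonzero
    proof eventually_elim
      case (elim z)
      then show ?case using ulog_le[OF elim B[of z]] by (auto simp: indicator_def T_def) (smt (verit) norm_ge_zero)
    qed
    have "(\<integral>\<^sup>+ z. ennreal (indicator (cball 0 R) z * (B - ulog z)) \<partial>lborel) = (\<integral>\<^sup>+ z. gap B z * indicator (cball 0 R) z \<partial>lborel)"
      by (intro nn_integral_cong_AE, use AE_gap[of B] in eventually_elim) (auto simp: indicator_def)
    also have "\<dots> < \<infinity>" using nn_integral_gap_finite[OF p, of R B] B by (simp add: T_def)
    finally show "(\<integral>\<^sup>+ z. ennreal (indicator (cball 0 R) z * (B - ulog z)) \<partial>lborel) < \<infinity>" .
  qed measurable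
  moreover have "integrable lborel (\<lambda>z. indicator (cball (0::complex ^ 'm) R) z * B :: real)"
    using emeasure_lborel_cball_finite[of "0::complex ^ 'm" R] by (intro integrable_mult_left integrable_real_indicator) auto
  ultimately have "integrable lborel (\<lambda>z. indicator (cball 0 R) z * B - indicator (cball 0 R) z * (B - ulog z))"
    by (rule Bochner_Integration.integrable_diff[rotated])
  then show ?thesis unfolding set_integrable_def by (simp add: algebra_simps)
qed

text \<open>Local integrability yields finiteness for almost every radius only; monotonicity carries
  it from some t < s to s.\<close>

lemma mean_gap_finite:
  assumes s: "s > 0" and B: "\<And>z. norm z \<le> s \<Longrightarrow> ueps 1 z \<le> B"
  shows "mean_gap B s < top"
proof -
  obtain p where p: "nsq p \<noteq> 0" using nonzero by blast
  define T where "T = norm p + (s + norm p)"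
  obtain B' where B': "\<And>z. norm z \<le> T \<Longrightarrow> ueps 1 z \<le> B'" using ueps_bounded_above[where T = T] by blast
  let ?N = "\<lambda>s::real. ennreal (DIM(complex ^ 'm) * s ^ (DIM(complex ^ 'm) - 1)) * indicator {0<..} s :: ennreal"
  have ind: "indicator (cball 0 s) z = (indicator {..s} (norm z) :: ennreal)" for z :: "complex ^ 'm"
    by (simp add: indicator_def)
  have "(\<integral>\<^sup>+ t. ?N t * (indicator {..s} t * mean_gap B' t) \<partial>lborel) = (\<integral>\<^sup>+ z. gap B' z * indicator (cball 0 s) z \<partial>lborel)"
    unfolding ind mean_gap_def by (rule nn_integral_polar_radial[symmetric]) measurable
  also have "\<dots> < \<infinity>" using nn_integral_gap_finite[OF p, of s B'] B' by (simp add: T_def)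
  finally have "(\<integral>\<^sup>+ t. ?N t * (indicator {..s} t * mean_gap B' t) \<partial>lborel) \<noteq> \<infinity>" by simp
  then have ae: "AE t in lborel. ?N t * (indicator {..s} t * mean_gap B' t) \<noteq> \<infinity>"
    unfolding mean_gap_def by (intro nn_integral_PInf_AE) measurable
  have "\<exists>t. 0 < t \<and> t < s \<and> mean_gap B' t < top"
  proof (rule ccontr)
    assume "\<not> ?thesis"
    then have "\<not> mean_gap B' t < top" if "0 < t" "t < s" for t using that by blast
    then have top: "mean_gap B' t = top" if "0 < t" "t < s" for t
      using that by (simp add: not_less top_unique)
    have "AE t in lborel. t \<notin> {0<..<s}"
      using ae
    proof eventually_elim
      case (elim t)
      have "ennreal (DIM(complex ^ 'm) * t ^ (DIM(complex ^ 'm) - 1)) \<noteq> 0" if "0 < t"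
        using that by (simp add: ennreal_eq_0_iff not_le)
      then show ?case using elim top[of t] by (auto simp: indicator_def ennreal_mult_eq_top_iff)
    qed
    then have "emeasure lborel {0<..<s} = 0"
      by (subst (asm) AE_iff_measurable[where N = "{0<..<s}"]) auto
    then show False using s by simp
  qed
  then obtain t where t: "0 < t" "t < s" "mean_gap B' t < top" by blast
  have "mean_gap B' s \<le> mean_gap B' t"
    using t B' by (intro mean_gap_antimono) (auto simp: T_def, smt (verit) norm_ge_zero)
  then have fin: "mean_gap B' s < top" using t(3) by (rule order.strict_trans1)
  \<comment> \<open>Exchanging the bound B' for the larger ball against B costs a constant.\<close>
  have "gap B z \<le> ennreal \<bar>B - B'\<bar> + gap B' z" for z
  proof (cases "nsq z = 0")
    case False
    have "ennreal (B - ulog z) \<le> ennreal (\<bar>B - B'\<bar> + max 0 (B' - ulog z))" by (rule ennreal_leI) simp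
    also have "\<dots> = ennreal \<bar>B - B'\<bar> + ennreal (max 0 (B' - ulog z))" by (rule ennreal_plus) auto
    also have "ennreal (max 0 (B' - ulog z)) = ennreal (B' - ulog z)" by (simp add: max_def ennreal_neg)
    finally show ?thesis using False by (simp add: gap_def)
  qed (simp add: gap_def)
  then have "mean_gap B s \<le> (\<integral>\<^sup>+ z. ennreal \<bar>B - B'\<bar> + gap B' z \<partial>cone_measure s)"
    unfolding mean_gap_def by (intro nn_integral_mono)
  also have "\<dots> = ennreal \<bar>B - B'\<bar> * ennreal (unit_vol TYPE('m)) + mean_gap B' s"
    unfolding mean_gap_def
    by (subst nn_integral_add) (auto simp: emeasure_cone_measure_UNIV emeasure_unit_ball)
  also have "\<dots> < top" using fin by (simp add: ennreal_mult_less_top)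
  finally show ?thesis .
qed

text \<open>Finiteness at every radius makes the zero set null on every sphere, which the identities
  at a fixed radius require.\<close>

lemma AE_cone_nsq_nonzero:
  assumes s: "s > 0"
  shows "AE z in cone_measure s. nsq z \<noteq> 0"
proof -
  obtain B where B: "\<And>z. norm z \<le> s \<Longrightarrow> ueps 1 z \<le> B" using ueps_bounded_above[where T = s] by blast
  have "(\<integral>\<^sup>+ z. gap B z \<partial>cone_measure s) \<noteq> \<infinity>" using mean_gap_finite[OF s B] by (simp add: mean_gap_def)
  then have "AE z in cone_measure s. gap B z \<noteq> \<infinity>" by (intro nn_integral_PInf_AE) measurable
  then show ?thesis by eventually_elim (auto simp: gap_def)
qed

text \<open>Not normalised: the spherical mean of log |F| is
  \<open>Mean s / unit_vol\<close>.\<close>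

definition Mean :: "real \<Rightarrow> real" where
  "Mean s = (LINT z|cone_measure s. ulog z)"

lemma
  assumes s: "s > 0" 
  shows integrable_ulog_cone_measure: "integrable (cone_measure s) ulog"
    and mean_gap_eq_Mean: "\<And>B. (\<And>z. norm z \<le> s \<Longrightarrow> ueps 1 z \<le> B) \<Longrightarrow>
      mean_gap B s = ennreal (B * unit_vol TYPE('m) - Mean s) \<and> 0 \<le> B * unit_vol TYPE('m) - Mean s"
proof -
  interpret finite_measure "cone_measure s :: (complex ^ 'm) measure" by (rule finite_measure_cone_measure)
  have ae: "AE z in cone_measure s. 0 \<le> B - ulog z"
    and int: "integrable (cone_measure s) (\<lambda>z. B - ulog z)"
    and eq: "mean_gap B s = (\<integral>\<^sup>+ z. ennreal (B - ulog z) \<partial>cone_measure s)"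
    if B: "\<And>z. norm z \<le> s \<Longrightarrow> ueps 1 z \<le> B" for B
  proof -
    have "AE z in cone_measure s. norm z = s" by (rule AE_cone_measure[OF s])
    then show ae: "AE z in cone_measure s. 0 \<le> B - ulog z"
      using AE_cone_nsq_nonzero[OF s] by eventually_elim (use ulog_le B in auto)
    show eq: "mean_gap B s = (\<integral>\<^sup>+ z. ennreal (B - ulog z) \<partial>cone_measure s)"
      unfolding mean_gap_def
      by (intro nn_integral_cong_AE, use AE_cone_nsq_nonzero[OF s] in eventually_elim) (simp add: gap_def)
    show "integrable (cone_measure s) (\<lambda>z. B - ulog z)"
      using mean_gap_finite[OF s B] by (intro integrableI_nonneg ae) (auto simp: eq)
  qed
  obtain B where B: "\<And>z. norm z \<le> s \<Longrightarrow> ueps 1 z \<le> B" using ueps_bounded_above[where T = s] by blast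
  have "integrable (cone_measure s) (\<lambda>z. B - (B - ulog z))"
    by (intro Bochner_Integration.integrable_diff int B) auto
  then show I: "integrable (cone_measure s) ulog" by simp
  fix B assume B: "\<And>z. norm z \<le> s \<Longrightarrow> ueps 1 z \<le> B"
  have L: "(LINT z|cone_measure s. B - ulog z) = B * unit_vol TYPE('m) - Mean s"
    using I by (simp add: Mean_def measure_cone_measure_UNIV)
  have "mean_gap B s = ennreal (LINT z|cone_measure s. B - ulog z)"
    by (subst eq) (auto intro!: nn_integral_eq_integral int ae B)
  moreover have "0 \<le> (LINT z|cone_measure s. B - ulog z)"
    by (intro integral_nonneg_AE ae B)
  ultimately show "mean_gap B s = ennreal (B * unit_vol TYPE('m) - Mean s) \<and> 0 \<le> B * unit_vol TYPE('m) - Mean s"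
    unfolding L by simp
qed

lemma tendsto_Phi_Mean:
  assumes s: "s > 0"
  shows "(\<lambda>k. Phi (1 / Suc k) (of_real s)) \<longlonglongrightarrow> Mean s"
proof -
  obtain B where B: "\<And>z. norm z \<le> s \<Longrightarrow> ueps 1 z \<le> B" using ueps_bounded_above[where T = s] by blast
  have ns: "AE z in cone_measure s. norm (z :: complex ^ 'm) = s" by (rule AE_cone_measure[OF s])
  interpret finite_measure "cone_measure s :: (complex ^ 'm) measure" by (rule finite_measure_cone_measure)
  show ?thesis
    unfolding Phi_of_real Mean_def
  proof (rule integral_dominated_convergence[where w = "\<lambda>z. \<bar>ulog z\<bar> + \<bar>B\<bar>"])
  show "integrable (cone_measure s) (\<lambda>z. \<bar>ulog z\<bar> + \<bar>B\<bar>)"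
    using integrable_ulog_cone_measure[OF s] by simp
  show "AE z in cone_measure s. (\<lambda>k. ueps (1 / Suc k) z) \<longlonglongrightarrow> ulog z"
    using AE_cone_nsq_nonzero[OF s] by eventually_elim (rule tendsto_ueps)
  show "AE z in cone_measure s. norm (ueps (1 / Suc k) z) \<le> \<bar>ulog z\<bar> + \<bar>B\<bar>" for k
    using AE_cone_nsq_nonzero[OF s] ns
  proof eventually_elim
    case (elim z)
    have "ulog z \<le> ueps (1 / Suc k) z" using elim by (intro ulog_le_ueps) auto
    moreover have "ueps (1 / Suc k) z \<le> B" using elim B[of z] ueps_mono[of "1 / Suc k" 1 z] by simp
    ultimately show ?case by simp
  qed
  qed measurable
qed

lemma Mean_mono:
  assumes s: "0 < s" "s \<le> s'"
  shows "Mean s \<le> Mean s'"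
  using s by (intro LIMSEQ_le[OF tendsto_Phi_Mean tendsto_Phi_Mean] exI allI impI Phi_mono) auto

lemma Mean_three_circles:
  assumes s: "0 < s1" "s1 \<le> s" "s \<le> s2"
  shows "Mean s - l * ln s \<le> max (Mean s1 - l * ln s1) (Mean s2 - l * ln s2)"
  using s
  by (intro LIMSEQ_le[OF tendsto_diff[OF tendsto_Phi_Mean tendsto_const]
        tendsto_max[OF tendsto_diff[OF tendsto_Phi_Mean tendsto_const] tendsto_diff[OF tendsto_Phi_Mean tendsto_const]]]
      exI allI impI Phi_three_circles) auto

end

lemma measure_cball_Cm: "R \<ge> 0 \<Longrightarrow> measure lborel (cball (p::complex ^ 'm) R) = unit_vol TYPE('m::finite) * R ^ (2 * CARD('m))"
  unfolding unit_vol_def by (simp add: content_cball mult.commute)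

lemma emeasure_cball_Cm: "R \<ge> 0 \<Longrightarrow> emeasure lborel (cball (p::complex ^ 'm) R) = ennreal (unit_vol TYPE('m::finite) * R ^ (2 * CARD('m)))"
  using emeasure_eq_ennreal_measure[of lborel "cball p R"] emeasure_lborel_cball_finite[of p R]
  by (simp add: measure_cball_Cm)

text \<open>q is its modulus times a unimodular number, so the linear part is a rotation followed by
  a dilation, with Jacobian |q|^(2m).\<close>

lemma nn_integral_lborel_complex_affine:
  fixes g :: "complex ^ 'm::finite \<Rightarrow> ennreal"
  assumes [measurable]: "g \<in> borel_measurable borel" and q: "q \<noteq> 0"
  shows "(\<integral>\<^sup>+ x. g x \<partial>lborel) = ennreal (cmod q ^ (2 * CARD('m))) * (\<integral>\<^sup>+ z. g (c + q *s z) \<partial>lborel)"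
proof -
  define w where "w = sgn q"
  have w: "cmod w = 1" "q = of_real (cmod q) * w"
    using q by (simp_all add: w_def norm_sgn) (simp add: sgn_eq)
  have U: "orthogonal_transformation (\<lambda>x :: complex ^ 'm. w *s x)"
    unfolding orthogonal_transformation using w
    by (auto simp: norm_vector_scalar intro: bounded_linear.linear bounded_linear_scalar_vector)
  have "c + q *s z = c + cmod q *\<^sub>R (w *s z)" for z :: "complex ^ 'm"
    using arg_cong[OF w(2), of "\<lambda>q. q *s z"] unfolding vector_smult_assoc[symmetric] of_real_vector_scalar by simp
  then have "(\<integral>\<^sup>+ z. g (c + q *s z) \<partial>lborel) = (\<integral>\<^sup>+ z. g (c + cmod q *\<^sub>R z) \<partial>lborel)"
    using nn_integral_lborel_orthogonal[OF U, of "\<lambda>z. g (c + cmod q *\<^sub>R z)"] by simp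
  moreover have "(\<integral>\<^sup>+ x. g x \<partial>lborel) = ennreal (\<bar>cmod q\<bar> ^ DIM(complex ^ 'm)) * (\<integral>\<^sup>+ z. g (c + cmod q *\<^sub>R z) \<partial>lborel)"
    using q by (intro nn_integral_lborel_affine) auto
  ultimately show ?thesis by (simp add: mult.commute)
qed

context nonzero_entire_pair
begin

lemma ulog_set_integrable_ball: "set_integrable lborel (cball p R) ulog"
proof (rule set_integrable_subset[OF ulog_set_integrable[of "norm p + R"]])
  show "cball p R \<subseteq> cball 0 (norm p + R)"
  proof
    fix x assume "x \<in> cball p R"
    then show "x \<in> cball 0 (norm p + R)"
      using norm_triangle_sub[of x p] by (simp add: dist_norm norm_minus_commute)
  qed
qed simp

lemma nn_integral_gap_eq:
  assumes A: "A \<in> sets borel" "A \<subseteq> cball p R" and B: "\<And>z. z \<in> A \<Longrightarrow> ueps 1 z \<le> B"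
  shows "(\<integral>\<^sup>+ z. gap B z * indicator A z \<partial>lborel) = ennreal (B * measure lborel A - (LINT z:A|lborel. ulog z))"
    and "0 \<le> B * measure lborel A - (LINT z:A|lborel. ulog z)"
proof -
  note [measurable] = A(1)
  have fin: "emeasure lborel A < top"
    using emeasure_mono[OF A(2), of lborel] emeasure_lborel_cball_finite[of p R] by (auto intro: order.strict_trans1)
  have iu: "integrable lborel (\<lambda>z. indicator A z * ulog z)"
    using set_integrable_subset[OF ulog_set_integrable_ball _ A(2)] A(1) by (simp add: set_integrable_def)
  have iB: "integrable lborel (\<lambda>z. indicator A z * B)"
    using fin by (intro integrable_mult_left integrable_real_indicator) auto
  have nn: "AE z in lborel. 0 \<le> indicator A z * B - indicator A z * ulog z"
    using AE_nsq_nonzero by eventually_elim (auto simp: indicator_def ulog_le B)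
  have "(\<integral>\<^sup>+ z. gap B z * indicator A z \<partial>lborel) = (\<integral>\<^sup>+ z. ennreal (indicator A z * B - indicator A z * ulog z) \<partial>lborel)"
    by (intro nn_integral_cong_AE, use AE_gap[of B] in eventually_elim) (auto simp: indicator_def)
  also have "\<dots> = ennreal (LINT z|lborel. indicator A z * B - indicator A z * ulog z)"
    by (intro nn_integral_eq_integral nn Bochner_Integration.integrable_diff iB iu)
  also have L: "(LINT z|lborel. indicator A z * B - indicator A z * ulog z) = B * measure lborel A - (LINT z:A|lborel. ulog z)"
    by (subst Bochner_Integration.integral_diff[OF iB iu]) (simp add: set_lebesgue_integral_def mult.commute)
  finally show "(\<integral>\<^sup>+ z. gap B z * indicator A z \<partial>lborel) = ennreal (B * measure lborel A - (LINT z:A|lborel. ulog z))" .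
  show "0 \<le> B * measure lborel A - (LINT z:A|lborel. ulog z)"
    unfolding L[symmetric] by (rule integral_nonneg_AE[OF nn])
qed

section \<open>Averages over balls and shells\<close>

definition avg :: "real \<Rightarrow> complex ^ 'm \<Rightarrow> real" where
  "avg R a = (LINT z:cball a R|lborel. ulog z) / (unit_vol TYPE('m) * R ^ (2 * CARD('m)))"

lemma borel_measurable_avg [measurable]: "avg R \<in> borel_measurable borel"
proof -
  have eq: "indicator (cball a R) z = (indicator {..R} (dist a z) :: real)" for a z :: "complex ^ 'm"
    by (simp add: indicator_def)
  have "(\<lambda>a. LINT z|lborel. indicator {..R} (dist a z) * ulog z) \<in> borel_measurable borel"
    by (intro lborel.borel_measurable_lebesgue_integral) measurable
  then show ?thesis unfolding avg_def set_lebesgue_integral_def eq by simp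
qed

lemma gap_avg:
  assumes R: "R > 0" and B: "\<And>z. z \<in> cball a R \<Longrightarrow> ueps 1 z \<le> B"
  shows "(\<integral>\<^sup>+ z. gap B z * indicator (cball a R) z \<partial>lborel) =
      ennreal (unit_vol TYPE('m) * R ^ (2 * CARD('m))) * ennreal (B - avg R a)"
    and "avg R a \<le> B"
proof -
  define c where "c = unit_vol TYPE('m) * R ^ (2 * CARD('m))"
  have c: "c > 0" using R unit_vol_pos[where 'm = 'm] by (simp add: c_def)
  have m: "measure lborel (cball a R) = c" using R by (simp add: measure_cball_Cm c_def)
  have eq: "B * measure lborel (cball a R) - (LINT z:cball a R|lborel. ulog z) = c * (B - avg R a)"
    using c unfolding m avg_def c_def[symmetric] by (simp add: right_diff_distrib mult.commute)
  have "(\<integral>\<^sup>+ z. gap B z * indicator (cball a R) z \<partial>lborel) =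
      ennreal (B * measure lborel (cball a R) - (LINT z:cball a R|lborel. ulog z))"
    by (rule nn_integral_gap_eq(1)[where p = a and R = R]) (use B in auto)
  also have "\<dots> = ennreal c * ennreal (B - avg R a)"
    unfolding eq using c by (intro ennreal_mult') simp
  finally show "(\<integral>\<^sup>+ z. gap B z * indicator (cball a R) z \<partial>lborel) =
      ennreal (unit_vol TYPE('m) * R ^ (2 * CARD('m))) * ennreal (B - avg R a)" by (simp only: c_def)
  have "0 \<le> B * measure lborel (cball a R) - (LINT z:cball a R|lborel. ulog z)"
    by (rule nn_integral_gap_eq(2)[where p = a and R = R]) (use B in auto)
  then show "avg R a \<le> B" using c unfolding eq by (simp add: zero_le_mult_iff)
qed

lemma ulog_le_avg:
  assumes a: "nsq a \<noteq> 0" and R: "R > 0"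
  shows "ulog a \<le> avg R a"
proof -
  define c where "c = unit_vol TYPE('m) * R ^ (2 * CARD('m))"
  have c: "c > 0" using R unit_vol_pos[where 'm = 'm] by (simp add: c_def)
  obtain B where B: "\<And>z. norm z \<le> norm a + R \<Longrightarrow> ueps 1 z \<le> B" using ueps_bounded_above[of "norm a + R"] by blast
  have B': "ueps 1 z \<le> B" if "z \<in> cball a R" for z
    using that norm_triangle_sub[of z a] by (intro B) (simp add: dist_norm norm_minus_commute)
  have "ennreal c * ennreal (B - avg R a) \<le> ennreal c * gap B a"
  proof -
    have "(\<integral>\<^sup>+ z. gap B z * indicator (cball a R) z \<partial>lborel) \<le> emeasure lborel (cball (0::complex ^ 'm) R) * gap B a"
      by (rule nn_integral_gap_ball) (use B' in \<open>auto simp: dist_norm\<close>)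
    then show ?thesis using gap_avg(1)[OF R B'] emeasure_cball_Cm[of R "0::complex ^ 'm"] R by (simp add: c_def)
  qed
  then have "ennreal (B - avg R a) \<le> gap B a"
    using c by (subst (asm) ennreal_mult_le_mult_iff) auto
  then have "B - avg R a \<le> B - ulog a"
    using a gap_avg(2)[OF R B'] ulog_le[OF a B'[of a]] R by (simp add: gap_def)
  then show ?thesis by simp
qed

text \<open>Averaging over balls and then over a shell amounts to one integral against a radial
  weight, hence to an average of spherical means.\<close>

lemma nn_integral_avg_minus_ulog:
  assumes R: "R > 0" and \<alpha>: "0 < \<alpha>" "\<alpha> \<le> \<beta>"
  shows "(\<integral>\<^sup>+ a. ennreal (avg R a - ulog a) * indicator {\<alpha>..\<beta>} (norm a) \<partial>lborel) \<le>
    ennreal (\<beta> ^ (2 * CARD('m)) * (Mean (R + \<beta>) - Mean \<alpha>))"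
proof -
  define V where "V = unit_vol TYPE('m)"
  have V: "V > 0" by (simp add: V_def unit_vol_pos)
  define c where "c = V * R ^ (2 * CARD('m))"
  have c: "c > 0" using R V by (simp add: c_def)
  obtain B where B: "\<And>z. norm z \<le> R + \<beta> \<Longrightarrow> ueps 1 z \<le> B" using ueps_bounded_above[of "R + \<beta>"] by blast
  have Bball: "ueps 1 z \<le> B" if "norm a \<le> \<beta>" "z \<in> cball a R" for a z
    using that norm_triangle_sub[of z a] by (intro B) (simp add: dist_norm norm_minus_commute)
  define X where "X = (\<integral>\<^sup>+ a. ennreal (avg R a - ulog a) * indicator {\<alpha>..\<beta>} (norm a) \<partial>lborel)"
  define Y where "Y = (\<integral>\<^sup>+ a. (\<integral>\<^sup>+ z. gap B z * indicator {..R} (dist a z) \<partial>lborel) * indicator {\<alpha>..\<beta>} (norm a) \<partial>lborel)"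
  define Z where "Z = (\<integral>\<^sup>+ a. gap B a * indicator {\<alpha>..\<beta>} (norm a) \<partial>lborel)"
  define S where "S = (\<integral>\<^sup>+ a. indicator {\<alpha>..\<beta>} (norm (a :: complex ^ 'm)) \<partial>lborel)"
  have ind: "indicator (cball a R) z = (indicator {..R} (dist a z) :: ennreal)" for a z :: "complex ^ 'm"
    by (simp add: indicator_def)
  \<comment> \<open>Pointwise (avg - ulog) + (B - avg) = B - ulog, kept as a sum because subtraction
    in \<open>ennreal\<close> truncates.\<close>
  have XYZ: "ennreal c * X + Y = ennreal c * Z"
  proof -
    have "ennreal c * X + Y = (\<integral>\<^sup>+ a. ennreal c * (ennreal (avg R a - ulog a) * indicator {\<alpha>..\<beta>} (norm a)) +
        (\<integral>\<^sup>+ z. gap B z * indicator {..R} (dist a z) \<partial>lborel) * indicator {\<alpha>..\<beta>} (norm a) \<partial>lborel)"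
      unfolding X_def Y_def by (subst nn_integral_add, measurable) (simp add: nn_integral_cmult)
    also have "\<dots> = (\<integral>\<^sup>+ a. ennreal c * (gap B a * indicator {\<alpha>..\<beta>} (norm a)) \<partial>lborel)"
    proof (intro nn_integral_cong_AE, use AE_nsq_nonzero in eventually_elim)
      fix a assume a: "nsq a \<noteq> 0"
      have *: "ennreal c * ennreal (avg R a - ulog a) + (\<integral>\<^sup>+ z. gap B z * indicator {..R} (dist a z) \<partial>lborel) = ennreal c * gap B a"
        if "norm a \<le> \<beta>"
      proof -
        have "(\<integral>\<^sup>+ z. gap B z * indicator {..R} (dist a z) \<partial>lborel) = ennreal c * ennreal (B - avg R a)"
          unfolding ind[symmetric] c_def V_def by (rule gap_avg(1)[OF R]) (rule Bball[OF that])
        moreover have "avg R a \<le> B" by (rule gap_avg(2)[OF R]) (rule Bball[OF that])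
        ultimately show ?thesis
          using a ulog_le_avg[OF a R]
          by (simp add: gap_def distrib_left[symmetric] ennreal_plus[symmetric] del: ennreal_plus)
      qed
      then show "ennreal c * (ennreal (avg R a - ulog a) * indicator {\<alpha>..\<beta>} (norm a)) +
        (\<integral>\<^sup>+ z. gap B z * indicator {..R} (dist a z) \<partial>lborel) * indicator {\<alpha>..\<beta>} (norm a) =
        ennreal c * (gap B a * indicator {\<alpha>..\<beta>} (norm a))"
        by (auto simp: indicator_def)
    qed
    also have "\<dots> = ennreal c * Z" unfolding Z_def by (rule nn_integral_cmult) measurable
    finally show ?thesis .
  qed
  have Z_le: "ennreal V * Z \<le> mean_gap B \<alpha> * S"
    unfolding Z_def S_def V_def
    by (rule nn_integral_gap_radial_le[where T = \<beta>]) (use \<alpha> R B in \<open>auto simp: indicator_def\<close>)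
  \<comment> \<open>The exchange of integrals turns Y into the integral of the gap against k w, the
    volume of the shell points within R of w. This weight is radial by rotation invariance, vanishes
    for |w| > R + \<beta>, and has total integral c S.\<close>
  have Y_ge: "mean_gap B (R + \<beta>) * (ennreal c * S) \<le> ennreal V * Y"
  proof -
    obtain e :: "complex ^ 'm" where e: "norm e = 1" using vector_choose_size[of 1] by auto
    define k where "k w = (\<integral>\<^sup>+ a. indicator {..R} (dist a w) * indicator {\<alpha>..\<beta>} (norm a) \<partial>lborel)" for w :: "complex ^ 'm"
    define \<kappa> where "\<kappa> s = k (s *\<^sub>R e)" for s
    have [measurable]: "k \<in> borel_measurable borel" unfolding k_def by measurable
    have [measurable]: "\<kappa> \<in> borel_measurable borel" unfolding \<kappa>_def by measurable
    have k\<kappa>: "k w = \<kappa> (norm w)" for w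
    proof -
      have "norm (norm w *\<^sub>R e) = norm w" using e by simp
      then obtain U where U: "orthogonal_transformation U" "U (norm w *\<^sub>R e) = w"
        by (rule orthogonal_transformation_between)
      have d: "dist (U a) (U b) = dist a b" for a b
        unfolding dist_norm using U(1)
        by (metis linear_diff orthogonal_transformation_linear orthogonal_transformation_norm)
      have "k w = (\<integral>\<^sup>+ a. indicator {..R} (dist (U a) w) * indicator {\<alpha>..\<beta>} (norm (U a)) \<partial>lborel)"
        unfolding k_def by (rule nn_integral_lborel_orthogonal[OF U(1), symmetric]) measurable
      also have "\<dots> = k (norm w *\<^sub>R e)"
        unfolding k_def using U d[of _ "norm w *\<^sub>R e"] by (simp add: orthogonal_transformation_norm)
      finally show ?thesis by (simp add: \<kappa>_def)
    qed
    have "Y = (\<integral>\<^sup>+ a. \<integral>\<^sup>+ z. gap B z * (indicator {..R} (dist a z) * indicator {\<alpha>..\<beta>} (norm a)) \<partial>lborel \<partial>lborel)"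
      unfolding Y_def by (subst nn_integral_multc[symmetric]) (auto simp: mult.assoc)
    also have "\<dots> = (\<integral>\<^sup>+ z. \<integral>\<^sup>+ a. gap B z * (indicator {..R} (dist a z) * indicator {\<alpha>..\<beta>} (norm a)) \<partial>lborel \<partial>lborel)"
      by (rule lborel_pair.Fubini') measurable
    also have "\<dots> = (\<integral>\<^sup>+ z. gap B z * k z \<partial>lborel)"
      unfolding k_def by (subst nn_integral_cmult) auto
    finally have Y: "Y = (\<integral>\<^sup>+ z. gap B z * \<kappa> (norm z) \<partial>lborel)" unfolding k\<kappa> .
    have "(\<integral>\<^sup>+ z. \<kappa> (norm (z :: complex ^ 'm)) \<partial>lborel) = (\<integral>\<^sup>+ z. \<integral>\<^sup>+ a. indicator {..R} (dist a z) * indicator {\<alpha>..\<beta>} (norm a) \<partial>(lborel :: (complex ^ 'm) measure) \<partial>(lborel :: (complex ^ 'm) measure))"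
      unfolding k\<kappa>[symmetric] k_def ..
    also have "\<dots> = (\<integral>\<^sup>+ a. \<integral>\<^sup>+ z. indicator {..R} (dist a z) * indicator {\<alpha>..\<beta>} (norm a) \<partial>(lborel :: (complex ^ 'm) measure) \<partial>(lborel :: (complex ^ 'm) measure))"
      by (rule lborel_pair.Fubini') measurable
    also have "\<dots> = (\<integral>\<^sup>+ a. ennreal c * indicator {\<alpha>..\<beta>} (norm a) \<partial>(lborel :: (complex ^ 'm) measure))"
    proof (intro nn_integral_cong)
      fix a :: "complex ^ 'm"
      have "(\<integral>\<^sup>+ z. indicator {..R} (dist a z) * indicator {\<alpha>..\<beta>} (norm a) \<partial>lborel) =
          (\<integral>\<^sup>+ z. indicator {..R} (dist a z) \<partial>lborel) * indicator {\<alpha>..\<beta>} (norm a)"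
        by (rule nn_integral_multc) measurable
      also have "(\<integral>\<^sup>+ z. indicator {..R} (dist a z) \<partial>lborel) = ennreal c"
        unfolding ind[symmetric] using emeasure_cball_Cm[of R a] R by (simp add: c_def V_def)
      finally show "(\<integral>\<^sup>+ z. indicator {..R} (dist a z) * indicator {\<alpha>..\<beta>} (norm a) \<partial>lborel) = ennreal c * indicator {\<alpha>..\<beta>} (norm a)" .
    qed
    also have "\<dots> = ennreal c * S" unfolding S_def by (rule nn_integral_cmult) measurable
    finally have K: "(\<integral>\<^sup>+ z. \<kappa> (norm (z :: complex ^ 'm)) \<partial>lborel) = ennreal c * S" .
    have "mean_gap B (R + \<beta>) * (\<integral>\<^sup>+ z. \<kappa> (norm (z :: complex ^ 'm)) \<partial>lborel) \<le> ennreal V * (\<integral>\<^sup>+ z. gap B z * \<kappa> (norm z) \<partial>lborel)"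
      unfolding V_def
    proof (rule nn_integral_gap_radial_ge)
      fix s assume s: "s > R + \<beta>"
      have "indicator {..R} (dist a (s *\<^sub>R e)) * indicator {\<alpha>..\<beta>} (norm a) = (0::ennreal)" for a
      proof -
        have "norm (s *\<^sub>R e) = s" using e s R \<alpha> by simp
        then show ?thesis
          using norm_triangle_sub[of "s *\<^sub>R e" a] s by (auto simp: indicator_def dist_norm norm_minus_commute)
      qed
      then show "\<kappa> s = 0" unfolding \<kappa>_def k_def by (simp only: nn_integral_const mult_zero_left)
    qed (use R \<alpha> B in auto)
    then show ?thesis unfolding K Y .
  qed
  have S_le: "S \<le> ennreal (V * \<beta> ^ (2 * CARD('m)))"
  proof -
    have "S \<le> (\<integral>\<^sup>+ a. indicator (cball 0 \<beta>) (a :: complex ^ 'm) \<partial>lborel)"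
      unfolding S_def by (intro nn_integral_mono) (auto simp: indicator_def)
    then show ?thesis using emeasure_cball_Cm[of \<beta> "0 :: complex ^ 'm"] \<alpha> by (simp add: V_def)
  qed
  then obtain s where s: "S = ennreal s" "0 \<le> s" "s \<le> V * \<beta> ^ (2 * CARD('m))"
    by (cases S) (use V in \<open>auto simp: top_unique\<close>)
  \<comment> \<open>The bounds on Z and Y in \<open>XYZ\<close> combine to V X \<le> (m1 - m2) S,
    and m1 - m2 is the increment of \<open>Mean\<close>.\<close>
  define m1 m2 where "m1 = B * V - Mean \<alpha>" and "m2 = B * V - Mean (R + \<beta>)"
  have m1: "mean_gap B \<alpha> = ennreal m1" "m1 \<ge> 0"
    using mean_gap_eq_Mean[of \<alpha> B] B \<alpha> R unfolding m1_def V_def by auto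
  have m2: "mean_gap B (R + \<beta>) = ennreal m2" "m2 \<ge> 0"
    using mean_gap_eq_Mean[of "R + \<beta>" B] B \<alpha> R unfolding m2_def V_def by auto
  have m12: "m2 \<le> m1" using Mean_mono[of \<alpha> "R + \<beta>"] \<alpha> R by (simp add: m1_def m2_def)
  have "ennreal (V * c) * X + ennreal (m2 * c * s) \<le> ennreal (m1 * c * s)"
  proof -
    have "ennreal (V * c) * X + ennreal (m2 * c * s) = ennreal V * (ennreal c * X) + mean_gap B (R + \<beta>) * (ennreal c * S)"
      using V c s m2 by (simp add: ennreal_mult mult.assoc)
    also have "\<dots> \<le> ennreal V * (ennreal c * X) + ennreal V * Y" by (intro add_left_mono Y_ge)
    also have "\<dots> = ennreal c * (ennreal V * Z)"
      unfolding distrib_left[symmetric] XYZ by (simp only: mult_ac)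
    also have "\<dots> \<le> ennreal c * (mean_gap B \<alpha> * S)" by (intro mult_left_mono Z_le) simp
    also have "\<dots> = ennreal (m1 * c * s)" using c s m1 by (simp add: ennreal_mult mult_ac)
    finally show ?thesis .
  qed
  moreover have "X < top"
  proof (rule ccontr)
    assume "\<not> X < top"
    then have "X = top" by (simp add: not_less top_unique)
    then have "ennreal (V * c) * X + ennreal (m2 * c * s) = top" using V c by (simp add: ennreal_mult_top)
    with \<open>ennreal (V * c) * X + ennreal (m2 * c * s) \<le> ennreal (m1 * c * s)\<close> show False by (simp add: top_unique)
  qed
  then obtain x where x: "X = ennreal x" "x \<ge> 0" by (cases X) auto
  ultimately have "V * c * x + m2 * c * s \<le> m1 * c * s"
    using V c m1 m2 s by (simp add: ennreal_mult[symmetric] ennreal_plus[symmetric] del: ennreal_plus)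
  then have "c * (V * x) \<le> c * ((m1 - m2) * s)" by (simp add: algebra_simps)
  then have "V * x \<le> (m1 - m2) * s" using c by simp
  also have "\<dots> \<le> (m1 - m2) * (V * \<beta> ^ (2 * CARD('m)))" using s m12 by (intro mult_left_mono) auto
  finally have "V * x \<le> V * (\<beta> ^ (2 * CARD('m)) * (m1 - m2))" by (simp add: mult_ac)
  then have "x \<le> \<beta> ^ (2 * CARD('m)) * (m1 - m2)" using V by simp
  then have "x \<le> \<beta> ^ (2 * CARD('m)) * (Mean (R + \<beta>) - Mean \<alpha>)" by (simp add: m1_def m2_def)
  then show ?thesis unfolding X_def[symmetric] x(1) by (rule ennreal_leI)
qed

text \<open>The means at the two boundary spheres bound those in between, by the two estimates for
  radial weights applied to the indicator of the shell.\<close>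

lemma
  assumes \<alpha>: "0 < \<alpha>" "\<alpha> \<le> \<beta>"
  shows shell_integral_le: "unit_vol TYPE('m) * (LINT z:{z. norm z \<in> {\<alpha>..\<beta>}}|lborel. ulog z) \<le> Mean \<beta> * measure lborel {z :: complex ^ 'm. norm z \<in> {\<alpha>..\<beta>}}"
    and shell_integral_ge: "Mean \<alpha> * measure lborel {z :: complex ^ 'm. norm z \<in> {\<alpha>..\<beta>}} \<le> unit_vol TYPE('m) * (LINT z:{z. norm z \<in> {\<alpha>..\<beta>}}|lborel. ulog z)"
proof -
  define V where "V = unit_vol TYPE('m)"
  have V: "V > 0" by (simp add: V_def unit_vol_pos)
  define A where "A = {z :: complex ^ 'm. norm z \<in> {\<alpha>..\<beta>}}"
  have A [measurable]: "A \<in> sets borel" unfolding A_def by measurable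
  have Asub: "A \<subseteq> cball 0 \<beta>" by (auto simp: A_def)
  obtain B where B: "\<And>z. norm z \<le> \<beta> \<Longrightarrow> ueps 1 z \<le> B" using ueps_bounded_above[of \<beta>] by blast
  define I where "I = (LINT z:A|lborel. ulog z)"
  define s where "s = measure lborel A"
  have ind: "indicator A z = (indicator {\<alpha>..\<beta>} (norm z) :: ennreal)" for z by (simp add: A_def indicator_def)
  have AB: "ueps 1 z \<le> B" if "z \<in> A" for z using that B Asub by auto
  have "(\<integral>\<^sup>+ z. gap B z * indicator A z \<partial>lborel) = ennreal (B * s - I)"
    unfolding s_def I_def by (rule nn_integral_gap_eq(1)[OF A Asub]) (rule AB)
  moreover have "0 \<le> B * s - I"
    unfolding s_def I_def by (rule nn_integral_gap_eq(2)[OF A Asub]) (rule AB)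
  ultimately have g: "(\<integral>\<^sup>+ z. gap B z * indicator {\<alpha>..\<beta>} (norm z) \<partial>lborel) = ennreal (B * s - I)" "0 \<le> B * s - I"
    unfolding ind by auto
  have S: "(\<integral>\<^sup>+ z. indicator {\<alpha>..\<beta>} (norm (z :: complex ^ 'm)) \<partial>lborel) = ennreal s" "s \<ge> 0"
  proof -
    have "emeasure lborel A < top"
      using emeasure_mono[OF Asub, of lborel] emeasure_lborel_cball_finite[of "0 :: complex ^ 'm" \<beta>] by (auto intro: order.strict_trans1)
    then show "(\<integral>\<^sup>+ z. indicator {\<alpha>..\<beta>} (norm (z :: complex ^ 'm)) \<partial>lborel) = ennreal s"
      unfolding ind[symmetric] s_def by (simp add: emeasure_eq_ennreal_measure)
  qed (simp add: s_def)
  have m1: "mean_gap B \<alpha> = ennreal (B * V - Mean \<alpha>)" "B * V - Mean \<alpha> \<ge> 0"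
    using mean_gap_eq_Mean[of \<alpha> B] B \<alpha> unfolding V_def by auto
  have m2: "mean_gap B \<beta> = ennreal (B * V - Mean \<beta>)" "B * V - Mean \<beta> \<ge> 0"
    using mean_gap_eq_Mean[of \<beta> B] B \<alpha> unfolding V_def by auto
  have "mean_gap B \<beta> * (\<integral>\<^sup>+ z. indicator {\<alpha>..\<beta>} (norm (z :: complex ^ 'm)) \<partial>lborel) \<le> ennreal V * (\<integral>\<^sup>+ z. gap B z * indicator {\<alpha>..\<beta>} (norm z) \<partial>lborel)"
    unfolding V_def by (rule nn_integral_gap_radial_ge) (use \<alpha> B in auto)
  then have "(B * V - Mean \<beta>) * s \<le> V * (B * s - I)"
    unfolding g S m2 using V g S m2 by (simp add: ennreal_mult[symmetric])
  then show "unit_vol TYPE('m) * (LINT z:{z. norm z \<in> {\<alpha>..\<beta>}}|lborel. ulog z) \<le> Mean \<beta> * measure lborel {z :: complex ^ 'm. norm z \<in> {\<alpha>..\<beta>}}"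
    unfolding A_def[symmetric] V_def[symmetric] I_def[symmetric] s_def[symmetric] by (simp add: algebra_simps)
  have "ennreal V * (\<integral>\<^sup>+ z. gap B z * indicator {\<alpha>..\<beta>} (norm z) \<partial>lborel) \<le> mean_gap B \<alpha> * (\<integral>\<^sup>+ z. indicator {\<alpha>..\<beta>} (norm (z :: complex ^ 'm)) \<partial>lborel)"
    unfolding V_def by (rule nn_integral_gap_radial_le[where T = \<beta>]) (use \<alpha> B in auto)
  then have "V * (B * s - I) \<le> (B * V - Mean \<alpha>) * s"
    unfolding g S m1 using V g S m1 by (simp add: ennreal_mult[symmetric])
  then show "Mean \<alpha> * measure lborel {z :: complex ^ 'm. norm z \<in> {\<alpha>..\<beta>}} \<le> unit_vol TYPE('m) * (LINT z:{z. norm z \<in> {\<alpha>..\<beta>}}|lborel. ulog z)"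
    unfolding A_def[symmetric] V_def[symmetric] I_def[symmetric] s_def[symmetric] by (simp add: algebra_simps)
qed

text \<open>A zero at 0 drives the means to minus infinity as the radius tends to 0, so they gain
  between some small s and 1. Convexity in \<open>ln r\<close> continues this slope beyond 1 and
  gives at least logarithmic growth.\<close>

lemma Mean_at_top:
  assumes 0: "nsq 0 = 0"
  shows "filterlim Mean at_top at_top"
proof -
  define V where "V = unit_vol TYPE('m)"
  have V: "V > 0" by (simp add: V_def unit_vol_pos)
  \<comment> \<open>Chosen so that - K V \<le> Mean 1 - 2; below,
    \<open>nsq z < exp (- 2 * K)\<close> gives log |F| \<le> - K near 0.\<close>
  define K where "K = max 1 ((2 - Mean 1) / V)"
  have "\<exists>d>0. \<forall>z. norm z < d \<longrightarrow> nsq z < exp (- 2 * K)"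
  proof -
    have "isCont nsq 0" using continuous_on_nsq[of UNIV] by (simp add: continuous_on_eq_continuous_at)
    then show ?thesis
      using 0 nsq_nonneg unfolding continuous_at_eps_delta
      by (metis exp_gt_zero dist_0_norm dist_commute dist_real_def diff_0_right abs_of_nonneg)
  qed
  then obtain d where d: "d > 0" "\<And>z. norm z < d \<Longrightarrow> nsq z < exp (- 2 * K)" by blast
  define s where "s = min (d / 2) (1 / 2)"
  have s: "0 < s" "s < d" "s < 1" using d by (auto simp: s_def)
  interpret fm: finite_measure "cone_measure s :: (complex ^ 'm) measure" by (rule finite_measure_cone_measure)
  have "Mean s \<le> (LINT z|(cone_measure s :: (complex ^ 'm) measure). - K)"
    unfolding Mean_def
  proof (rule integral_mono_AE[OF integrable_ulog_cone_measure[OF s(1)]])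
    have "AE z in cone_measure s. norm (z :: complex ^ 'm) = s" by (rule AE_cone_measure[OF s(1)])
    with AE_cone_nsq_nonzero[OF s(1)] show "AE z in cone_measure s. ulog z \<le> - K"
    proof eventually_elim
      case (elim z)
      then have "ln (nsq z) \<le> ln (exp (- 2 * K))"
        using d(2)[of z] s nsq_nonneg[of z] by (intro ln_mono) auto
      then show ?case by (simp add: ulog_def)
    qed
  qed simp
  also have "\<dots> = - K * V" by (simp add: measure_cone_measure_UNIV V_def)
  also have "\<dots> \<le> Mean 1 - 2"
  proof -
    have "(2 - Mean 1) / V * V \<le> K * V" using V by (intro mult_right_mono) (auto simp: K_def)
    then show ?thesis using V by simp
  qed
  finally have M: "Mean s \<le> Mean 1 - 2" .
  \<comment> \<open>With this slope the term at s is \<open>Mean s + 1\<close>, which is below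
    \<open>Mean 1\<close>; so the maximum in the three circles estimate is the term at r.\<close>
  define l where "l = 1 / (- ln s)"
  have lns: "ln s < 0" using s by simp
  then have l: "l > 0" "- l * ln s = 1" by (simp_all add: l_def)
  have "Mean 1 + l * ln r \<le> Mean r" if "r \<ge> 1" for r
    using Mean_three_circles[of s 1 r l] s that M l by (simp add: max_def split: if_splits)
  then have "\<forall>\<^sub>F r in at_top. Mean 1 + l * ln r \<le> Mean r"
    by (intro eventually_at_top_linorderI[of 1]) auto
  moreover have "filterlim (\<lambda>r. Mean 1 + l * ln r) at_top at_top"
    by (intro filterlim_tendsto_add_at_top[OF tendsto_const] filterlim_tendsto_pos_mult_at_top[OF tendsto_const l(1)] ln_at_top)
  ultimately show ?thesis by (rule filterlim_at_top_mono[rotated])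
qed

end

section \<open>Logarithmic density\<close>

text \<open>Through t / (1 + t), which is at most ln (1 + t) and at least half of min 1 t.\<close>

lemma min_one_le_ln:
  assumes "t \<ge> (0::real)"
  shows "min 1 t \<le> 2 * ln (1 + t)"
proof -
  have "ln (1 / (1 + t)) \<le> 1 / (1 + t) - 1" using assms by (intro ln_le_minus_one) auto
  then have "1 - 1 / (1 + t) \<le> ln (1 + t)" using assms by (simp add: ln_div)
  moreover have "min 1 t \<le> 2 * (1 - 1 / (1 + t))"
    using assms by (simp add: min_def field_simps) (auto simp: power2_eq_square intro: mult_left_le)
  moreover have "2 * (1 - 1 / (1 + t)) \<le> 2 * ln (1 + t)"
    by (rule mult_left_mono) (use calculation(1) in auto)
  ultimately show ?thesis by (meson order_trans)
qed

text \<open>Telescoping with step d: d values at the upper end survive, and the nonnegative values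
  at the lower end are dropped.\<close>

lemma sum_shift_diff_le:
  fixes A :: "nat \<Rightarrow> real"
  assumes A: "\<And>j. j \<ge> j0 \<Longrightarrow> 0 \<le> A j" and J: "J \<ge> j0"
  shows "(\<Sum>j=j0..<J. A (j + d) - A j) \<le> (\<Sum>i<d. A (J + i))"
  using J
proof (induction J rule: dec_induct)
  case base
  then show ?case using A by (simp add: sum_nonneg)
next
  case (step J)
  have "(\<Sum>i<d. A (J + i)) + A (J + d) = (\<Sum>i<Suc d. A (J + i))" by simp
  also have "\<dots> = A J + (\<Sum>i<d. A (Suc J + i))" by (subst sum.lessThan_Suc_shift) simp
  finally show ?case using step by simp
qed

lemma nn_integral_one_over:
  assumes "1 \<le> a" "a \<le> b"
  shows "(\<integral>\<^sup>+ t. ennreal (1 / t) * indicator {a..b} t \<partial>lborel) = ennreal (ln b - ln a)"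
proof (rule nn_integral_FTC_Icc[OF _ _ _ assms(2)])
  show "(ln has_real_derivative 1 / x) (at x)" if "x \<in> {a..b}" for x
    using that assms by (intro DERIV_ln_divide) auto
  show "0 \<le> 1 / x" if "x \<in> {a..b}" for x using that assms by simp
qed simp

text \<open>Serves the degenerate case in which the common factor of all spherical integrals is
  0.\<close>

lemma log_density_one_atLeast: "log_density_one {1..}"
proof -
  have eq: "(LINT t:{1..r}|lebesgue. 1 / t) = ln r" if "r \<ge> 1" for r :: real
  proof -
    have "(LINT t:{1..r}|lebesgue. 1 / t) = (LINT t|lborel. indicator {1..r} t * (1 / t))"
      unfolding set_lebesgue_integral_def by (subst integral_completion) auto
    also have "\<dots> = enn2real (\<integral>\<^sup>+ t. ennreal (indicator {1..r} t * (1 / t)) \<partial>lborel)"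
      by (rule integral_eq_nn_integral) (auto simp: indicator_def)
    also have "(\<integral>\<^sup>+ t. ennreal (indicator {1..r} t * (1 / t)) \<partial>lborel) = ennreal (ln r - ln 1)"
      unfolding nn_integral_one_over[OF order_refl that, symmetric]
      by (intro nn_integral_cong) (auto simp: indicator_def)
    finally show ?thesis using that by simp
  qed
  have "\<forall>\<^sub>F r in at_top. 1 / ln r * (LINT t:{1..} \<inter> {1..r}|lebesgue. 1 / t) = (1::real)"
    using eventually_gt_at_top[of 1] by eventually_elim (simp add: eq)
  then show ?thesis
    unfolding log_density_one_def by (auto intro: tendsto_eventually)
qed

text \<open>A function h with values in [0,1] whose logarithmic means tend to zero tends to zero on
  \<open>E = {r. h r \<le> sqrt (W r)}\<close>, where W is a decreasing null function dominating the logarithmic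
  means; by Chebyshev, E has logarithmic density one.\<close>

lemma log_density_one_from_mean:
  fixes h :: "real \<Rightarrow> real"
  assumes h [measurable]: "h \<in> borel_measurable borel" and h01: "\<And>t. 0 \<le> h t" "\<And>t. h t \<le> 1"
    and mean: "((\<lambda>r. (LINT t|lborel. indicator {1..r} t * (h t / t)) / ln r) \<longlongrightarrow> 0) at_top"
  obtains E where "log_density_one E" "\<And>e. e > 0 \<Longrightarrow> \<exists>r0. \<forall>r\<in>E. r \<ge> r0 \<longrightarrow> h r \<le> e"
proof -
  have i1: "integrable lborel (\<lambda>t. indicator {1..r} t * (1 / t))" for r :: real
  proof (rule integrableI_nonneg)
    have "(\<integral>\<^sup>+ t. ennreal (indicator {1..r} t * (1 / t)) \<partial>lborel) = (\<integral>\<^sup>+ t. ennreal (1 / t) * indicator {1..r} t \<partial>lborel)"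
      by (intro nn_integral_cong) (auto simp: indicator_def)
    also have "\<dots> < \<infinity>"
      by (cases "1 \<le> r") (auto simp: nn_integral_one_over)
    finally show "(\<integral>\<^sup>+ t. ennreal (indicator {1..r} t * (1 / t)) \<partial>lborel) < \<infinity>" .
  qed (auto simp: indicator_def)
  have i2: "integrable lborel (\<lambda>t. indicator {1..r} t * (1 / t) * g t)"
    if "g \<in> borel_measurable borel" "\<And>t. 0 \<le> g t" "\<And>t. g t \<le> 1" for g :: "real \<Rightarrow> real" and r :: real
  proof (rule Bochner_Integration.integrable_bound[OF i1[of r]])
    show "AE t in lborel. norm (indicator {1..r} t * (1 / t) * g t) \<le> norm (indicator {1..r} t * (1 / t))"
      using that by (intro AE_I2) (auto simp: indicator_def abs_mult mult_left_le divide_right_mono)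
  qed (use that in measurable)
  have I1: "(LINT t|lborel. indicator {1..r} t * (1 / t)) = ln r" if "1 \<le> r" for r :: real
  proof -
    have "(LINT t|lborel. indicator {1..r} t * (1 / t)) = enn2real (\<integral>\<^sup>+ t. ennreal (indicator {1..r} t * (1 / t)) \<partial>lborel)"
      by (rule integral_eq_nn_integral) (auto simp: indicator_def)
    also have "(\<integral>\<^sup>+ t. ennreal (indicator {1..r} t * (1 / t)) \<partial>lborel) = ennreal (ln r - ln 1)"
      unfolding nn_integral_one_over[OF order_refl that, symmetric]
      by (intro nn_integral_cong) (auto simp: indicator_def)
    finally show ?thesis using that by simp
  qed
  define Q where "Q r = (LINT t|lborel. indicator {1..r} t * (h t / t)) / ln r" for r
  have heq: "indicator {1..r} t * (h t / t) = indicator {1..r} t * (1 / t) * h t" for r t by simp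
  have Q01: "0 \<le> Q r" "Q r \<le> 1" if "r \<ge> 2" for r
  proof -
    have "0 \<le> (LINT t|lborel. indicator {1..r} t * (h t / t))"
      using h01 by (intro integral_nonneg_AE AE_I2) (auto simp: indicator_def)
    then show "0 \<le> Q r" using that by (simp add: Q_def)
    have "(LINT t|lborel. indicator {1..r} t * (h t / t)) \<le> (LINT t|lborel. indicator {1..r} t * (1 / t))"
      unfolding heq using h01 by (intro integral_mono i1 i2 h) (auto simp: indicator_def divide_right_mono)
    then show "Q r \<le> 1" using that I1[of r] by (simp add: Q_def)
  qed
  \<comment> \<open>The supremum makes W decreasing; the summand 1 / max 2 r makes it strictly
    positive, since its square root is a divisor below.\<close>
  define W where "W r = 1 / max 2 r + (SUP t\<in>{max 2 r..}. Q t)" for r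
  have bdd: "bdd_above (Q ` {max 2 r..})" for r
    using Q01 by (intro bdd_aboveI[of _ 1]) auto
  have W_anti: "W s \<le> W r" if "r \<le> s" for r s
  proof -
    have "1 / max 2 s \<le> 1 / max 2 r" using that by (intro divide_left_mono) auto
    moreover have "(SUP t\<in>{max 2 s..}. Q t) \<le> (SUP t\<in>{max 2 r..}. Q t)"
      using that by (intro cSUP_subset_mono bdd) auto
    ultimately show ?thesis by (simp add: W_def)
  qed
  have Q_le: "Q r \<le> W r" if "r \<ge> 2" for r
  proof -
    have "Q r \<le> (SUP t\<in>{max 2 r..}. Q t)" using that by (intro cSUP_upper bdd) auto
    then show ?thesis using that by (simp add: W_def add_increasing)
  qed
  have W_pos: "W r > 0" for r
  proof -
    have "0 \<le> Q (max 2 r)" by (rule Q01) simp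
    also have "\<dots> \<le> (SUP t\<in>{max 2 r..}. Q t)" by (intro cSUP_upper bdd) auto
    finally show ?thesis by (simp add: W_def add_pos_nonneg)
  qed
  have W_lim: "(W \<longlongrightarrow> 0) at_top"
  proof (rule tendstoI)
    fix e :: real assume e: "e > 0"
    from tendstoD[OF mean, of "e / 3"] e have "\<forall>\<^sub>F r in at_top. \<bar>Q r\<bar> < e / 3"
      by (simp add: Q_def)
    then obtain r1 where r1: "\<And>r. r \<ge> r1 \<Longrightarrow> \<bar>Q r\<bar> < e / 3" unfolding eventually_at_top_linorder by blast
    have W_e: "\<bar>W r\<bar> < e" if "r \<ge> r1" "r \<ge> 2" "r > 3 / e" for r
    proof -
      have "Q t \<le> e / 3" if "t \<in> {max 2 r..}" for t
        using r1[of t] that \<open>r \<ge> r1\<close> by (simp add: abs_less_iff)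
      then have "(SUP t\<in>{max 2 r..}. Q t) \<le> e / 3" by (intro cSUP_least) auto
      moreover have "1 / max 2 r < e / 3" using that e by (simp add: field_simps)
      ultimately have "W r < e" unfolding W_def using e by linarith
      then show ?thesis using W_pos[of r] by simp
    qed
    have "\<forall>\<^sub>F r in at_top. \<bar>W r\<bar> < e"
      using eventually_ge_at_top[of r1] eventually_ge_at_top[of 2] eventually_gt_at_top[of "3 / e"]
      by eventually_elim (rule W_e)
    then show "\<forall>\<^sub>F r in at_top. dist (W r) 0 < e" by simp
  qed
  have [measurable]: "W \<in> borel_measurable borel"
  proof -
    have "mono (\<lambda>r. - W r)" using W_anti by (intro monoI) simp
    then have "(\<lambda>r. - W r) \<in> borel_measurable borel" by (rule borel_measurable_mono)
    from borel_measurable_uminus[OF this] show ?thesis by simp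
  qed
  define E where "E = {r. 2 \<le> r \<and> h r \<le> sqrt (W r)}"
  have E [measurable]: "E \<in> sets borel" unfolding E_def by measurable
  have lower: "1 - ln 2 / ln r - sqrt (W r) \<le> 1 / ln r * (LINT t:E \<inter> {1..r}|lebesgue. 1 / t)"
    and upper: "1 / ln r * (LINT t:E \<inter> {1..r}|lebesgue. 1 / t) \<le> 1" if r: "r > 2" for r
  proof -
    have lr: "ln r > 0" using r by simp
    have L: "(LINT t:E \<inter> {1..r}|lebesgue. 1 / t) = (LINT t|lborel. indicator {1..r} t * (1 / t) * indicator E t)"
      unfolding set_lebesgue_integral_def
      by (subst integral_completion) (auto intro!: Bochner_Integration.integral_cong simp: indicator_def)
    have iE: "integrable lborel (\<lambda>t. indicator {1..r} t * (1 / t) * indicator E t)"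
      by (intro i2) (auto simp: indicator_def)
    have ih: "integrable lborel (\<lambda>t. indicator {1..r} t * (1 / t) * h t)"
      by (intro i2 h h01)
    have "(LINT t|lborel. indicator {1..r} t * (1 / t) * indicator E t) \<le> (LINT t|lborel. indicator {1..r} t * (1 / t))"
      by (intro integral_mono i1 iE) (auto simp: indicator_def)
    then show "1 / ln r * (LINT t:E \<inter> {1..r}|lebesgue. 1 / t) \<le> 1"
      unfolding L using I1[of r] r lr by simp
    define w where "w = sqrt (W r)"
    have w: "w > 0" "w * w = W r" using W_pos[of r] by (auto simp: w_def)
    have i12: "integrable lborel (\<lambda>t. indicator {1..2} t * (1 / t :: real))" by (rule i1)
    \<comment> \<open>Chebyshev: for t in [2, r] outside E the quotient h t / w exceeds 1, because w
      = sqrt (W r) \<le> sqrt (W t) < h t. The range up to 2 costs ln 2.\<close>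
    have "(LINT t|lborel. indicator {1..r} t * (1 / t)) \<le>
        (LINT t|lborel. indicator {1..r} t * (1 / t) * indicator E t + (indicator {1..2} t * (1 / t) + indicator {1..r} t * (1 / t) * h t * (1 / w)))"
    proof (intro integral_mono i1 Bochner_Integration.integrable_add iE i12 integrable_mult_left ih)
      fix t
      show "indicator {1..r} t * (1 / t) \<le> indicator {1..r} t * (1 / t) * indicator E t + (indicator {1..2} t * (1 / t) + indicator {1..r} t * (1 / t) * h t * (1 / w))"
      proof (cases "t \<in> {2..r} \<and> t \<notin> E")
        case True
        then have "sqrt (W t) < h t" by (auto simp: E_def)
        moreover have "w \<le> sqrt (W t)" unfolding w_def using True by (intro real_sqrt_le_mono W_anti) auto
        ultimately have "1 \<le> h t * (1 / w)" using w by (simp add: field_simps)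
        then have "1 / t * 1 \<le> 1 / t * (h t * (1 / w))" using True by (intro mult_left_mono) auto
        then show ?thesis using True by (auto simp: indicator_def)
      next
        case False
        then show ?thesis using h01(1)[of t] w by (auto simp: indicator_def)
      qed
    qed
    also have "\<dots> = (LINT t|lborel. indicator {1..r} t * (1 / t) * indicator E t) +
        ((LINT t|lborel. indicator {1..2} t * (1 / t)) + (LINT t|lborel. indicator {1..r} t * (1 / t) * h t) * (1 / w))"
      using iE i12 ih by (simp add: Bochner_Integration.integral_add Bochner_Integration.integrable_add integrable_mult_left del: times_divide_eq_right mult_1_right)
    also have "(LINT t|lborel. indicator {1..2} t * (1 / t)) = ln (2::real)" by (rule I1) simp
    also have "(LINT t|lborel. indicator {1..r} t * (1 / t) * h t) = Q r * ln r"
      using lr unfolding Q_def heq by simp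
    also have "(LINT t|lborel. indicator {1..r} t * (1 / t)) = ln r" by (rule I1) (use r in simp)
    finally have "ln r \<le> (LINT t:E \<inter> {1..r}|lebesgue. 1 / t) + (ln 2 + Q r * ln r * (1 / w))" unfolding L .
    \<comment> \<open>Q r is at most W r = w * w, so one factor w survives the division.\<close>
    moreover have "Q r * ln r * (1 / w) \<le> w * ln r"
    proof -
      have "Q r * ln r * (1 / w) \<le> (w * w) * ln r * (1 / w)"
        using Q_le[of r] r lr w by (intro mult_right_mono) auto
      also have "\<dots> = w * ln r" using w(1) by simp
      finally show ?thesis .
    qed
    ultimately have "ln r - ln 2 - w * ln r \<le> (LINT t:E \<inter> {1..r}|lebesgue. 1 / t)" by linarith
    then have "(ln r - ln 2 - w * ln r) / ln r \<le> (LINT t:E \<inter> {1..r}|lebesgue. 1 / t) / ln r"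
      using lr by (intro divide_right_mono) auto
    then show "1 - ln 2 / ln r - sqrt (W r) \<le> 1 / ln r * (LINT t:E \<inter> {1..r}|lebesgue. 1 / t)"
      using lr by (simp add: diff_divide_distrib w_def)
  qed
  show thesis
  proof (rule that[of E])
    show "log_density_one E"
      unfolding log_density_one_def
    proof (intro conjI)
      show "E \<subseteq> {1..}" by (auto simp: E_def)
      show "E \<in> sets lebesgue" using E by simp
      show "((\<lambda>r. 1 / ln r * (LINT t:E \<inter> {1..r}|lebesgue. 1 / t)) \<longlongrightarrow> 1) at_top"
      proof (rule tendsto_sandwich)
        have "((\<lambda>r. 1 - ln 2 / ln r - sqrt (W r)) \<longlongrightarrow> 1 - 0 - sqrt 0) at_top"
          by (intro tendsto_diff tendsto_const tendsto_real_sqrt W_lim tendsto_divide_0[OF tendsto_const] filterlim_at_top_imp_at_infinity ln_at_top)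
        then show "((\<lambda>r. 1 - ln 2 / ln r - sqrt (W r)) \<longlongrightarrow> 1) at_top" by simp
        show "\<forall>\<^sub>F r in at_top. 1 - ln 2 / ln r - sqrt (W r) \<le> 1 / ln r * (LINT t:E \<inter> {1..r}|lebesgue. 1 / t)"
          using eventually_gt_at_top[of 2] by eventually_elim (rule lower)
        show "\<forall>\<^sub>F r in at_top. 1 / ln r * (LINT t:E \<inter> {1..r}|lebesgue. 1 / t) \<le> (1::real)"
          using eventually_gt_at_top[of 2] by eventually_elim (rule upper)
      qed simp
    qed
    fix e :: real assume e: "e > 0"
    have "((\<lambda>r. sqrt (W r)) \<longlongrightarrow> sqrt 0) at_top" by (intro tendsto_real_sqrt W_lim)
    from order_tendstoD(2)[OF this, of e] e obtain r0 where r0: "\<And>r. r \<ge> r0 \<Longrightarrow> sqrt (W r) < e"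
      unfolding eventually_at_top_linorder by auto
    have "h r \<le> e" if "r \<in> E" "r \<ge> r0" for r
      using that r0[of r] by (auto simp: E_def)
    then show "\<exists>r0. \<forall>r\<in>E. r \<ge> r0 \<longrightarrow> h r \<le> e" by blast
  qed
qed

text \<open>On dyadic blocks, \<open>min 1 ((a - b) / b) \<le> 2 * ln (a / b)\<close> makes the block
  estimates telescope, so that zero order forces the logarithmic means to vanish.\<close>

lemma log_density_one_from_blocks:
  fixes G :: "real \<Rightarrow> ennreal" and \<psi> :: "real \<Rightarrow> real"
  assumes G [measurable]: "G \<in> borel_measurable borel"
    and mono: "\<And>r s. 1 \<le> r \<Longrightarrow> r \<le> s \<Longrightarrow> \<psi> r \<le> \<psi> s"
    and top: "filterlim \<psi> at_top at_top"
    and order: "\<And>e. e > 0 \<Longrightarrow> \<forall>\<^sub>F r in at_top. ln (\<psi> r) \<le> e * ln r"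
    and C: "C \<ge> 0"
    and blocks: "\<And>\<epsilon>. \<epsilon> > 0 \<Longrightarrow> \<exists>k j1. \<forall>j\<ge>j1.
      (\<integral>\<^sup>+ s. G s * ennreal (1 / s) * indicator {2 ^ j..2 ^ Suc j} s \<partial>lborel) \<le>
      ennreal (C * (\<epsilon> * (\<psi> (2 ^ (j + k)) + C) + (\<psi> (2 ^ (j + k)) - \<psi> (2 ^ (j - l)))))"
  obtains E where "log_density_one E"
    "\<And>e. e > 0 \<Longrightarrow> \<exists>r0. \<forall>r\<in>E. r \<ge> r0 \<longrightarrow> G r \<le> ennreal (e * \<psi> r)"
proof -
  \<comment> \<open>Constant below 1, so that monotonicity, and with it measurability, holds on the
    whole line.\<close>
  define \<psi>' where "\<psi>' s = \<psi> (max 1 s)" for s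
  have \<psi>'_mono: "mono \<psi>'" unfolding \<psi>'_def by (intro monoI mono) auto
  have [measurable]: "\<psi>' \<in> borel_measurable borel" by (rule borel_measurable_mono[OF \<psi>'_mono])
  \<comment> \<open>The truncation bounds each block integral by ln 2 and matches the minimum in
    \<open>min_one_le_ln\<close>.\<close>
  define hh where "hh s = min 1 (G s / ennreal (\<psi>' s))" for s
  define h where "h s = enn2real (hh s)" for s
  have [measurable]: "hh \<in> borel_measurable borel" unfolding hh_def by measurable
  have [measurable]: "h \<in> borel_measurable borel" unfolding h_def by measurable
  have hh1: "hh s \<le> 1" for s by (simp add: hh_def)
  then have hh_top: "hh s < top" for s by (rule order.strict_trans1) simp
  have hh: "ennreal (h s) = hh s" for s unfolding h_def using hh_top[of s] by simp
  have h01: "0 \<le> h s" "h s \<le> 1" for s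
    using enn2real_mono[OF hh1[of s]] by (auto simp: h_def)
  obtain r1 where r1: "\<And>r. r \<ge> r1 \<Longrightarrow> \<psi> r \<ge> max 1 C"
    using top unfolding filterlim_at_top eventually_at_top_linorder by meson
  define b where "b j = (\<integral>\<^sup>+ s. hh s * ennreal (1 / s) * indicator {2 ^ j..2 ^ Suc j} s \<partial>lborel)" for j :: nat
  have b1: "b j \<le> 1" for j
  proof -
    have "b j \<le> (\<integral>\<^sup>+ s. ennreal (1 / s) * indicator {2 ^ j..2 ^ Suc j} s \<partial>lborel)"
      unfolding b_def using mult_right_mono[OF hh1]
      by (intro nn_integral_mono mult_right_mono) (auto simp: mult_1)
    also have "\<dots> = ennreal (ln (2 ^ Suc j) - ln (2 ^ j))"
      by (rule nn_integral_one_over) auto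
    also have "ln (2 ^ Suc j) - ln (2 ^ j) = ln (2::real)" by (simp add: ln_mult)
    also have "ennreal (ln 2) \<le> 1" using ln_2_less_1 by simp
    finally show ?thesis .
  qed
  define \<beta> where "\<beta> j = enn2real (b j)" for j
  have "b j < top" for j using b1[of j] by (rule order.strict_trans1) simp
  then have \<beta>: "ennreal (\<beta> j) = b j" "0 \<le> \<beta> j" "\<beta> j \<le> 1" for j
    using enn2real_mono[OF b1[of j]] by (auto simp: \<beta>_def)
  have pow_ge: "\<exists>j0. \<forall>j\<ge>j0. R \<le> (2::real) ^ j" for R
  proof -
    obtain j0 :: nat where "R < 2 ^ j0" using real_arch_pow[of 2 R] by auto
    then show ?thesis by (meson less_imp_le one_le_numeral order_trans power_increasing)
  qed
  \<comment> \<open>Each late block is at most \<epsilon> plus a multiple of the increment of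
    \<open>ln \<psi>\<close> over a fixed number of blocks. After telescoping a fixed number of
    values near J remains, all bounded by one later value; D accounts for the early blocks.\<close>
  have key: "\<exists>D (d::nat) k. \<forall>J. (\<Sum>j<J. \<beta> j) \<le> D + \<epsilon> * J + (\<Sum>i<d. 4 * (C + 1) * max 0 (ln (\<psi> (2 ^ (J + k)))))"
    if \<epsilon>: "\<epsilon> > 0" for \<epsilon> :: real
  proof -
    define \<epsilon>' where "\<epsilon>' = min 1 (\<epsilon> / (2 * (C + 1)))"
    have \<epsilon>': "0 < \<epsilon>'" "\<epsilon>' \<le> 1" "2 * C * \<epsilon>' \<le> \<epsilon>"
    proof -
      show "0 < \<epsilon>'" "\<epsilon>' \<le> 1" using \<epsilon> C by (auto simp: \<epsilon>'_def)
      have "2 * C * \<epsilon>' \<le> 2 * C * (\<epsilon> / (2 * (C + 1)))" using C by (intro mult_left_mono) (auto simp: \<epsilon>'_def)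
      also have "\<dots> = \<epsilon> * (C / (C + 1))" using C by (simp add: field_simps)
      also have "\<dots> \<le> \<epsilon> * 1" using C \<epsilon> by (intro mult_left_mono) auto
      finally show "2 * C * \<epsilon>' \<le> \<epsilon>" by simp
    qed
    obtain k j1 where kj: "\<And>j. j \<ge> j1 \<Longrightarrow>
      (\<integral>\<^sup>+ s. G s * ennreal (1 / s) * indicator {2 ^ j..2 ^ Suc j} s \<partial>lborel) \<le>
      ennreal (C * (\<epsilon>' * (\<psi> (2 ^ (j + k)) + C) + (\<psi> (2 ^ (j + k)) - \<psi> (2 ^ (j - l)))))"
      using blocks[OF \<epsilon>'(1)] by blast
    obtain j2 where j2: "\<And>j. j \<ge> j2 \<Longrightarrow> max 1 r1 \<le> (2::real) ^ j" using pow_ge by blast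
    \<comment> \<open>From here on the block estimate holds, and \<psi> is at least 1 and at least C
      already at 2 ^ (j - l).\<close>
    define j0 where "j0 = l + max j1 j2"
    define A where "A i = ln (\<psi> (2 ^ (i - l)))" for i
    have A: "A i \<ge> 0" if "i \<ge> j0" for i
      using r1[of "2 ^ (i - l)"] j2[of "i - l"] that by (simp add: A_def j0_def)
    have step: "\<beta> j \<le> \<epsilon> + 4 * (C + 1) * (A (j + (k + l)) - A j)" if j: "j \<ge> j0" for j
    proof -
      define p q where "p = \<psi> (2 ^ (j + k))" and "q = \<psi> (2 ^ (j - l))"
      have r: "max 1 r1 \<le> (2::real) ^ (j - l)" "j \<ge> j1" using j j2[of "j - l"] by (auto simp: j0_def)
      have q: "q \<ge> 1" "q \<ge> C" using r1[of "2 ^ (j - l)"] r by (auto simp: q_def)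
      have pq: "q \<le> p" unfolding p_def q_def using r by (intro mono power_increasing) auto
      have "b j \<le> (\<integral>\<^sup>+ s. ennreal (1 / q) * (G s * ennreal (1 / s) * indicator {2 ^ j..2 ^ Suc j} s) \<partial>lborel)"
        unfolding b_def
      proof (rule nn_integral_mono)
        fix s :: real
        have "hh s \<le> G s * ennreal (1 / q)" if s: "2 ^ j \<le> s"
        proof -
          have "(2::real) ^ (j - l) \<le> s" by (rule order_trans[OF power_increasing s]) auto
          then have "q \<le> \<psi>' s" unfolding q_def \<psi>'_def using r s by (intro mono) auto
          then have "G s * ennreal (1 / \<psi>' s) \<le> G s * ennreal (1 / q)"
            using q by (intro mult_left_mono ennreal_leI divide_left_mono) auto
          moreover have "G s / ennreal (\<psi>' s) = G s * ennreal (1 / \<psi>' s)"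
            using q \<open>q \<le> \<psi>' s\<close> by (simp add: divide_ennreal_def inverse_ennreal inverse_eq_divide)
          ultimately show ?thesis by (simp add: hh_def min.coboundedI2)
        qed
        then have "hh s * (ennreal (1 / s) * indicator {2 ^ j..2 ^ Suc j} s) \<le> (G s * ennreal (1 / q)) * (ennreal (1 / s) * indicator {2 ^ j..2 ^ Suc j} s)"
          by (cases "2 ^ j \<le> s") (auto intro: mult_right_mono)
        then show "hh s * ennreal (1 / s) * indicator {2 ^ j..2 ^ Suc j} s \<le> ennreal (1 / q) * (G s * ennreal (1 / s) * indicator {2 ^ j..2 ^ Suc j} s)"
          by (simp only: mult_ac)
      qed
      also have "\<dots> = ennreal (1 / q) * (\<integral>\<^sup>+ s. G s * ennreal (1 / s) * indicator {2 ^ j..2 ^ Suc j} s \<partial>lborel)"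
        by (rule nn_integral_cmult) measurable
      also have "\<dots> \<le> ennreal (1 / q) * ennreal (C * (\<epsilon>' * (p + C) + (p - q)))"
        unfolding p_def q_def using kj[OF r(2)] by (intro mult_left_mono) auto
      also have "\<dots> = ennreal (1 / q * (C * (\<epsilon>' * (p + C) + (p - q))))"
        using q by (intro ennreal_mult'[symmetric]) auto
      finally have bl: "ennreal (\<beta> j) \<le> ennreal (1 / q * (C * (\<epsilon>' * (p + C) + (p - q))))" unfolding \<beta>(1) .
      \<comment> \<open>With p = q (1 + t) and C / q \<le> 1, the block bound divided by q reduces
        to \<epsilon> + 2 C t.\<close>
      define t where "t = p / q - 1"
      have t: "t \<ge> 0" "p = q * (1 + t)" using q pq by (auto simp: t_def field_simps)
      have "1 / q * (C * (\<epsilon>' * (p + C) + (p - q))) = C * (\<epsilon>' * (1 + t + C / q) + t)"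
        using q by (simp add: t(2) field_simps)
      also have "\<dots> \<le> C * (\<epsilon>' * (1 + t + 1) + t)"
        using q C \<epsilon>' by (intro mult_left_mono add_right_mono add_left_mono) auto
      also have "\<dots> = 2 * C * \<epsilon>' + C * (\<epsilon>' * t + t)" by (simp add: algebra_simps)
      also have "\<dots> \<le> \<epsilon> + C * (1 * t + t)"
        using \<epsilon>' C t by (intro add_mono mult_left_mono mult_right_mono) auto
      finally have X: "1 / q * (C * (\<epsilon>' * (p + C) + (p - q))) \<le> \<epsilon> + 2 * C * t" by simp
      have "0 \<le> \<epsilon> + 2 * C * t" using \<epsilon> C t by simp
      then have "\<beta> j \<le> \<epsilon> + 2 * C * t"
        using order_trans[OF bl ennreal_leI[OF X]] by (simp add: ennreal_le_iff)
      \<comment> \<open>For t > 1 the trivial bound \<beta> j \<le> 1 takes over, which the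
        truncation provides.\<close>
      then have "\<beta> j \<le> \<epsilon> + 2 * (C + 1) * min 1 t"
      proof (cases "t \<le> 1")
        case True
        then show ?thesis using \<open>\<beta> j \<le> \<epsilon> + 2 * C * t\<close> t by (simp add: algebra_simps)
      next
        case False
        then show ?thesis using \<beta>(3)[of j] \<epsilon> C by simp
      qed
      also have "\<dots> \<le> \<epsilon> + 2 * (C + 1) * (2 * ln (1 + t))"
        using C t by (intro add_left_mono mult_left_mono min_one_le_ln) auto
      also have "ln (1 + t) = ln p - ln q"
        using q t pq by (simp add: t(2) ln_mult)
      also have "2 * (C + 1) * (2 * (ln p - ln q)) = 4 * (C + 1) * (ln p - ln q)" by (simp add: algebra_simps)
      finally show ?thesis unfolding A_def p_def q_def by simp
    qed
    have "(\<Sum>j<J. \<beta> j) \<le> real j0 + \<epsilon> * J + (\<Sum>i<k + l. 4 * (C + 1) * max 0 (ln (\<psi> (2 ^ (J + (j0 + k))))))" for J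
    proof (cases "J \<le> j0")
      case True
      have "(\<Sum>j<J. \<beta> j) \<le> (\<Sum>j<J. 1)" by (intro sum_mono \<beta>)
      also have "\<dots> \<le> real j0" using True by simp
      also have "\<dots> \<le> real j0 + \<epsilon> * J + (\<Sum>i<k + l. 4 * (C + 1) * max 0 (ln (\<psi> (2 ^ (J + (j0 + k))))))"
        using \<epsilon> C by (simp add: add_nonneg_nonneg)
      finally show ?thesis .
    next
      case False
      then have J: "j0 \<le> J" by simp
      have "(\<Sum>j<J. \<beta> j) = (\<Sum>j<j0. \<beta> j) + (\<Sum>j=j0..<J. \<beta> j)"
        using J by (simp add: lessThan_atLeast0 sum.atLeastLessThan_concat)
      also have "\<dots> \<le> (\<Sum>j<j0. 1) + (\<Sum>j=j0..<J. \<epsilon> + 4 * (C + 1) * (A (j + (k + l)) - A j))"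
        by (intro add_mono sum_mono \<beta> step) auto
      also have "\<dots> = real j0 + \<epsilon> * (real J - real j0) + 4 * (C + 1) * (\<Sum>j=j0..<J. A (j + (k + l)) - A j)"
        using J by (simp add: sum.distrib sum_distrib_left of_nat_diff mult.commute)
      also have "\<dots> \<le> real j0 + \<epsilon> * J + 4 * (C + 1) * (\<Sum>i<k + l. A (J + i))"
        using \<epsilon> C J A by (intro add_mono mult_left_mono sum_shift_diff_le) auto
      also have "4 * (C + 1) * (\<Sum>i<k + l. A (J + i)) = (\<Sum>i<k + l. 4 * (C + 1) * A (J + i))"
        by (simp add: sum_distrib_left)
      also have "\<dots> \<le> (\<Sum>i<k + l. 4 * (C + 1) * max 0 (ln (\<psi> (2 ^ (J + (j0 + k))))))"
      proof (intro sum_mono mult_left_mono)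
        fix i assume i: "i \<in> {..<k + l}"
        have Jl: "l \<le> J" "j2 \<le> J + i - l" using J by (auto simp: j0_def)
        have r: "max 1 r1 \<le> (2::real) ^ (J + i - l)" by (rule j2) (rule Jl)
        have "\<psi> (2 ^ (J + i - l)) \<ge> 1" using r1[of "2 ^ (J + i - l)"] r by auto
        moreover have "\<psi> (2 ^ (J + i - l)) \<le> \<psi> (2 ^ (J + (j0 + k)))"
          using r i Jl by (intro mono power_increasing) (auto simp: j0_def)
        ultimately have "A (J + i) \<le> ln (\<psi> (2 ^ (J + (j0 + k))))"
          unfolding A_def by (intro ln_mono) auto
        then show "A (J + i) \<le> max 0 (ln (\<psi> (2 ^ (J + (j0 + k)))))" by simp
      qed (use C in auto)
      finally show ?thesis by simp
    qed
    note bound = this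
    show ?thesis
      by (rule exI[of _ "real j0"], rule exI[of _ "k + l"], rule exI[of _ "j0 + k"], rule allI, rule bound)
  qed
  have mean_nat: "(\<lambda>J. (\<Sum>j<J. \<beta> j) / real J) \<longlonglongrightarrow> 0"
  proof (rule tendstoI)
    fix e :: real assume e: "e > 0"
    obtain D k and d :: nat where D: "\<And>J. (\<Sum>j<J. \<beta> j) \<le> D + e / 4 * J + (\<Sum>i<d. 4 * (C + 1) * max 0 (ln (\<psi> (2 ^ (J + k)))))"
      using key[of "e / 4"] e by auto
    \<comment> \<open>The 1 keeps M positive when d = 0. The slope e / (8 M) used below leaves e / 4
      per block, since ln (2 ^ (J + k)) \<le> 2 J once J exceeds k.\<close>
    define M where "M = real d * (4 * (C + 1)) + 1"
    have M: "M > 0" using C by (simp add: M_def add_nonneg_pos)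
    have "filterlim (\<lambda>J. (2::real) ^ (J + k)) at_top sequentially"
      unfolding filterlim_at_top eventually_sequentially
    proof
      fix Z :: real
      obtain j0 where "\<And>j. j \<ge> j0 \<Longrightarrow> Z \<le> 2 ^ j" using pow_ge by blast
      then show "\<exists>N. \<forall>n\<ge>N. Z \<le> 2 ^ (n + k)" by (intro exI[of _ j0]) auto
    qed
    note lim_pow = this
    have "e / (8 * M) > 0" using e M by simp
    then have ev: "\<forall>\<^sub>F J in sequentially. ln (\<psi> (2 ^ (J + k))) \<le> e / (8 * M) * ln (2 ^ (J + k))"
      by (rule eventually_compose_filterlim[OF order lim_pow])
    have lim: "(\<lambda>J. \<bar>D\<bar> / real J) \<longlonglongrightarrow> 0" by (rule lim_const_over_n)
    have "\<forall>\<^sub>F J in sequentially. \<bar>D\<bar> / real J < e / 4"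
      using order_tendstoD(2)[OF lim, of "e / 4"] e by simp
    with ev eventually_gt_at_top[of "max 1 k"] show "\<forall>\<^sub>F J in sequentially. dist ((\<Sum>j<J. \<beta> j) / real J) 0 < e"
    proof eventually_elim
      case (elim J)
      have J: "real J > 0" using elim by simp
      have l2: "ln (2 ^ (J + k)) \<le> 2 * real J"
      proof -
        have "ln ((2::real) ^ (J + k)) = real (J + k) * ln 2" by (simp add: ln_realpow)
        also have "\<dots> \<le> real (J + k) * 1" using ln_2_less_1 by (intro mult_left_mono) auto
        also have "\<dots> \<le> 2 * real J" using elim by simp
        finally show ?thesis .
      qed
      have "ln (\<psi> (2 ^ (J + k))) \<le> e / (8 * M) * (2 * real J)"
        using elim(1) mult_left_mono[OF l2, of "e / (8 * M)"] e M by simp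
      then have "max 0 (ln (\<psi> (2 ^ (J + k)))) \<le> e / (8 * M) * (2 * real J)"
        using e M by simp
      then have "(\<Sum>i<d. 4 * (C + 1) * max 0 (ln (\<psi> (2 ^ (J + k))))) \<le> (\<Sum>i<d. 4 * (C + 1) * (e / (8 * M) * (2 * real J)))"
        using C by (intro sum_mono mult_left_mono) auto
      also have "\<dots> = (real d * (4 * (C + 1))) * (e / (8 * M) * (2 * real J))" by simp
      also have "\<dots> \<le> M * (e / (8 * M) * (2 * real J))"
        using e M by (intro mult_right_mono) (auto simp: M_def)
      also have "\<dots> = e / 4 * real J" using M by simp
      finally have "(\<Sum>j<J. \<beta> j) \<le> \<bar>D\<bar> + e / 4 * J + e / 4 * J" using D[of J] by linarith
      moreover have "\<bar>D\<bar> < e / 4 * J" using elim J by (simp add: field_simps)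
      ultimately have "(\<Sum>j<J. \<beta> j) < e * J" using mult_pos_pos[OF e J] by linarith
      moreover have "0 \<le> (\<Sum>j<J. \<beta> j)" by (intro sum_nonneg \<beta>)
      ultimately show ?case using J by (simp add: field_simps)
    qed
  qed
  have mean: "((\<lambda>r. (LINT t|lborel. indicator {1..r} t * (h t / t)) / ln r) \<longlongrightarrow> 0) at_top"
  proof (rule tendstoI)
    fix e :: real assume e: "e > 0"
    from tendstoD[OF mean_nat, of "e / 4"] e
    obtain J0 where J0: "\<And>J. J \<ge> J0 \<Longrightarrow> \<bar>(\<Sum>j<J. \<beta> j) / real J\<bar> < e / 4"
      unfolding eventually_sequentially by auto
    have "\<bar>(LINT t|lborel. indicator {1..r} t * (h t / t)) / ln r\<bar> < e" if r: "r > 2 ^ Suc J0" for r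
    proof -
      have "(1::real) \<le> 2 ^ J0" by simp
      then have r2: "r > 2" using r unfolding power_Suc by linarith
      \<comment> \<open>r lies in block J, so the integral up to r is at most the sum of the first
        Suc J blocks; Suc J \<le> 2 J and ln 2 \<ge> 1 / 2 then convert J into ln r.\<close>
      define J where "J = nat \<lfloor>log 2 r\<rfloor>"
      have lg: "log 2 r \<ge> Suc J0" using r by (intro le_log_of_power) auto
      have J: "real J \<le> log 2 r" "log 2 r < real (Suc J)" "J \<ge> Suc J0"
        using lg unfolding J_def by linarith+
      have rJ: "r < 2 ^ Suc J" 
        using J(2) r2 log_less_iff[of 2 r "real (Suc J)"] powr_realpow[of 2 "Suc J"] by (simp only:)
      have "(LINT t|lborel. indicator {1..r} t * (h t / t)) = enn2real (\<integral>\<^sup>+ t. ennreal (indicator {1..r} t * (h t / t)) \<partial>lborel)"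
        using h01 by (intro integral_eq_nn_integral) (auto simp: indicator_def)
      also have "\<dots> \<le> (\<Sum>j<Suc J. \<beta> j)"
      proof (rule enn2real_leI)
        have "(\<integral>\<^sup>+ t. ennreal (indicator {1..r} t * (h t / t)) \<partial>lborel) \<le> (\<integral>\<^sup>+ t. (\<Sum>j<Suc J. hh t * ennreal (1 / t) * indicator {2 ^ j..2 ^ Suc j} t) \<partial>lborel)"
        proof (rule nn_integral_mono)
          fix t :: real
          show "ennreal (indicator {1..r} t * (h t / t)) \<le> (\<Sum>j<Suc J. hh t * ennreal (1 / t) * indicator {2 ^ j..2 ^ Suc j} t)"
          proof (cases "t \<in> {1..r}")
            case True
            define i where "i = nat \<lfloor>log 2 t\<rfloor>"
            have lt: "log 2 t \<ge> 0" using True by simp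
            have i: "real i \<le> log 2 t" "log 2 t < real (Suc i)"
              using lt unfolding i_def by linarith+
            have t0: "t > 0" using True by simp
            have "2 powr real i \<le> t" by (rule iffD1[OF le_log_iff]) (use t0 i in auto)
            then have i1: "2 ^ i \<le> t" by (simp add: powr_realpow)
            have "t < 2 powr real (Suc i)" by (rule iffD1[OF log_less_iff]) (use t0 i in auto)
            then have i2: "t < 2 ^ Suc i" using powr_realpow[of 2 "Suc i"] by simp
            have "(2::real) ^ i < 2 ^ Suc J" using i1 True rJ by auto
            then have iJ: "i < Suc J" by (rule power_less_imp_less_exp[rotated]) simp
            have "ennreal (indicator {1..r} t * (h t / t)) = hh t * ennreal (1 / t) * indicator {2 ^ i..2 ^ Suc i} t"
              using True i1 i2 h01[of t] by (simp add: hh[symmetric] ennreal_mult[symmetric])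
            also have "\<dots> \<le> (\<Sum>j<Suc J. hh t * ennreal (1 / t) * indicator {2 ^ j..2 ^ Suc j} t)"
              using iJ by (intro member_le_sum) auto
            finally show ?thesis .
          qed simp
        qed
        also have "\<dots> = (\<Sum>j<Suc J. b j)"
          unfolding b_def by (intro nn_integral_sum) measurable
        also have "\<dots> = ennreal (\<Sum>j<Suc J. \<beta> j)"
          unfolding \<beta>(1)[symmetric] by (intro sum_ennreal \<beta>)
        finally show "(\<integral>\<^sup>+ t. ennreal (indicator {1..r} t * (h t / t)) \<partial>lborel) \<le> ennreal (\<Sum>j<Suc J. \<beta> j)" .
      qed (intro sum_nonneg \<beta>)
      also have "\<dots> < e / 4 * real (Suc J)"
        using J0[of "Suc J"] J by (simp add: field_simps abs_less_iff del: sum.lessThan_Suc)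
      also have "\<dots> \<le> e / 4 * (2 * real J)" using e J by (intro mult_left_mono) auto
      also have "\<dots> \<le> e * ln r"
      proof -
        have "1 / 2 \<le> ln (2::real)" using min_one_le_ln[of 1] by simp
        then have "real J * (1 / 2) \<le> log 2 r * ln 2" using J by (intro mult_mono) auto
        also have "log 2 r * ln 2 = ln r" by (simp add: log_def)
        finally show ?thesis using e by (simp add: field_simps)
      qed
      finally have "(LINT t|lborel. indicator {1..r} t * (h t / t)) < e * ln r" .
      moreover have "0 \<le> (LINT t|lborel. indicator {1..r} t * (h t / t))"
        using h01 by (intro integral_nonneg_AE AE_I2) (auto simp: indicator_def)
      ultimately show ?thesis using r2 by (simp add: field_simps)
    qed
    then show "\<forall>\<^sub>F r in at_top. dist ((LINT t|lborel. indicator {1..r} t * (h t / t)) / ln r) 0 < e"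
      by (intro eventually_mono[OF eventually_gt_at_top[of "2 ^ Suc J0"]]) simp
  qed
  obtain E where E: "log_density_one E" "\<And>e. e > 0 \<Longrightarrow> \<exists>r0. \<forall>r\<in>E. r \<ge> r0 \<longrightarrow> h r \<le> e"
    by (rule log_density_one_from_mean[of h]) (use h01 mean in auto)
  show thesis
  proof (rule that[OF E(1)])
    fix e :: real assume e: "e > 0"
    \<comment> \<open>1 / 2 is below the truncation level 1, so a value of \<open>h r\<close> this
      small is the true quotient of G r by \<psi> r.\<close>
    obtain r0 where r0: "\<And>r. r \<in> E \<Longrightarrow> r \<ge> r0 \<Longrightarrow> h r \<le> min e (1 / 2)"
      using E(2)[of "min e (1 / 2)"] e by auto
    have "G r \<le> ennreal (e * \<psi> r)" if r: "r \<in> E" "r \<ge> max r0 (max 1 r1)" for r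
    proof -
      have \<psi>: "\<psi>' r = \<psi> r" "\<psi> r \<ge> 1" using r r1[of r] by (auto simp: \<psi>'_def)
      have "h r \<le> min e (1 / 2)" using r by (intro r0) auto
      then have "hh r \<le> ennreal (min e (1 / 2))" unfolding hh[symmetric] by (rule ennreal_leI)
      moreover have "ennreal (min e (1 / 2)) < 1" by (simp add: min_def)
      ultimately have "G r / ennreal (\<psi> r) \<le> ennreal (min e (1 / 2))"
        unfolding hh_def \<psi> by (auto simp: min_def split: if_splits)
      also have "\<dots> \<le> ennreal e" by (intro ennreal_leI) simp
      finally have "G r / ennreal (\<psi> r) * ennreal (\<psi> r) \<le> ennreal e * ennreal (\<psi> r)" by (rule mult_right_mono) simp
      moreover have "G r / ennreal (\<psi> r) * ennreal (\<psi> r) = G r"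
        using \<psi> by (simp add: ennreal_divide_times)
      ultimately show ?thesis using e \<psi> by (simp add: ennreal_mult)
    qed
    then show "\<exists>r0. \<forall>r\<in>E. r \<ge> r0 \<longrightarrow> G r \<le> ennreal (e * \<psi> r)" by blast
  qed
qed

section \<open>Meromorphic functions as quotients\<close>

lemma entire_Cm_zero: "entire_Cm (\<lambda>z. 0)"
  unfolding holomorphic_Cm_def by (auto intro!: exI[of _ "\<lambda>_. 0"])

text \<open>\<open>nonzero1\<close> excludes f = 0, so that log |f| is finite almost everywhere. The
  sublocales \<open>A0\<close>, \<open>A1\<close> and \<open>U\<close> carry log |f0|, log |f1| and
  the logarithm of the norm.\<close>

locale meromorphic_pair =
  fixes f0 f1 :: "complex ^ 'm::finite \<Rightarrow> complex"
  assumes entire0: "entire_Cm f0" and entire1: "entire_Cm f1"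
    and nonzero0: "\<exists>z. f0 z \<noteq> 0" and nonzero1: "\<exists>z. f1 z \<noteq> 0"

sublocale meromorphic_pair \<subseteq> A0: entire_pair f0 "\<lambda>_. 0"
  by unfold_locales (rule entire0 entire_Cm_zero)+

sublocale meromorphic_pair \<subseteq> A1: entire_pair f1 "\<lambda>_. 0"
  by unfold_locales (rule entire1 entire_Cm_zero)+

sublocale meromorphic_pair \<subseteq> U: entire_pair f0 f1
  by unfold_locales (rule entire0 entire1)+

sublocale meromorphic_pair \<subseteq> A0: nonzero_entire_pair f0 "\<lambda>_. 0"
  by unfold_locales (use nonzero0 in \<open>auto simp: A0.nsq_def\<close>)

sublocale meromorphic_pair \<subseteq> A1: nonzero_entire_pair f1 "\<lambda>_. 0"
  by unfold_locales (use nonzero1 in \<open>auto simp: A1.nsq_def\<close>)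

sublocale meromorphic_pair \<subseteq> U: nonzero_entire_pair f0 f1
  by unfold_locales (use nonzero0 in \<open>auto simp: U.nsq_def add_nonneg_eq_0_iff\<close>)

context meromorphic_pair
begin

lemma nsq_eq_0: "A0.nsq z = 0 \<longleftrightarrow> f0 z = 0" "A1.nsq z = 0 \<longleftrightarrow> f1 z = 0"
  by (simp_all add: A0.nsq_def A1.nsq_def)

lemma half_ln_square: "ln (x\<^sup>2) / 2 = ln \<bar>x :: real\<bar>"
proof (cases "x = 0")
  case False
  then have "ln (\<bar>x\<bar> ^ 2) = 2 * ln \<bar>x\<bar>" by (subst ln_realpow) auto
  then show ?thesis by simp
qed simp

lemma ulog_eq: "A0.ulog z = ln (cmod (f0 z))" "A1.ulog z = ln (cmod (f1 z))"
  using half_ln_square[of "cmod (f0 z)"] half_ln_square[of "cmod (f1 z)"]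
  by (simp_all add: A0.ulog_def A0.nsq_def A1.ulog_def A1.nsq_def)

lemma ulog_norm_eq: "U.ulog z = ln (sqrt ((cmod (f0 z))\<^sup>2 + (cmod (f1 z))\<^sup>2))"
proof -
  define y where "y = (cmod (f0 z))\<^sup>2 + (cmod (f1 z))\<^sup>2"
  have y: "y \<ge> 0" by (simp add: y_def)
  have "ln y / 2 = ln (sqrt y)" using half_ln_square[of "sqrt y"] y by simp
  then show ?thesis by (simp add: U.ulog_def U.nsq_def y_def)
qed

text \<open>Almost everywhere this is log |f|.\<close>

definition Lquot :: "complex ^ 'm \<Rightarrow> real" where
  "Lquot z = A1.ulog z - A0.ulog z"

lemma Lquot_measurable [measurable]: "Lquot \<in> borel_measurable borel"
  unfolding Lquot_def by measurable

lemma ulog_le_norm: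
  shows "f0 z \<noteq> 0 \<Longrightarrow> A0.ulog z \<le> U.ulog z" "f1 z \<noteq> 0 \<Longrightarrow> A1.ulog z \<le> U.ulog z"
  unfolding A0.ulog_def A1.ulog_def U.ulog_def A0.nsq_def A1.nsq_def U.nsq_def
  by (intro divide_right_mono ln_mono; simp)+

lemma AE_nonzero: "AE z in lborel. f0 z \<noteq> 0 \<and> f1 z \<noteq> 0"
  using A0.AE_nsq_nonzero A1.AE_nsq_nonzero by eventually_elim (simp add: nsq_eq_0)

lemma AE_cone_nonzero: "s > 0 \<Longrightarrow> AE z in cone_measure s. f0 z \<noteq> 0 \<and> f1 z \<noteq> 0"
  using A0.AE_cone_nsq_nonzero[of s] A1.AE_cone_nsq_nonzero[of s]
  by (simp add: nsq_eq_0 AE_conj_iff)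

lemma Mean_le_norm:
  assumes s: "s > 0"
  shows "A0.Mean s \<le> U.Mean s" "A1.Mean s \<le> U.Mean s"
  unfolding A0.Mean_def A1.Mean_def U.Mean_def
  by (intro integral_mono_AE A0.integrable_ulog_cone_measure A1.integrable_ulog_cone_measure U.integrable_ulog_cone_measure s,
      use AE_cone_nonzero[OF s] in eventually_elim, use ulog_le_norm in blast)+

text \<open>The absolute value of log |f| is at most (log norm - log |f0|) + (log norm - log |f1|),
  both summands being nonnegative. On a shell the norm is estimated at the outer radius r, the other
  two at the inner radius s.\<close>

definition total :: "real \<Rightarrow> real \<Rightarrow> real" where
  "total r s = 2 * U.Mean r - A0.Mean s - A1.Mean s"

lemma total_mono:
  assumes "0 < s" "s \<le> s'" "0 < r'" "r' \<le> r"
  shows "total r' s' \<le> total r s"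
  using U.Mean_mono[of r' r] A0.Mean_mono[of s s'] A1.Mean_mono[of s s'] assms by (simp add: total_def)

lemma measure_shell:
  assumes "0 < \<alpha>" "\<alpha> \<le> \<beta>"
  shows "measure lborel {z :: complex ^ 'm. norm z \<in> {\<alpha>..\<beta>}} = unit_vol TYPE('m) * (\<beta> ^ (2 * CARD('m)) - \<alpha> ^ (2 * CARD('m)))"
proof -
  have eq: "{z :: complex ^ 'm. norm z \<in> {\<alpha>..\<beta>}} = cball 0 \<beta> - ball 0 \<alpha>" by auto
  have b: "measure lborel (ball (0 :: complex ^ 'm) \<alpha>) = unit_vol TYPE('m) * \<alpha> ^ (2 * CARD('m))"
    using assms measure_cball_Cm[of \<alpha> "0 :: complex ^ 'm"] by (simp add: content_ball content_cball)
  have "measure lborel (cball (0 :: complex ^ 'm) \<beta> - ball 0 \<alpha>) = measure lborel (cball (0 :: complex ^ 'm) \<beta>) - measure lborel (ball (0 :: complex ^ 'm) \<alpha>)"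
    using emeasure_lborel_cball_finite[of "0 :: complex ^ 'm" \<beta>] assms by (intro measure_Diff) auto
  then show ?thesis
    unfolding eq b using assms by (simp add: measure_cball_Cm right_diff_distrib)
qed

text \<open>The volume of the shell R - \<beta> \<le> |z| \<le> R + \<beta> relative to the ball of
  radius R; it is small when R is large compared with \<beta>.\<close>

definition shell_ratio :: "real \<Rightarrow> real \<Rightarrow> real" where
  "shell_ratio R \<beta> = ((R + \<beta>) ^ (2 * CARD('m)) - (R - \<beta>) ^ (2 * CARD('m))) / R ^ (2 * CARD('m))"

text \<open>The two balls differ only inside a thin shell, on which the integral of
  \<open>|log |f||\<close> is controlled by the characteristic function.\<close>

lemma avg_diff_le:
  assumes \<beta>: "0 < \<beta>" "\<beta> < R" and a: "norm a \<le> \<beta>" and b: "norm b \<le> \<beta>"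
  shows "\<bar>(A1.avg R a - A0.avg R a) - (A1.avg R b - A0.avg R b)\<bar> \<le>
    shell_ratio R \<beta> * (total (R + \<beta>) (R - \<beta>) / unit_vol TYPE('m))"
proof -
  define V where "V = unit_vol TYPE('m)"
  have V: "V > 0" by (simp add: V_def unit_vol_pos)
  define c where "c = V * R ^ (2 * CARD('m))"
  have c: "c > 0" using \<beta> V by (simp add: c_def)
  define S where "S = {z :: complex ^ 'm. norm z \<in> {R - \<beta>..R + \<beta>}}"
  have S [measurable]: "S \<in> sets borel" unfolding S_def by measurable
  have [measurable]: "cball a R \<in> sets borel" "cball b R \<in> sets borel" by simp_all
  have Ssub: "S \<subseteq> cball 0 (R + \<beta>)" by (auto simp: S_def)
  have iS: "integrable lborel (\<lambda>z. indicator S z * A0.ulog z)" "integrable lborel (\<lambda>z. indicator S z * A1.ulog z)"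
      "integrable lborel (\<lambda>z. indicator S z * U.ulog z)"
    using set_integrable_subset[OF A0.ulog_set_integrable _ Ssub] set_integrable_subset[OF A1.ulog_set_integrable _ Ssub]
      set_integrable_subset[OF U.ulog_set_integrable _ Ssub] S by (simp_all add: set_integrable_def)
  have ia: "integrable lborel (\<lambda>z. indicator (cball p R) z * Lquot z)" for p :: "complex ^ 'm"
    using A0.ulog_set_integrable_ball[of p R] A1.ulog_set_integrable_ball[of p R]
    by (simp add: set_integrable_def Lquot_def right_diff_distrib)
  have avg: "A1.avg R p - A0.avg R p = (LINT z|lborel. indicator (cball p R) z * Lquot z) / c" for p
    using A0.ulog_set_integrable_ball[of p R] A1.ulog_set_integrable_ball[of p R]
    by (simp add: A0.avg_def A1.avg_def Lquot_def set_lebesgue_integral_def set_integrable_def right_diff_distrib c_def V_def diff_divide_distrib)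
  have eq: "(A1.avg R a - A0.avg R a) - (A1.avg R b - A0.avg R b) =
      (LINT z|lborel. indicator (cball a R) z * Lquot z - indicator (cball b R) z * Lquot z) / c"
    unfolding avg by (simp add: ia diff_divide_distrib)
  \<comment> \<open>A ball of radius R whose centre has norm at most \<beta> contains all z with |z|
    < R - \<beta> and none with |z| > R + \<beta>, so outside the shell the two indicators
    cancel.\<close>
  have in_S: "\<bar>indicator (cball a R) z - indicator (cball b R) z\<bar> \<le> (indicator S z :: real)" for z
  proof -
    have "z \<in> cball p R \<longleftrightarrow> norm z < R - \<beta>" if "z \<notin> S" "norm p \<le> \<beta>" for p
      using that norm_triangle_sub[of z p] norm_triangle_ineq4[of p z] \<beta>
      by (auto simp: S_def dist_norm norm_minus_commute not_le)
    from this[OF _ a] this[OF _ b] show ?thesis by (cases "z \<in> S") (auto simp: indicator_def)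
  qed
  define X where "X = (LINT z|lborel. 2 * (indicator S z * U.ulog z) - indicator S z * A0.ulog z - indicator S z * A1.ulog z)"
  have iX: "integrable lborel (\<lambda>z. 2 * (indicator S z * U.ulog z) - indicator S z * A0.ulog z - indicator S z * A1.ulog z)"
    using iS by (intro Bochner_Integration.integrable_diff integrable_mult_right) auto
  have X_eq: "X = 2 * (LINT z:S|lborel. U.ulog z) - (LINT z:S|lborel. A0.ulog z) - (LINT z:S|lborel. A1.ulog z)"
    using iS unfolding X_def set_lebesgue_integral_def
    by (simp add: Bochner_Integration.integral_diff Bochner_Integration.integrable_diff)
  have "\<bar>LINT z|lborel. indicator (cball a R) z * Lquot z - indicator (cball b R) z * Lquot z\<bar> \<le>
      (LINT z|lborel. \<bar>indicator (cball a R) z * Lquot z - indicator (cball b R) z * Lquot z\<bar>)"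
    by (rule integral_abs_bound)
  also have "\<dots> \<le> X"
    unfolding X_def
  proof (rule integral_mono_AE)
    show "integrable lborel (\<lambda>z. \<bar>indicator (cball a R) z * Lquot z - indicator (cball b R) z * Lquot z\<bar>)"
      using ia by (intro integrable_abs Bochner_Integration.integrable_diff)
    show "AE z in lborel. \<bar>indicator (cball a R) z * Lquot z - indicator (cball b R) z * Lquot z\<bar> \<le>
        2 * (indicator S z * U.ulog z) - indicator S z * A0.ulog z - indicator S z * A1.ulog z"
      using AE_nonzero
    proof eventually_elim
      case (elim z)
      have "\<bar>indicator (cball a R) z * Lquot z - indicator (cball b R) z * Lquot z\<bar> =
          \<bar>indicator (cball a R) z - indicator (cball b R) z\<bar> * \<bar>Lquot z\<bar>"
        by (simp add: abs_mult[symmetric] left_diff_distrib)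
      also have "\<dots> \<le> indicator S z * (2 * U.ulog z - A0.ulog z - A1.ulog z)"
        using in_S[of z] ulog_le_norm[of z] elim by (intro mult_mono) (auto simp: Lquot_def)
      finally show ?case by (simp add: algebra_simps)
    qed
  qed (rule iX)
  finally have le: "\<bar>(A1.avg R a - A0.avg R a) - (A1.avg R b - A0.avg R b)\<bar> \<le> X / c"
    unfolding eq using c by (simp add: divide_right_mono)
  have mS: "measure lborel S = c * shell_ratio R \<beta>"
    unfolding S_def using measure_shell[of "R - \<beta>" "R + \<beta>"] \<beta> by (simp add: c_def V_def shell_ratio_def)
  have "V * X \<le> total (R + \<beta>) (R - \<beta>) * measure lborel S"
    using U.shell_integral_le[of "R - \<beta>" "R + \<beta>"] A0.shell_integral_ge[of "R - \<beta>" "R + \<beta>"]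
      A1.shell_integral_ge[of "R - \<beta>" "R + \<beta>"] \<beta>
    unfolding X_eq S_def[symmetric] V_def[symmetric] by (simp add: total_def algebra_simps)
  then have "X \<le> (total (R + \<beta>) (R - \<beta>) * (c * shell_ratio R \<beta>)) / V"
    unfolding mS using V by (simp add: pos_le_divide_eq mult.commute)
  then have "X / c \<le> (total (R + \<beta>) (R - \<beta>) * (c * shell_ratio R \<beta>)) / V / c"
    using c by (intro divide_right_mono) auto
  also have "\<dots> = shell_ratio R \<beta> * (total (R + \<beta>) (R - \<beta>) / V)" using c by simp
  finally show ?thesis using le unfolding V_def by (rule order_trans[rotated])
qed

text \<open>At z and at c + q z, log |f0| and log |f1| are compared with their ball averages there.
  The four errors are nonnegative and bounded by \<open>nn_integral_avg_minus_ulog\<close>, those at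
  c + q z after a change of variables with factor 1 / |q|^(2m); the averages of log |f| at the two
  points differ by at most D.\<close>

lemma shell_difference:
  assumes q: "q \<noteq> 0" and \<alpha>: "0 < \<alpha>" "\<alpha> \<le> r" and \<beta>: "2 * r \<le> \<beta>" "\<beta> < R"
    and sub: "\<And>z :: complex ^ 'm. norm z \<in> {r..2 * r} \<Longrightarrow> norm (c + q *s z) \<in> {\<alpha>..\<beta>}"
  shows "(\<integral>\<^sup>+ z. ennreal \<bar>Lquot (c + q *s z) - Lquot z\<bar> * indicator {r..2 * r} (norm z) \<partial>lborel) \<le>
    ennreal ((2 * r) ^ (2 * CARD('m)) * (shell_ratio R \<beta> * total (R + \<beta>) (R - \<beta>)) +
      (1 + 1 / cmod q ^ (2 * CARD('m))) * \<beta> ^ (2 * CARD('m)) *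
        ((A0.Mean (R + \<beta>) - A0.Mean \<alpha>) + (A1.Mean (R + \<beta>) - A1.Mean \<alpha>)))"
proof -
  let ?n = "2 * CARD('m)"
  define V where "V = unit_vol TYPE('m)"
  have V: "V > 0" by (simp add: V_def unit_vol_pos)
  have \<beta>0: "0 < \<beta>" "\<alpha> \<le> \<beta>" "0 < R" "0 < r" using \<alpha> \<beta> by auto
  define D where "D = shell_ratio R \<beta> * (total (R + \<beta>) (R - \<beta>) / V)"
  have D: "\<bar>(A1.avg R a - A0.avg R a) - (A1.avg R b - A0.avg R b)\<bar> \<le> D" if "norm a \<le> \<beta>" "norm b \<le> \<beta>" for a b
    unfolding D_def V_def using avg_diff_le[OF \<beta>0(1) \<beta>(2) that] .
  have D0: "0 \<le> D" using D[of 0 0] \<beta>0 by simp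
  define w where "w z = c + q *s z" for z :: "complex ^ 'm"
  have [measurable]: "w \<in> borel_measurable borel"
    unfolding w_def by (intro borel_measurable_continuous_onI continuous_intros)
  \<comment> \<open>Provides that f0 and f1 are nonzero at c + q z for almost every z.\<close>
  interpret B: meromorphic_pair "\<lambda>z. f0 (c + q *s z)" "\<lambda>z. f1 (c + q *s z)"
  proof
    have surj: "\<exists>z'. c + q *s z' = z" for z
      using q by (intro exI[of _ "inverse q *s (z - c)"]) (simp add: vector_smult_assoc)
    show "\<exists>z. f0 (c + q *s z) \<noteq> 0" "\<exists>z. f1 (c + q *s z) \<noteq> 0"
      using nonzero0 nonzero1 surj by metis+
  qed (rule entire_Cm_affine entire0 entire1)+
  define H0 where "H0 z = ennreal (A0.avg R z - A0.ulog z) * indicator {\<alpha>..\<beta>} (norm z)" for z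
  define H1 where "H1 z = ennreal (A1.avg R z - A1.ulog z) * indicator {\<alpha>..\<beta>} (norm z)" for z
  have [measurable]: "H0 \<in> borel_measurable borel" "H1 \<in> borel_measurable borel"
    unfolding H0_def H1_def by measurable
  define d0 where "d0 = A0.Mean (R + \<beta>) - A0.Mean \<alpha>"
  define d1 where "d1 = A1.Mean (R + \<beta>) - A1.Mean \<alpha>"
  have d: "d0 \<ge> 0" "d1 \<ge> 0"
    using A0.Mean_mono[of \<alpha> "R + \<beta>"] A1.Mean_mono[of \<alpha> "R + \<beta>"] \<alpha> \<beta> by (auto simp: d0_def d1_def)
  have I0: "(\<integral>\<^sup>+ z. H0 z \<partial>lborel) \<le> ennreal (\<beta> ^ ?n * d0)"
    unfolding H0_def d0_def by (rule A0.nn_integral_avg_minus_ulog) (use \<beta>0 \<alpha> in auto)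
  have I1: "(\<integral>\<^sup>+ z. H1 z \<partial>lborel) \<le> ennreal (\<beta> ^ ?n * d1)"
    unfolding H1_def d1_def by (rule A1.nn_integral_avg_minus_ulog) (use \<beta>0 \<alpha> in auto)
  have aff: "(\<integral>\<^sup>+ z. g (w z) \<partial>lborel) \<le> ennreal (1 / cmod q ^ ?n * t)"
    if "g \<in> borel_measurable borel" "(\<integral>\<^sup>+ z. g z \<partial>lborel) \<le> ennreal t" for g t
  proof -
    have "(\<integral>\<^sup>+ z. g (w z) \<partial>lborel) = ennreal (1 / cmod q ^ ?n) * (ennreal (cmod q ^ ?n) * (\<integral>\<^sup>+ z. g (w z) \<partial>lborel))"
      using q by (simp add: mult.assoc[symmetric] ennreal_mult[symmetric])
    also have "\<dots> = ennreal (1 / cmod q ^ ?n) * (\<integral>\<^sup>+ z. g z \<partial>lborel)"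
      unfolding w_def nn_integral_lborel_complex_affine[OF that(1) q, of c, symmetric] ..
    also have "\<dots> \<le> ennreal (1 / cmod q ^ ?n) * ennreal t" by (intro mult_left_mono that(2)) simp
    also have "\<dots> = ennreal (1 / cmod q ^ ?n * t)" by (rule ennreal_mult'[symmetric]) simp
    finally show ?thesis .
  qed
  have "(\<integral>\<^sup>+ z. ennreal \<bar>Lquot (c + q *s z) - Lquot z\<bar> * indicator {r..2 * r} (norm z) \<partial>lborel) \<le>
      (\<integral>\<^sup>+ z. ennreal D * indicator {r..2 * r} (norm z) + (H0 z + (H1 z + (H0 (w z) + H1 (w z)))) \<partial>lborel)"
  proof (intro nn_integral_mono_AE, use AE_nonzero B.AE_nonzero in eventually_elim)
    case (elim z)
    show ?case
    proof (cases "norm z \<in> {r..2 * r}")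
      case True
      have wz: "norm (w z) \<in> {\<alpha>..\<beta>}" unfolding w_def by (rule sub[OF True])
      have nz: "norm z \<in> {\<alpha>..\<beta>}" using True \<alpha> \<beta> by auto
      have h: "0 \<le> A0.avg R z - A0.ulog z" "0 \<le> A1.avg R z - A1.ulog z"
        "0 \<le> A0.avg R (w z) - A0.ulog (w z)" "0 \<le> A1.avg R (w z) - A1.ulog (w z)"
        using elim \<beta>0 A0.ulog_le_avg[of _ R] A1.ulog_le_avg[of _ R] by (auto simp: nsq_eq_0 w_def)
      have "\<bar>Lquot (w z) - Lquot z\<bar> \<le> D + ((A0.avg R z - A0.ulog z) + ((A1.avg R z - A1.ulog z) +
          ((A0.avg R (w z) - A0.ulog (w z)) + (A1.avg R (w z) - A1.ulog (w z)))))"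
        using D[of "w z" z] h wz nz unfolding Lquot_def by auto
      then have "ennreal \<bar>Lquot (w z) - Lquot z\<bar> \<le> ennreal (D + ((A0.avg R z - A0.ulog z) + ((A1.avg R z - A1.ulog z) +
          ((A0.avg R (w z) - A0.ulog (w z)) + (A1.avg R (w z) - A1.ulog (w z))))))"
        by (rule ennreal_leI)
      also have "\<dots> = ennreal D * indicator {r..2 * r} (norm z) + (H0 z + (H1 z + (H0 (w z) + H1 (w z))))"
        using h D0 True wz nz by (simp add: H0_def H1_def ennreal_plus)
      finally show ?thesis using True by (simp add: w_def)
    qed simp
  qed
  also have "\<dots> = ennreal D * (\<integral>\<^sup>+ z. indicator {r..2 * r} (norm (z :: complex ^ 'm)) \<partial>lborel) + ((\<integral>\<^sup>+ z. H0 z \<partial>lborel) +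
      ((\<integral>\<^sup>+ z. H1 z \<partial>lborel) + ((\<integral>\<^sup>+ z. H0 (w z) \<partial>lborel) + (\<integral>\<^sup>+ z. H1 (w z) \<partial>lborel))))"
    by (simp add: nn_integral_add nn_integral_cmult)
  also have "\<dots> \<le> ennreal D * ennreal (V * (2 * r) ^ ?n) + (ennreal (\<beta> ^ ?n * d0) + (ennreal (\<beta> ^ ?n * d1) +
      (ennreal (1 / cmod q ^ ?n * (\<beta> ^ ?n * d0)) + ennreal (1 / cmod q ^ ?n * (\<beta> ^ ?n * d1)))))"
  proof (intro add_mono mult_left_mono I0 I1 aff)
    have "(\<integral>\<^sup>+ z. indicator {r..2 * r} (norm (z :: complex ^ 'm)) \<partial>lborel) \<le> (\<integral>\<^sup>+ z. indicator (cball 0 (2 * r)) (z :: complex ^ 'm) \<partial>lborel)"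
      by (intro nn_integral_mono) (auto simp: indicator_def)
    then show "(\<integral>\<^sup>+ z. indicator {r..2 * r} (norm (z :: complex ^ 'm)) \<partial>lborel) \<le> ennreal (V * (2 * r) ^ ?n)"
      using emeasure_cball_Cm[of "2 * r" "0 :: complex ^ 'm"] \<beta>0 by (simp add: V_def)
  qed auto
  also have "\<dots> = ennreal (D * (V * (2 * r) ^ ?n) + (\<beta> ^ ?n * d0 + (\<beta> ^ ?n * d1 +
      (1 / cmod q ^ ?n * (\<beta> ^ ?n * d0) + 1 / cmod q ^ ?n * (\<beta> ^ ?n * d1)))))"
    using D0 V \<beta>0 d by (simp add: ennreal_plus ennreal_mult)
  also have "D * (V * (2 * r) ^ ?n) = (2 * r) ^ ?n * (shell_ratio R \<beta> * total (R + \<beta>) (R - \<beta>))"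
    using V by (simp add: D_def)
  also have "\<beta> ^ ?n * d0 + (\<beta> ^ ?n * d1 + (1 / cmod q ^ ?n * (\<beta> ^ ?n * d0) + 1 / cmod q ^ ?n * (\<beta> ^ ?n * d1))) =
      (1 + 1 / cmod q ^ ?n) * \<beta> ^ ?n * (d0 + d1)"
    by (simp add: algebra_simps add_divide_distrib)
  finally show ?thesis unfolding d0_def d1_def .
qed

section \<open>Estimates on dyadic blocks\<close>

text \<open>Increasing, nonnegative from 1 on, with increments dominating those of all three means,
  and bounded by the growth of \<open>U.Mean\<close> up to constants: this is the \<psi> of the
  block argument.\<close>

definition Psi :: "real \<Rightarrow> real" where
  "Psi r = (U.Mean r - U.Mean 1) + (A0.Mean r - A0.Mean 1) + (A1.Mean r - A1.Mean 1)"

lemma Psi_mono: "0 < r \<Longrightarrow> r \<le> s \<Longrightarrow> Psi r \<le> Psi s"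
  using U.Mean_mono[of r s] A0.Mean_mono[of r s] A1.Mean_mono[of r s] by (simp add: Psi_def)

lemma Psi_nonneg: "1 \<le> r \<Longrightarrow> 0 \<le> Psi r"
  using Psi_mono[of 1 r] by (simp add: Psi_def)

text \<open>The absolute value dominates the positive part that log^+ takes.\<close>

definition mean_diff :: "complex \<Rightarrow> complex ^ 'm \<Rightarrow> real \<Rightarrow> ennreal" where
  "mean_diff q c s = (\<integral>\<^sup>+ z. ennreal \<bar>Lquot (c + q *s z) - Lquot z\<bar> \<partial>cone_measure s)"

lemma Lquot_diff_measurable [measurable]:
  "(\<lambda>z. ennreal \<bar>Lquot (c + q *s z) - Lquot z\<bar>) \<in> borel_measurable borel"
proof -
  have [measurable]: "(\<lambda>z :: complex ^ 'm. c + q *s z) \<in> borel_measurable borel"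
    by (intro borel_measurable_continuous_onI continuous_intros)
  show ?thesis by measurable
qed

lemma mean_diff_measurable [measurable]: "mean_diff q c \<in> borel_measurable borel"
  unfolding mean_diff_def by measurable

text \<open>With n = 2 m, the polar weight s^(n-1) ds is at least r^n ds / s for s \<ge> r.\<close>

lemma mean_diff_block:
  fixes r :: real
  assumes r: "r > 0"
  shows "ennreal (2 * CARD('m) * r ^ (2 * CARD('m))) * (\<integral>\<^sup>+ s. mean_diff q c s * ennreal (1 / s) * indicator {r..2 * r} s \<partial>lborel) \<le>
    (\<integral>\<^sup>+ z. ennreal \<bar>Lquot (c + q *s z) - Lquot z\<bar> * indicator {r..2 * r} (norm z) \<partial>lborel)"
proof -
  let ?n = "2 * CARD('m)"
  have dim: "DIM(complex ^ 'm) = ?n" by simp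
  have n: "?n \<ge> 1" using zero_less_card_finite[where 'a = 'm] by linarith
  have "ennreal (?n * r ^ ?n) * (\<integral>\<^sup>+ s. mean_diff q c s * ennreal (1 / s) * indicator {r..2 * r} s \<partial>lborel) =
      (\<integral>\<^sup>+ s. ennreal (?n * r ^ ?n) * (mean_diff q c s * ennreal (1 / s) * indicator {r..2 * r} s) \<partial>lborel)"
    by (rule nn_integral_cmult[symmetric]) measurable
  also have "\<dots> \<le> (\<integral>\<^sup>+ s. ennreal (?n * s ^ (?n - 1)) * indicator {0<..} s * (indicator {r..2 * r} s * mean_diff q c s) \<partial>lborel)"
  proof (rule nn_integral_mono)
    fix s :: real
    show "ennreal (?n * r ^ ?n) * (mean_diff q c s * ennreal (1 / s) * indicator {r..2 * r} s) \<le>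
      ennreal (?n * s ^ (?n - 1)) * indicator {0<..} s * (indicator {r..2 * r} s * mean_diff q c s)"
    proof (cases "s \<in> {r..2 * r}")
      case True
      then have s: "s > 0" "r \<le> s" using r by auto
      have "?n * r ^ ?n * (1 / s) \<le> ?n * s ^ ?n * (1 / s)"
        using s r by (intro mult_right_mono mult_left_mono power_mono) auto
      also have "s ^ ?n = s * s ^ (?n - 1)" using n by (cases ?n) auto
      finally have "?n * r ^ ?n * (1 / s) \<le> ?n * s ^ (?n - 1)" using s by simp
      then have "ennreal (?n * r ^ ?n) * ennreal (1 / s) \<le> ennreal (?n * s ^ (?n - 1))"
        using s r by (subst ennreal_mult[symmetric]) (auto intro!: ennreal_leI)
      then have "(ennreal (?n * r ^ ?n) * ennreal (1 / s)) * mean_diff q c s \<le> ennreal (?n * s ^ (?n - 1)) * mean_diff q c s"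
        by (rule mult_right_mono) simp
      then show ?thesis using True s by (simp add: mult_ac)
    qed simp
  qed
  also have "\<dots> = (\<integral>\<^sup>+ z. ennreal \<bar>Lquot (c + q *s z) - Lquot z\<bar> * indicator {r..2 * r} (norm z) \<partial>lborel)"
    unfolding mean_diff_def dim[symmetric] by (rule nn_integral_polar_radial[symmetric]) measurable
  finally show ?thesis .
qed

text \<open>For r = 2 ^ j and |z| in [r, 2 r], both z and c + q z have norm between 2 ^ (j - l) and
  \<beta> = 2 ^ (j + p), once j is large. The averaging radius is 2 ^ i times \<beta>; only i
  depends on \<epsilon>, so that l and C do not.\<close>

lemma mean_diff_blocks:
  assumes q: "q \<noteq> 0"
  obtains C l where "C \<ge> 0" "\<And>\<epsilon>. \<epsilon> > 0 \<Longrightarrow> \<exists>k j1. \<forall>j\<ge>j1.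
      (\<integral>\<^sup>+ s. mean_diff q c s * ennreal (1 / s) * indicator {2 ^ j..2 ^ Suc j} s \<partial>lborel) \<le>
      ennreal (C * (\<epsilon> * (Psi (2 ^ (j + k)) + C) + (Psi (2 ^ (j + k)) - Psi (2 ^ (j - l)))))"
proof -
  let ?n = "2 * CARD('m)"
  have n: "real ?n \<ge> 1" using zero_less_card_finite[where 'a = 'm] by linarith
  \<comment> \<open>Below |q| / 2, half of |q| |z| is left to outweigh c in the lower bound for |c +
    q z|; below 1, also |z| stays above \<alpha>.\<close>
  obtain l :: nat where l: "(1 / 2) ^ l < min 1 (cmod q / 2)"
    using real_arch_pow_inv[of "min 1 (cmod q / 2)" "1 / 2"] q by auto
  \<comment> \<open>2 + 3 |q| covers both |z| \<le> 2 r and |c + q z| \<le> 2 |q| r + |q| r /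
    2.\<close>
  obtain p :: nat where p: "2 + 3 * cmod q < 2 ^ p" using real_arch_pow[of 2] by auto
  define K0 where "K0 = 2 * U.Mean 1 - A0.Mean 1 - A1.Mean 1"
  define Q where "Q = (1 + 1 / cmod q ^ ?n) * (2 ^ p) ^ ?n"
  have Q: "Q \<ge> 1"
  proof -
    have "1 * 1 \<le> Q" unfolding Q_def by (intro mult_mono one_le_power) auto
    then show ?thesis by simp
  qed
  define C where "C = \<bar>K0\<bar> + Q"
  have C: "C \<ge> 1" "Q \<le> C" "K0 \<le> C" using Q by (auto simp: C_def)
  show thesis
  proof (rule that[of C l])
    show "C \<ge> 0" using C by simp
    fix \<epsilon> :: real assume \<epsilon>: "\<epsilon> > 0"
    define \<delta> :: "nat \<Rightarrow> real" where "\<delta> i = (1 + (1 / 2) ^ i) ^ ?n - (1 - (1 / 2) ^ i) ^ ?n" for i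
    have "\<delta> \<longlonglongrightarrow> (1 + 0) ^ ?n - (1 - 0) ^ ?n"
      unfolding \<delta>_def by (intro tendsto_intros LIMSEQ_realpow_zero) auto
    then have "\<delta> \<longlonglongrightarrow> 0" by simp
    \<comment> \<open>The factor 2 ^ Suc n absorbs (2 r) ^ n against r ^ n and the 2 in front of P +
      C.\<close>
    from order_tendstoD(2)[OF this, of "\<epsilon> / 2 ^ Suc ?n"] \<epsilon>
    have "\<forall>\<^sub>F i in sequentially. \<delta> i < \<epsilon> / 2 ^ Suc ?n" by simp
    then obtain i where i: "i \<ge> 1" "\<delta> i < \<epsilon> / 2 ^ Suc ?n"
      unfolding eventually_sequentially by (meson le_add1 le_add2 max.cobounded1 max.cobounded2)
    have \<delta>0: "\<delta> i \<ge> 0"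
      unfolding \<delta>_def by (simp add: power_mono power_le_one)
    have \<delta>\<epsilon>: "\<delta> i * 2 ^ Suc ?n \<le> \<epsilon>" using i(2) by (simp add: field_simps)
    \<comment> \<open>One further doubling gives R + \<beta> \<le> 2 R = 2 ^ (j + k).\<close>
    define k where "k = p + i + 1"
    \<comment> \<open>From 2 ^ j2 on, |c| is at most half of |q| r.\<close>
    obtain j2 :: nat where j2: "2 * norm c / cmod q < 2 ^ j2" using real_arch_pow[of 2] by auto
    show "\<exists>k j1. \<forall>j\<ge>j1.
      (\<integral>\<^sup>+ s. mean_diff q c s * ennreal (1 / s) * indicator {2 ^ j..2 ^ Suc j} s \<partial>lborel) \<le>
      ennreal (C * (\<epsilon> * (Psi (2 ^ (j + k)) + C) + (Psi (2 ^ (j + k)) - Psi (2 ^ (j - l)))))"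
    proof (rule exI[of _ k], rule exI[of _ "max l j2"], intro allI impI)
      fix j assume j: "max l j2 \<le> j"
      define r where "r = (2::real) ^ j"
      define \<beta> where "\<beta> = 2 ^ p * r"
      define R where "R = 2 ^ (p + i) * r"
      define \<alpha> where "\<alpha> = (2::real) ^ (j - l)"
      have r: "r \<ge> 1" "r > 0" by (simp_all add: r_def)
      have \<alpha>r: "\<alpha> = (1 / 2) ^ l * r"
        unfolding \<alpha>_def r_def using j by (simp add: power_diff power_one_over)
      have \<alpha>: "\<alpha> > 0" "\<alpha> \<le> r" "\<alpha> \<le> cmod q / 2 * r"
        using l r by (auto simp: \<alpha>r intro!: mult_right_mono)
      have cq: "norm c \<le> cmod q / 2 * r"
      proof -
        have "(2::real) ^ j2 \<le> r" unfolding r_def using j by (intro power_increasing) auto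
        then have "2 * norm c / cmod q \<le> r" using j2 by simp
        then show ?thesis using q by (simp add: field_simps)
      qed
      have p2: "2 ^ p \<ge> (1::real)" by simp
      have \<beta>r: "(2 + 3 * cmod q) * r \<le> \<beta>" unfolding \<beta>_def using p r by (intro mult_right_mono) auto
      have \<beta>1: "2 * r \<le> \<beta>" using \<beta>r r by (simp add: distrib_right) (smt (verit) norm_ge_zero mult_nonneg_nonneg)
      have R\<beta>: "R = 2 ^ i * \<beta>" by (simp add: R_def \<beta>_def power_add mult_ac)
      have i2: "(2::real) \<le> 2 ^ i" using i(1) power_increasing[of 1 i "2::real"] by simp
      have \<beta>pos: "\<beta> \<ge> 1" "\<beta> > 0" using \<beta>1 r by auto
      have R2: "2 * \<beta> \<le> R" unfolding R\<beta> using i2 \<beta>pos by (intro mult_right_mono) auto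
      have sub: "norm (c + q *s z) \<in> {\<alpha>..\<beta>}" if "norm z \<in> {r..2 * r}" for z :: "complex ^ 'm"
      proof -
        have qz: "cmod q * r \<le> norm (q *s z)" "norm (q *s z) \<le> cmod q * (2 * r)"
          using that by (auto simp: norm_vector_scalar intro!: mult_left_mono)
        have "norm (q *s z) - norm c \<le> norm (c + q *s z)"
          using norm_diff_ineq[of "q *s z" c] by (simp add: add.commute)
        moreover have "norm (c + q *s z) \<le> norm c + norm (q *s z)" by (rule norm_triangle_ineq)
        moreover have "cmod q * (2 * r) + cmod q / 2 * r \<le> \<beta>"
        proof -
          have "0 \<le> cmod q * r" using r by simp
          then have "cmod q * (2 * r) + cmod q / 2 * r \<le> (2 + 3 * cmod q) * r"
            unfolding distrib_right using r by linarith
          also have "\<dots> \<le> \<beta>" by (rule \<beta>r)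
          finally show ?thesis .
        qed
        moreover have "cmod q * r - cmod q / 2 * r = cmod q / 2 * r" by simp
        ultimately show ?thesis unfolding atLeastAtMost_iff using qz cq \<alpha>(3) by linarith
      qed
      have top: "R + \<beta> \<le> 2 ^ (j + k)"
      proof -
        have "R + \<beta> \<le> 2 * R" using R2 \<beta>pos by simp
        also have "\<dots> = 2 ^ (j + k)" by (simp add: R_def r_def k_def power_add)
        finally show ?thesis .
      qed
      have ratio: "shell_ratio R \<beta> = \<delta> i"
      proof -
        have 1: "R + \<beta> = R * (1 + (1 / 2) ^ i)" "R - \<beta> = R * (1 - (1 / 2) ^ i)"
          unfolding R\<beta> by (simp_all add: distrib_left right_diff_distrib power_one_over)
        have "R ^ ?n \<noteq> 0" using R2 \<beta>pos by simp
        then show ?thesis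
          unfolding shell_ratio_def \<delta>_def 1 power_mult_distrib right_diff_distrib[symmetric]
          by (rule nonzero_mult_div_cancel_left)
      qed
      define P where "P = Psi (2 ^ (j + k))"
      have P: "P \<ge> 0" unfolding P_def by (rule Psi_nonneg) simp
      have tot: "total (R + \<beta>) (R - \<beta>) \<le> 2 * P + C"
      proof -
        have "total (R + \<beta>) (R - \<beta>) \<le> total (2 ^ (j + k)) 1"
          using top R2 \<beta>pos by (intro total_mono) auto
        also have "\<dots> = 2 * (U.Mean (2 ^ (j + k)) - U.Mean 1) + K0" by (simp add: total_def K0_def)
        also have "\<dots> \<le> 2 * P + C"
          using C A0.Mean_mono[of 1 "2 ^ (j + k)"] A1.Mean_mono[of 1 "2 ^ (j + k)"] by (simp add: P_def Psi_def)
        finally show ?thesis .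
      qed
      have dif: "(A0.Mean (R + \<beta>) - A0.Mean \<alpha>) + (A1.Mean (R + \<beta>) - A1.Mean \<alpha>) \<le> P - Psi \<alpha>"
      proof -
        have "0 < R + \<beta>" "\<alpha> \<le> R + \<beta>" using R2 \<beta>pos \<alpha> \<beta>1 by auto
        then show ?thesis
          using U.Mean_mono[of \<alpha> "2 ^ (j + k)"] A0.Mean_mono[OF _ top] A1.Mean_mono[OF _ top] top \<alpha>
          by (simp add: P_def Psi_def)
      qed
      have dif0: "0 \<le> P - Psi \<alpha>" unfolding P_def using \<alpha>(1) top R2 \<beta>pos \<alpha>(2) \<beta>1
        by (simp add: Psi_mono)
      define I where "I = (\<integral>\<^sup>+ s. mean_diff q c s * ennreal (1 / s) * indicator {r..2 * r} s \<partial>lborel)"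
      have "ennreal (?n * r ^ ?n) * I \<le> ennreal ((2 * r) ^ ?n * (shell_ratio R \<beta> * total (R + \<beta>) (R - \<beta>)) +
        (1 + 1 / cmod q ^ ?n) * \<beta> ^ ?n *
        ((A0.Mean (R + \<beta>) - A0.Mean \<alpha>) + (A1.Mean (R + \<beta>) - A1.Mean \<alpha>)))"
        unfolding I_def using R2 \<beta>pos
        by (intro order_trans[OF mean_diff_block[OF r(2)] shell_difference[OF q \<alpha>(1,2) \<beta>1 _ sub]]) auto
      also have "\<dots> \<le> ennreal (?n * r ^ ?n * (C * (\<epsilon> * (P + C) + (P - Psi \<alpha>))))"
      proof (rule ennreal_leI)
        have "(2 * r) ^ ?n * (shell_ratio R \<beta> * total (R + \<beta>) (R - \<beta>)) \<le> (2 * r) ^ ?n * (\<delta> i * (2 * (P + C)))"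
          unfolding ratio using tot \<delta>0 r C by (intro mult_left_mono) auto
        also have "\<dots> = r ^ ?n * ((\<delta> i * 2 ^ Suc ?n) * (P + C))"
          by (simp add: power_mult_distrib)
        also have "\<dots> \<le> r ^ ?n * (\<epsilon> * (P + C))"
          using \<delta>\<epsilon> P C r by (intro mult_left_mono mult_right_mono) auto
        also have "\<dots> \<le> r ^ ?n * (C * (\<epsilon> * (P + C)))"
          using mult_right_mono[OF C(1), of "\<epsilon> * (P + C)"] \<epsilon> P C r by (intro mult_left_mono) auto
        finally have 1: "(2 * r) ^ ?n * (shell_ratio R \<beta> * total (R + \<beta>) (R - \<beta>)) \<le> r ^ ?n * (C * (\<epsilon> * (P + C)))" .
        have "(1 + 1 / cmod q ^ ?n) * \<beta> ^ ?n * ((A0.Mean (R + \<beta>) - A0.Mean \<alpha>) + (A1.Mean (R + \<beta>) - A1.Mean \<alpha>)) \<le>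
            (1 + 1 / cmod q ^ ?n) * \<beta> ^ ?n * (P - Psi \<alpha>)"
          using dif \<beta>pos by (intro mult_left_mono) (auto intro!: mult_nonneg_nonneg add_nonneg_nonneg)
        also have "\<dots> = r ^ ?n * (Q * (P - Psi \<alpha>))"
          by (simp add: Q_def \<beta>_def power_mult_distrib mult_ac)
        also have "\<dots> \<le> r ^ ?n * (C * (P - Psi \<alpha>))"
          using C dif0 r by (intro mult_left_mono mult_right_mono) auto
        finally have 2: "(1 + 1 / cmod q ^ ?n) * \<beta> ^ ?n * ((A0.Mean (R + \<beta>) - A0.Mean \<alpha>) + (A1.Mean (R + \<beta>) - A1.Mean \<alpha>)) \<le> r ^ ?n * (C * (P - Psi \<alpha>))" .
        define Y where "Y = r ^ ?n * (C * (\<epsilon> * (P + C) + (P - Psi \<alpha>)))"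
        have Y: "Y \<ge> 0" unfolding Y_def using C P dif0 \<epsilon> r by (intro mult_nonneg_nonneg add_nonneg_nonneg) auto
        \<comment> \<open>The factor n = 2 m from polar coordinates is at least 1 and may be
          inserted.\<close>
        have "Y \<le> ?n * Y" using n Y mult_right_mono[OF n Y] by simp
        then show "(2 * r) ^ ?n * (shell_ratio R \<beta> * total (R + \<beta>) (R - \<beta>)) +
            (1 + 1 / cmod q ^ ?n) * \<beta> ^ ?n * ((A0.Mean (R + \<beta>) - A0.Mean \<alpha>) + (A1.Mean (R + \<beta>) - A1.Mean \<alpha>)) \<le>
            ?n * r ^ ?n * (C * (\<epsilon> * (P + C) + (P - Psi \<alpha>)))"
          using 1 2 unfolding Y_def by (simp only: distrib_left mult.assoc)
      qed
      also have "\<dots> = ennreal (?n * r ^ ?n) * ennreal (C * (\<epsilon> * (P + C) + (P - Psi \<alpha>)))"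
        using r by (intro ennreal_mult') simp
      finally have "I \<le> ennreal (C * (\<epsilon> * (P + C) + (P - Psi \<alpha>)))"
        using n r by (subst (asm) ennreal_mult_le_mult_iff) auto
      then show "(\<integral>\<^sup>+ s. mean_diff q c s * ennreal (1 / s) * indicator {2 ^ j..2 ^ Suc j} s \<partial>lborel) \<le>
        ennreal (C * (\<epsilon> * (Psi (2 ^ (j + k)) + C) + (Psi (2 ^ (j + k)) - Psi (2 ^ (j - l)))))"
        unfolding I_def P_def \<alpha>_def r_def by simp
    qed
  qed
qed

end

section \<open>Nevanlinna functions as multiples of means, and the conclusion\<close>

lemma scale_measure_eq_density: "scale_measure c M = density M (\<lambda>_. c)"
  by (rule measure_eqI) (auto simp: emeasure_density_const)

text \<open>The factor n r^(n-1) of surface measure cancels the decay \<kappa> / r^(n-1) of the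
  density, n = 2 m, so K = n \<kappa> is the same at every radius. The Borel function g' stands in
  for an integrand known almost everywhere.\<close>

lemma sphere_integral_eta_form:
  obtains K where "\<And>r g g'. r > 0 \<Longrightarrow> g' \<in> borel_measurable borel \<Longrightarrow>
      AE z in cone_measure r. g z = g' z \<Longrightarrow>
      sphere_integral r g (eta_form :: complex ^ 'm::finite \<Rightarrow> 'm form) = K * (LINT z|cone_measure r. g' z)"
proof -
  obtain \<kappa> where \<kappa>: "\<And>z :: complex ^ 'm. z \<noteq> 0 \<Longrightarrow>
      sphere_density eta_form z = \<kappa> / norm z ^ (2 * CARD('m) - 1)"
    using sphere_density_eta_form_const by metis
  show thesis
  proof (rule that)
    fix r :: real and g g' :: "complex ^ 'm \<Rightarrow> real"
    assume r: "r > 0" and g' [measurable]: "g' \<in> borel_measurable borel"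
      and ae: "AE z in cone_measure r. g z = g' z"
    let ?n = "2 * CARD('m)"
    define G where "G z = g' z * (\<kappa> / r ^ (?n - 1))" for z
    have [measurable]: "G \<in> borel_measurable borel" unfolding G_def by measurable
    have dim: "DIM(complex ^ 'm) = ?n" by simp
    have sm: "(sphere_measure r :: (complex ^ 'm) measure) = scale_measure (ennreal (?n * r ^ (?n - 1))) (cone_measure r)"
      using sphere_measure_eq_cone_measure[OF r, where 'a = "complex ^ 'm"] unfolding dim .
    have "AE z in cone_measure r. g z * sphere_density eta_form z = G z"
    proof -
      have "AE z in cone_measure r. norm (z :: complex ^ 'm) = r" by (rule AE_cone_measure[OF r])
      with ae show ?thesis
      proof eventually_elim
        case (elim z)
        then have "z \<noteq> 0" using r by auto
        then show ?case using elim by (simp add: G_def \<kappa>)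
      qed
    qed
    then have "AE z in sphere_measure r. g z * sphere_density eta_form z = G z"
      unfolding sm scale_measure_eq_density by (subst AE_density) auto
    then have "sphere_integral r g eta_form = (LINT z|sphere_measure r. G z)"
      unfolding sphere_integral_def by (intro integral_completion_AE) (simp add: sm)
    also have "\<dots> = ?n * r ^ (?n - 1) * (LINT z|cone_measure r. G z)"
      unfolding sm using r by (intro integral_scale_measure) auto
    also have "\<dots> = ?n * \<kappa> * (LINT z|cone_measure r. g' z)"
      unfolding G_def using r by simp
    finally show "sphere_integral r g eta_form = ?n * \<kappa> * (LINT z|cone_measure r. g' z)" .
  qed
qed

context meromorphic_pair
begin

text \<open>\<open>Mean_at_top\<close> needs a function that vanishes at 0: f0 if it does, otherwise
  f1 - a f0 with a = f1 0 / f0 0, which is not identically 0 by nonconstancy. Its logarithm exceeds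
  that of the norm by at most the constant B.\<close>

lemma norm_Mean_at_top:
  assumes nonconst: "\<not> (\<exists>a. \<forall>z. f1 z = a * f0 z)"
  shows "filterlim U.Mean at_top at_top"
proof -
  \<comment> \<open>The two alternatives of the bound belong to F = f1 - a f0 and to F = f0.\<close>
  have "\<exists>b. \<exists>F. entire_Cm F \<and> F 0 = 0 \<and> (\<exists>z. F z \<noteq> 0) \<and> (\<forall>z. cmod (F z) \<le> cmod (f1 z) + b * cmod (f0 z) \<or> cmod (F z) \<le> cmod (f0 z)) \<and> b \<ge> 0"
  proof (cases "f0 0 = 0")
    case True
    then show ?thesis using entire0 nonzero0 by (intro exI[of _ 0] exI[of _ f0]) auto
  next
    case False
    define a where "a = f1 0 / f0 0"
    have "entire_Cm (\<lambda>z. f1 z - a * f0 z)"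
      unfolding holomorphic_Cm_def
    proof
      fix z
      obtain D0 where D0: "(f0 has_derivative D0) (at z)" "\<forall>a v. D0 (a *s v) = a * D0 v"
        using entire0 unfolding holomorphic_Cm_def by blast
      obtain D1 where D1: "(f1 has_derivative D1) (at z)" "\<forall>a v. D1 (a *s v) = a * D1 v"
        using entire1 unfolding holomorphic_Cm_def by blast
      have "((\<lambda>z. f1 z - a * f0 z) has_derivative (\<lambda>v. D1 v - a * D0 v)) (at z)"
        by (intro has_derivative_diff D1 has_derivative_mult_right D0)
      moreover have "\<forall>b v. D1 (b *s v) - a * D0 (b *s v) = b * (D1 v - a * D0 v)"
        using D0 D1 by (simp add: algebra_simps)
      ultimately show "\<exists>D. ((\<lambda>z. f1 z - a * f0 z) has_derivative D) (at z) \<and> (\<forall>a v. D (a *s v) = a * D v)"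
        by blast
    qed
    moreover have "f1 0 - a * f0 0 = 0" using False by (simp add: a_def)
    moreover have "\<exists>z. f1 z - a * f0 z \<noteq> 0" using nonconst by auto
    moreover have "cmod (f1 z - a * f0 z) \<le> cmod (f1 z) + cmod a * cmod (f0 z)" for z
      using norm_triangle_ineq4[of "f1 z" "a * f0 z"] by (simp add: norm_mult)
    ultimately show ?thesis by (intro exI[of _ "cmod a"] exI[of _ "\<lambda>z. f1 z - a * f0 z"]) auto
  qed
  then obtain b F where F: "entire_Cm F" "F 0 = 0" "\<exists>z. F z \<noteq> 0" "b \<ge> 0"
    and le: "\<And>z. cmod (F z) \<le> cmod (f1 z) + b * cmod (f0 z) \<or> cmod (F z) \<le> cmod (f0 z)" by blast
  interpret F: nonzero_entire_pair F "\<lambda>_. 0"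
  proof unfold_locales
    show "\<exists>p. entire_pair.nsq F (\<lambda>_. 0) p \<noteq> 0"
    proof -
      interpret P: entire_pair F "\<lambda>_. 0" by unfold_locales (rule F(1) entire_Cm_zero)+
      show ?thesis using F(3) by (auto simp: P.nsq_def)
    qed
  qed (rule F(1) entire_Cm_zero)+
  define B where "B = ln (2 * (1 + b\<^sup>2)) / 2"
  have nsq_le: "F.nsq z \<le> 2 * (1 + b\<^sup>2) * U.nsq z" for z
  proof -
    have "(x + b * y)\<^sup>2 \<le> 2 * (1 + b\<^sup>2) * (y\<^sup>2 + x\<^sup>2)" for x y :: real
    proof -
      have "2 * (1 + b\<^sup>2) * (y\<^sup>2 + x\<^sup>2) - (x + b * y)\<^sup>2 = (x - b * y)\<^sup>2 + 2 * y\<^sup>2 + 2 * (b * x)\<^sup>2"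
        by (simp add: power2_eq_square algebra_simps)
      moreover have "0 \<le> (x - b * y)\<^sup>2 + 2 * y\<^sup>2 + 2 * (b * x)\<^sup>2"
        by (intro add_nonneg_nonneg) auto
      ultimately show ?thesis by linarith
    qed
    note sq = this
    show ?thesis
      using le[of z]
    proof
      assume "cmod (F z) \<le> cmod (f1 z) + b * cmod (f0 z)"
      then have "(cmod (F z))\<^sup>2 \<le> (cmod (f1 z) + b * cmod (f0 z))\<^sup>2" by (intro power_mono) auto
      then show ?thesis using sq[of "cmod (f1 z)" "cmod (f0 z)"] by (simp add: F.nsq_def U.nsq_def)
    next
      assume "cmod (F z) \<le> cmod (f0 z)"
      then have "(cmod (F z))\<^sup>2 \<le> (cmod (f0 z))\<^sup>2" by (intro power_mono) auto
      moreover have "(cmod (f0 z))\<^sup>2 \<le> 1 * U.nsq z" by (simp add: U.nsq_def)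
      moreover have "1 * U.nsq z \<le> 2 * (1 + b\<^sup>2) * U.nsq z"
        by (intro mult_right_mono U.nsq_nonneg) auto
      ultimately have "(cmod (F z))\<^sup>2 \<le> 2 * (1 + b\<^sup>2) * U.nsq z" by linarith
      then show ?thesis by (simp add: F.nsq_def)
    qed
  qed
  have le_Mean: "F.Mean s - B * unit_vol TYPE('m) \<le> U.Mean s" if s: "s > 0" for s
  proof -
    interpret fm: finite_measure "cone_measure s :: (complex ^ 'm) measure" by (rule finite_measure_cone_measure)
    have "F.Mean s \<le> (LINT z|cone_measure s. U.ulog z + B)"
      unfolding F.Mean_def
    proof (rule integral_mono_AE[OF F.integrable_ulog_cone_measure[OF s]])
      show "integrable (cone_measure s) (\<lambda>z. U.ulog z + B)"
        using U.integrable_ulog_cone_measure[OF s] by simp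
      show "AE z in cone_measure s. F.ulog z \<le> U.ulog z + B"
        using F.AE_cone_nsq_nonzero[OF s] U.AE_cone_nsq_nonzero[OF s]
      proof eventually_elim
        case (elim z)
        have p: "F.nsq z > 0" "U.nsq z > 0"
          using elim F.nsq_nonneg[of z] U.nsq_nonneg[of z] by auto
        have c: "0 < 2 * (1 + b\<^sup>2)" by (simp add: add_pos_nonneg)
        have "ln (F.nsq z) \<le> ln (2 * (1 + b\<^sup>2) * U.nsq z)" using nsq_le[of z] p by (intro ln_mono) auto
        also have "\<dots> = ln (2 * (1 + b\<^sup>2)) + ln (U.nsq z)" using c p by (intro ln_mult_pos)
        finally show ?case by (simp add: F.ulog_def U.ulog_def B_def)
      qed
    qed
    also have "\<dots> = U.Mean s + B * unit_vol TYPE('m)"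
      using U.integrable_ulog_cone_measure[OF s] by (simp add: U.Mean_def measure_cone_measure_UNIV)
    finally show ?thesis by simp
  qed
  have "filterlim F.Mean at_top at_top" by (rule F.Mean_at_top) (simp add: F.nsq_def F(2))
  then have "filterlim (\<lambda>s. - (B * unit_vol TYPE('m)) + F.Mean s) at_top at_top"
    by (rule filterlim_tendsto_add_at_top[OF tendsto_const])
  then show ?thesis
    by (rule filterlim_at_top_mono)
      (use le_Mean in \<open>auto intro!: eventually_mono[OF eventually_gt_at_top[of 0]]\<close>)
qed

lemma Psi_le:
  assumes r: "r \<ge> 1"
  shows "Psi r \<le> 3 * (U.Mean r - U.Mean 1) + (2 * U.Mean 1 - A0.Mean 1 - A1.Mean 1)"
  using Mean_le_norm[of r] r by (simp add: Psi_def)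

lemma log_plus_quotient:
  assumes nz: "f0 z \<noteq> 0" "f1 z \<noteq> 0" "f0 w \<noteq> 0" "f1 w \<noteq> 0"
  shows "log_plus (cmod ((f1 w / f0 w) / (f1 z / f0 z))) = max (Lquot w - Lquot z) 0"
proof -
  have "ln (cmod ((f1 w / f0 w) / (f1 z / f0 z))) = Lquot w - Lquot z"
    using nz by (simp add: norm_divide norm_mult ln_div ln_mult Lquot_def ulog_eq)
  then show ?thesis by (simp add: log_plus_def)
qed

end

theorem theorem3p2:
  fixes f f0 f1 :: "complex ^ 'm::finite \<Rightarrow> complex"
    and q c :: "complex ^ 'm" and qt :: complex
  assumes "meromorphic_Cm f"
    and "reduced_representation f f0 f1"
    and "\<not> (\<exists>a. \<forall>z. f0 z \<noteq> 0 \<longrightarrow> f z = a)"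
    and "growth_order (characteristic f0 f1) = 0"
    and "q = (\<chi> j. qt)" and "qt \<noteq> 0" and "qt \<noteq> 1"
  shows "(\<forall>r>0. proximity r (\<lambda>z. f ((\<chi> j. q $ j * z $ j) + c) / f z)
            = sphere_integral r
                (\<lambda>z. log_plus (cmod (f (\<chi> j. qt * z $ j + c $ j) / f z))) eta_form)
       \<and> (\<exists>E. log_density_one E \<and>
            (\<lambda>r. proximity r (\<lambda>z. f ((\<chi> j. q $ j * z $ j) + c) / f z))
              \<in> o[inf at_top (principal E)](characteristic f0 f1))"
proof -
  have arg: "(\<chi> j. q $ j * z $ j) + c = c + qt *s z" "(\<chi> j. qt * z $ j + c $ j) = c + qt *s z" for z :: "complex ^ 'm"
    using assms(5) by (simp_all add: vec_eq_iff)
  have rep: "entire_Cm f0" "entire_Cm f1" "\<exists>z. f0 z \<noteq> 0" "\<And>z. f0 z \<noteq> 0 \<Longrightarrow> f z = f1 z / f0 z"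
    using assms(2) unfolding reduced_representation_def by auto
  \<comment> \<open>If f1 vanished identically, f would be the constant 0 off the zeros of
    f0.\<close>
  have nz1: "\<exists>z. f1 z \<noteq> 0" using assms(3) rep(4) by (metis div_0)
  have nonconst: "\<not> (\<exists>a. \<forall>z. f1 z = a * f0 z)"
  proof
    assume "\<exists>a. \<forall>z. f1 z = a * f0 z"
    then obtain a where "\<And>z. f1 z = a * f0 z" by blast
    then have "\<forall>z. f0 z \<noteq> 0 \<longrightarrow> f z = a" using rep(4) by simp
    then show False using assms(3) by blast
  qed
  interpret P: meromorphic_pair f0 f1 by unfold_locales (use rep nz1 in auto)
  \<comment> \<open>Supplies the nonvanishing of the shifted functions at almost every point of each
    sphere.\<close>
  interpret S: meromorphic_pair "\<lambda>z. f0 (c + qt *s z)" "\<lambda>z. f1 (c + qt *s z)"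
  proof
    have "\<exists>z'. c + qt *s z' = z" for z
      using assms(6) by (intro exI[of _ "inverse qt *s (z - c)"]) (simp add: vector_smult_assoc)
    then show "\<exists>z. f0 (c + qt *s z) \<noteq> 0" "\<exists>z. f1 (c + qt *s z) \<noteq> 0"
      using rep(3) nz1 by metis+
  qed (rule entire_Cm_affine rep)+
  obtain K where K: "\<And>r g g'. r > 0 \<Longrightarrow> g' \<in> borel_measurable borel \<Longrightarrow>
      AE z in cone_measure r. g z = g' z \<Longrightarrow>
      sphere_integral r g (eta_form :: complex ^ 'm \<Rightarrow> 'm form) = K * (LINT z|cone_measure r. g' z)"
    using sphere_integral_eta_form by blast
  define T where "T r = P.U.Mean r - P.U.Mean 1" for r
  define D where "D z = max (P.Lquot (c + qt *s z) - P.Lquot z) 0" for z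
  have [measurable]: "D \<in> borel_measurable borel"
  proof -
    have [measurable]: "(\<lambda>z :: complex ^ 'm. c + qt *s z) \<in> borel_measurable borel"
      by (intro borel_measurable_continuous_onI continuous_intros)
    show ?thesis unfolding D_def by measurable
  qed
  have char: "characteristic f0 f1 r = K * T r" if r: "r > 0" for r
  proof -
    have *: "sphere_integral s (\<lambda>z. ln (sqrt ((cmod (f0 z))\<^sup>2 + (cmod (f1 z))\<^sup>2))) eta_form = K * P.U.Mean s"
      if "s > 0" for s
      unfolding P.ulog_norm_eq[symmetric] P.U.Mean_def by (rule K[OF that]) auto
    show ?thesis unfolding characteristic_def using *[of 1] *[OF r] by (simp add: T_def right_diff_distrib)
  qed
  have prox: "proximity r (\<lambda>z. f ((\<chi> j. q $ j * z $ j) + c) / f z) = K * (LINT z|cone_measure r. D z)" if r: "r > 0" for r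
    unfolding proximity_def arg
  proof (rule K[OF r])
    show "AE z in cone_measure r. log_plus (cmod (f (c + qt *s z) / f z)) = D z"
      using P.AE_cone_nonzero[OF r] S.AE_cone_nonzero[OF r]
    proof eventually_elim
      case (elim z)
      then show ?case using P.log_plus_quotient[of z "c + qt *s z"] by (simp add: rep(4) D_def)
    qed
  qed measurable
  have prox_le: "(LINT z|cone_measure r. D z) \<le> x" if "P.mean_diff qt c r \<le> ennreal x" "x \<ge> 0" for r x
  proof -
    have "(LINT z|cone_measure r. D z) = enn2real (\<integral>\<^sup>+ z. ennreal (D z) \<partial>cone_measure r)"
      by (rule integral_eq_nn_integral) (measurable, auto simp: D_def)
    also have "\<dots> \<le> x"
    proof (rule enn2real_leI[OF that(2)])
      have "(\<integral>\<^sup>+ z. ennreal (D z) \<partial>cone_measure r) \<le> P.mean_diff qt c r"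
        unfolding P.mean_diff_def by (intro nn_integral_mono ennreal_leI) (simp add: D_def)
      then show "(\<integral>\<^sup>+ z. ennreal (D z) \<partial>cone_measure r) \<le> ennreal x" using that(1) by (rule order_trans)
    qed
    finally show ?thesis .
  qed
  have prox_ge: "0 \<le> (LINT z|cone_measure r. D z)" for r
    by (intro integral_nonneg_AE AE_I2) (simp add: D_def)
  have "\<exists>E. log_density_one E \<and> (\<lambda>r. proximity r (\<lambda>z. f ((\<chi> j. q $ j * z $ j) + c) / f z))
              \<in> o[inf at_top (principal E)](characteristic f0 f1)"
  \<comment> \<open>K was never computed. If it were 0, proximity function and characteristic would
    both vanish for r > 0 and the relation would be trivial.\<close>
  proof (cases "K = 0")
    case True
    have "\<forall>\<^sub>F r in inf at_top (principal {1..}). proximity r (\<lambda>z. f ((\<chi> j. q $ j * z $ j) + c) / f z) = 0"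
      unfolding eventually_inf_principal by (auto simp: prox True intro!: eventually_mono[OF eventually_gt_at_top[of 0]])
    then show ?thesis using log_density_one_atLeast
      by (intro exI[of _ "{1..}"] conjI landau_o.smallI) (auto elim!: eventually_mono)
  next
    case False
    have T_top: "filterlim T at_top at_top"
      using filterlim_tendsto_add_at_top[OF tendsto_const P.norm_Mean_at_top[OF nonconst], of "- P.U.Mean 1"]
      by (simp add: T_def[abs_def])
    define C1 where "C1 = 2 * P.U.Mean 1 - P.A0.Mean 1 - P.A1.Mean 1"
    have T_ge: "\<forall>\<^sub>F r in at_top. T r \<ge> x" for x using T_top unfolding filterlim_at_top by blast
    have Psi_T: "T r \<le> P.Psi r" if "r \<ge> 1" for r
      using P.A0.Mean_mono[of 1 r] P.A1.Mean_mono[of 1 r] that by (simp add: T_def P.Psi_def)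
    have Psi_top: "filterlim P.Psi at_top at_top"
      using T_top by (rule filterlim_at_top_mono) (use Psi_T in \<open>auto intro!: eventually_mono[OF eventually_ge_at_top[of 1]]\<close>)
    \<comment> \<open>Psi is at most 3 T + C1, and T eventually reaches C1.\<close>
    have Psi_4T: "\<forall>\<^sub>F r in at_top. P.Psi r \<le> 4 * T r"
      using T_ge[of C1] eventually_ge_at_top[of 1]
    proof eventually_elim
      case (elim r)
      then show ?case using P.Psi_le[of r] by (simp add: T_def C1_def)
    qed
    \<comment> \<open>The order is that of K T; the constants ln \<bar>K\<bar> and ln 4 are absorbed
      in half of e ln r.\<close>
    have order: "\<forall>\<^sub>F r in at_top. ln (P.Psi r) \<le> e * ln r" if e: "e > 0" for e
    proof -
      have "Limsup at_top (\<lambda>r. ereal (log_plus (characteristic f0 f1 r) / ln r)) < ereal (e / 2)"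
        using assms(4) e by (simp add: growth_order_def)
      then have "\<forall>\<^sub>F r in at_top. ereal (log_plus (characteristic f0 f1 r) / ln r) < ereal (e / 2)"
        by (rule Limsup_lessD)
      moreover have "\<forall>\<^sub>F r in at_top. (2 / e) * (ln 4 - ln \<bar>K\<bar>) \<le> ln r"
        using ln_at_top unfolding filterlim_at_top by blast
      ultimately show ?thesis
        using Psi_4T T_ge[of 1] eventually_gt_at_top[of 1]
      proof eventually_elim
        case (elim r)
        have lr: "ln r > 0" using elim by simp
        have "log_plus (K * T r) / ln r < e / 2" using elim by (simp add: char)
        then have "log_plus (K * T r) < e / 2 * ln r" using lr by (simp add: field_simps)
        moreover have "ln (K * T r) \<le> log_plus (K * T r)" by (simp add: log_plus_def)
        \<comment> \<open>Valid for negative K too, as the real \<open>ln\<close> satisfies ln (- x)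
          = ln x.\<close>
        moreover have "ln (K * T r) = ln \<bar>K\<bar> + ln (T r)"
        proof -
          have "ln (K * T r) = ln (\<bar>K\<bar> * T r)"
            using ln_minus[of "K * T r"] by (cases "K \<ge> 0") auto
          also have "\<dots> = ln \<bar>K\<bar> + ln (T r)" using False elim by (intro ln_mult_pos) auto
          finally show ?thesis .
        qed
        moreover have "ln (P.Psi r) \<le> ln 4 + ln (T r)"
        proof -
          have "P.Psi r > 0" using Psi_T[of r] elim by simp
          then have "ln (P.Psi r) \<le> ln (4 * T r)" using elim by (intro ln_mono) auto
          also have "\<dots> = ln 4 + ln (T r)" using elim by (intro ln_mult_pos) auto
          finally show ?thesis .
        qed
        moreover have "ln 4 - ln \<bar>K\<bar> \<le> e / 2 * ln r" using elim e by (simp add: field_simps)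
        ultimately show ?case by (simp add: field_simps)
      qed
    qed
    obtain C l where C: "C \<ge> 0" and blocks: "\<And>\<epsilon>. \<epsilon> > 0 \<Longrightarrow> \<exists>k j1. \<forall>j\<ge>j1.
      (\<integral>\<^sup>+ s. P.mean_diff qt c s * ennreal (1 / s) * indicator {2 ^ j..2 ^ Suc j} s \<partial>lborel) \<le>
      ennreal (C * (\<epsilon> * (P.Psi (2 ^ (j + k)) + C) + (P.Psi (2 ^ (j + k)) - P.Psi (2 ^ (j - l)))))"
      by (rule P.mean_diff_blocks[OF assms(6), of c]) blast
    obtain E where E: "log_density_one E"
      "\<And>e. e > 0 \<Longrightarrow> \<exists>r0. \<forall>r\<in>E. r \<ge> r0 \<longrightarrow> P.mean_diff qt c r \<le> ennreal (e * P.Psi r)"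
      by (rule log_density_one_from_blocks[of "P.mean_diff qt c" P.Psi, OF _ _ Psi_top order C blocks])
        (auto intro: P.Psi_mono)
    have "(\<lambda>r. proximity r (\<lambda>z. f ((\<chi> j. q $ j * z $ j) + c) / f z)) \<in> o[inf at_top (principal E)](characteristic f0 f1)"
    proof (rule landau_o.smallI)
      fix e :: real assume e: "e > 0"
      \<comment> \<open>The quarter compensates the factor 4 in \<open>Psi_4T\<close>.\<close>
      obtain r0 where r0: "\<And>r. r \<in> E \<Longrightarrow> r \<ge> r0 \<Longrightarrow> P.mean_diff qt c r \<le> ennreal (e / 4 * P.Psi r)"
        using E(2)[of "e / 4"] e by auto
      show "\<forall>\<^sub>F r in inf at_top (principal E). norm (proximity r (\<lambda>z. f ((\<chi> j. q $ j * z $ j) + c) / f z)) \<le> e * norm (characteristic f0 f1 r)"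
        unfolding eventually_inf_principal
        using Psi_4T T_ge[of 1] eventually_ge_at_top[of "max r0 1"]
      proof eventually_elim
        case (elim r)
        show ?case
        proof
          assume "r \<in> E"
          then have "P.mean_diff qt c r \<le> ennreal (e / 4 * P.Psi r)" using elim by (intro r0) auto
          then have "(LINT z|cone_measure r. D z) \<le> e / 4 * P.Psi r"
            using e P.Psi_nonneg[of r] elim by (intro prox_le) auto
          also have "\<dots> \<le> e / 4 * (4 * T r)" using e elim by (intro mult_left_mono) auto
          finally have "\<bar>K\<bar> * (LINT z|cone_measure r. D z) \<le> \<bar>K\<bar> * (e * T r)"
            by (intro mult_left_mono) auto
          then show "norm (proximity r (\<lambda>z. f ((\<chi> j. q $ j * z $ j) + c) / f z)) \<le> e * norm (characteristic f0 f1 r)"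
            using elim prox_ge[of r] prox[of r] char[of r] by (simp add: abs_mult mult.left_commute)
        qed
      qed
    qed
    then show ?thesis using E(1) by blast
  qed
  then show ?thesis unfolding proximity_def arg by blast
qed

end
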